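(* Let $N\ge3$ and let $\Omega\subset\mathbb{R}^N$ be a bounded domain containing $0$. For every $u\in\mathcal{H}(\Omega)$, $$\|u\|_{\mathcal{H}}^2=\lim_{\varepsilon\to0}\Big(I_{B_\varepsilon^c}[u]-\Lambda_\varepsilon(u)\Big).$$
   Context: $\widetilde{\mathcal H}=W^{1,2}_0(|x|^{-(N-2)}dx,\Omega)$ is the completion of $C_0^\infty(\Omega)$ under the norm $\|v\|_{\widetilde{\mathcal H}}^2=\int_\Omega|x|^{-(N-2)}|\nabla v|^2\,dx$. The space $\mathcal H=\mathcal H(\Omega)$ is its isometric image under $v\mapsto u=|x|^{-(N-2)/2}v$, i.e. the completion of $\{|x|^{-(N-2)/2}v: v\in C_0^\infty(\Omega)\}$ under the norm $\|u\|_{\mathcal H}^2=\int_\Omega|x|^{-(N-2)}\big|\nabla(|x|^{\frac{N-2}{2}}u)\big|^2dx$. $B_\varepsilon$ is the ball of radius $\varepsilon$ centered at the origin, $B_\varepsilon^c=\Omega\setminus B_\varepsilon$, $S_\varepsilon=\partial B_\varepsilon$, and $dS$ is surface measure. For small $\varepsilon>0$, $$I_{B_\varepsilon^c}[u]=\int_{B_\varepsilon^c}|\nabla u|^2dx-\Big(\frac{N-2}{2}\Big)^2\int_{B_\varepsilon^c}\frac{u^2}{|x|^2}dx,\qquad \Lambda_\varepsilon(u)=\frac{N-2}{2}\,\varepsilon^{-1}\int_{S_\varepsilon}u^2\,dS .$$ *)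

theory Defs
  imports "HOL-Analysis.Analysis"
begin

section \<open>Test functions and weak gradients\<close>

primrec Ck :: "nat \<Rightarrow> ('a::euclidean_space \<Rightarrow> real) \<Rightarrow> bool" where
  "Ck 0 f \<longleftrightarrow> continuous_on UNIV f"
| "Ck (Suc k) f \<longleftrightarrow> (\<forall>x. f differentiable (at x)) \<and>
     (\<forall>b\<in>Basis. Ck k (\<lambda>x. frechet_derivative f (at x) b))"

definition test_functions :: "'a::euclidean_space set \<Rightarrow> ('a \<Rightarrow> real) set" where
  "test_functions U = {\<phi>. (\<forall>k. Ck k \<phi>) \<and>
     compact (closure {x. \<phi> x \<noteq> 0}) \<and> closure {x. \<phi> x \<noteq> 0} \<subseteq> U}"

definition grad :: "('a::euclidean_space \<Rightarrow> real) \<Rightarrow> 'a \<Rightarrow> 'a" where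
  "grad f x = (\<Sum>b\<in>Basis. frechet_derivative f (at x) b *\<^sub>R b)"

definition is_weak_gradient ::
    "'a::euclidean_space set \<Rightarrow> ('a \<Rightarrow> real) \<Rightarrow> ('a \<Rightarrow> 'a) \<Rightarrow> bool" where
  "is_weak_gradient U u G \<longleftrightarrow>
     (\<forall>K. compact K \<and> K \<subseteq> U \<longrightarrow>
        set_integrable lebesgue K u \<and> set_integrable lebesgue K G) \<and>
     (\<forall>\<phi>\<in>test_functions U.
        (LINT x:U|lebesgue. u x *\<^sub>R grad \<phi> x) = - (LINT x:U|lebesgue. \<phi> x *\<^sub>R G x))"

text \<open>A weak gradient on an open set is unique up to null sets, so the choice below
  does not affect integrals.\<close>

definition weak_grad :: "'a::euclidean_space set \<Rightarrow> ('a \<Rightarrow> real) \<Rightarrow> 'a \<Rightarrow> 'a" where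
  "weak_grad U u = (SOME G. is_weak_gradient U u G)"

text \<open>Convergence in \<open>L\<^sup>2\<close> is stated with the nonnegative integral because the Bochner
  integral of a non-integrable function is 0.\<close>

definition L2_tendsto ::
    "'a measure \<Rightarrow> (nat \<Rightarrow> 'a \<Rightarrow> 'b::real_normed_vector) \<Rightarrow> ('a \<Rightarrow> 'b) \<Rightarrow> bool" where
  "L2_tendsto M f g \<longleftrightarrow>
     (\<forall>k. f k \<in> borel_measurable M) \<and> g \<in> borel_measurable M \<and>
     (\<lambda>k. \<integral>\<^sup>+x. ennreal ((norm (f k x - g x))\<^sup>2) \<partial>M) \<longlonglongrightarrow> 0"

section \<open>The spaces\<close>

definition weighted_measure :: "'a::euclidean_space set \<Rightarrow> 'a measure" where
  "weighted_measure \<Omega> = density (restrict_space lebesgue \<Omega>)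
     (\<lambda>x. ennreal (norm x powr (- (real DIM('a) - 2))))"

definition Htilde_norm :: "'a::euclidean_space set \<Rightarrow> ('a \<Rightarrow> real) \<Rightarrow> real" where
  "Htilde_norm \<Omega> v = sqrt (LINT x:\<Omega>|lebesgue.
     norm x powr (- (real DIM('a) - 2)) * (norm (weak_grad \<Omega> v x))\<^sup>2)"

text \<open>The completion of the test functions, realised as a space of functions (up to null
  sets).  On a bounded domain the weighted Poincare inequality bounds the norm of
  \<open>L\<^sup>2(\<bar>x\<bar>\<^bsup>-(N-2)\<^esup> dx)\<close> by a multiple of \<^const>\<open>Htilde_norm\<close>.  Hence every Cauchy sequence
  of test functions has a limit \<open>v\<close> in that \<open>L\<^sup>2\<close> space, which determines its class in the
  completion.  The gradients converge to the weak gradient of \<open>v\<close> in the same weighted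
  \<open>L\<^sup>2\<close>, so \<^const>\<open>Htilde_norm\<close> is also the norm of the completion.\<close>

definition Htilde :: "'a::euclidean_space set \<Rightarrow> ('a \<Rightarrow> real) set" where
  "Htilde \<Omega> = {v. \<exists>\<phi>. (\<forall>k. \<phi> k \<in> test_functions \<Omega>) \<and>
     (\<forall>e>0. \<exists>M. \<forall>j\<ge>M. \<forall>k\<ge>M. Htilde_norm \<Omega> (\<lambda>x. \<phi> j x - \<phi> k x) < e) \<and>
     L2_tendsto (weighted_measure \<Omega>) \<phi> v}"

definition H_space :: "'a::euclidean_space set \<Rightarrow> ('a \<Rightarrow> real) set" where
  "H_space \<Omega> = {u. \<exists>v\<in>Htilde \<Omega>. AE x in lebesgue. x \<in> \<Omega> \<longrightarrow>
     u x = norm x powr (- ((real DIM('a) - 2) / 2)) * v x}"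

definition H_norm :: "'a::euclidean_space set \<Rightarrow> ('a \<Rightarrow> real) \<Rightarrow> real" where
  "H_norm \<Omega> u = Htilde_norm \<Omega> (\<lambda>x. norm x powr ((real DIM('a) - 2) / 2) * u x)"

section \<open>Surface measure and traces\<close>

text \<open>Surface measure of a subset of the sphere of radius \<open>r\<close> is \<open>N / r\<close> times the Lebesgue
  measure of the cone over it with apex 0.\<close>

definition sphere_measure :: "real \<Rightarrow> 'a::euclidean_space measure" where
  "sphere_measure r = scale_measure (ennreal (real DIM('a) / r))
     (distr (restrict_space lborel (cball 0 r - {0})) borel (\<lambda>x. (r / norm x) *\<^sub>R x))"

text \<open>The trace on the sphere of radius \<open>r\<close> of a function in \<open>W\<^sup>1\<^sup>,\<^sup>2\<close> of the exterior
  region: the \<open>L\<^sup>2\<close> limit of the restrictions of \<open>C\<^sup>1\<close> approximants.\<close>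

definition is_trace ::
    "'a::euclidean_space set \<Rightarrow> real \<Rightarrow> ('a \<Rightarrow> real) \<Rightarrow> ('a \<Rightarrow> real) \<Rightarrow> bool" where
  "is_trace \<Omega> r u g \<longleftrightarrow> (\<exists>\<psi> G.
     (\<forall>k. Ck 1 (\<psi> k)) \<and>
     is_weak_gradient (\<Omega> - cball 0 r) u G \<and>
     L2_tendsto (restrict_space lebesgue (\<Omega> - cball 0 r)) \<psi> u \<and>
     L2_tendsto (restrict_space lebesgue (\<Omega> - cball 0 r)) (\<lambda>k. grad (\<psi> k)) G \<and>
     L2_tendsto (sphere_measure r) \<psi> g)"

definition sphere_trace :: "'a::euclidean_space set \<Rightarrow> real \<Rightarrow> ('a \<Rightarrow> real) \<Rightarrow> 'a \<Rightarrow> real" where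
  "sphere_trace \<Omega> r u = (SOME g. is_trace \<Omega> r u g)"

section \<open>The two functionals\<close>

text \<open>The gradient of \<open>u\<close> is taken in the sense of distributions away from the origin.\<close>

definition hardy_exterior ::
    "'a::euclidean_space set \<Rightarrow> real \<Rightarrow> ('a \<Rightarrow> real) \<Rightarrow> real" where
  "hardy_exterior \<Omega> \<epsilon> u =
     (LINT x:(\<Omega> - ball 0 \<epsilon>)|lebesgue. (norm (weak_grad (\<Omega> - {0}) u x))\<^sup>2) -
     ((real DIM('a) - 2) / 2)\<^sup>2 *
       (LINT x:(\<Omega> - ball 0 \<epsilon>)|lebesgue. (u x)\<^sup>2 / (norm x)\<^sup>2)"

definition hardy_surface ::
    "'a::euclidean_space set \<Rightarrow> real \<Rightarrow> ('a \<Rightarrow> real) \<Rightarrow> real" where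
  "hardy_surface \<Omega> \<epsilon> u = (real DIM('a) - 2) / 2 * inverse \<epsilon> *
     (LINT x|sphere_measure \<epsilon>. (sphere_trace \<Omega> \<epsilon> u x)\<^sup>2)"

end

theory Submission
  imports Defs
begin

text \<open>Write \<open>a = (N - 2) / 2\<close>, so that \<open>2 a + 2 = N\<close>, and let \<open>u = \<bar>x\<bar>\<^sup>-\<^sup>a v\<close>. Where \<open>v\<close> is
  \<open>C\<^sup>1\<close> and \<open>x \<noteq> 0\<close>, expanding the square gives
  \<open>\<bar>\<nabla>u\<bar>\<^sup>2 - a\<^sup>2 u\<^sup>2 / \<bar>x\<bar>\<^sup>2 = \<bar>x\<bar>\<^sup>-\<^sup>2\<^sup>a \<bar>\<nabla>v\<bar>\<^sup>2 - a \<bar>x\<bar>\<^sup>-\<^sup>N x \<cdot> \<nabla>(v\<^sup>2)\<close>.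
  The field \<open>x / \<bar>x\<bar>\<^sup>N\<close> is divergence free away from the origin, so for compactly supported
  \<open>v\<close> the last term integrates over \<open>\<bar>x\<bar> \<ge> \<epsilon>\<close> to a flux through the sphere
  (\<open>radial_flux\<close>, \<open>sphere_flux\<close>), and this flux is exactly the surface term. Hence for a test
  function \<open>v\<close> the difference in the theorem equals the weighted energy of \<open>v\<close> outside the ball,
  for every radius (\<open>exterior_identity\<close>).

  A general \<open>v\<close> is a weighted \<open>L\<^sup>2\<close> limit of test functions whose gradients converge to some
  \<open>G\<close>, because \<open>L\<^sup>2\<close> is complete (\<open>Htilde_sequence\<close>). Every term of the identity is a squared
  \<open>L\<^sup>2\<close> norm and so passes to the limit (\<open>L2_tendsto_norm\<close>). What remains is to recognise the
  limits. The limits of gradients are the weak gradients of \<open>u\<close> and of \<open>v\<close>, since weak gradients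
  are unique by the fundamental lemma of the calculus of variations (\<open>weak_gradient_L2_limit\<close>,
  \<open>weak_gradient_unique\<close>). The limit on the sphere is the trace, by the inequality
  \<open>trace_inequality\<close>, itself a consequence of the flux identity (\<open>sphere_trace_limit\<close>). This
  gives the identity for \<open>u\<close> at every small radius (\<open>exact_formula\<close>), and the theorem follows
  because the excluded balls shrink to a null set and the weighted energy is integrable.\<close>

section \<open>Calculus of continuously differentiable functions\<close>

lemma Ck_Suc_imp: "Ck (Suc k) f \<Longrightarrow> Ck k f"
proof (induction k arbitrary: f)
  case 0
  then show ?case
    by (auto intro!: continuous_at_imp_continuous_on differentiable_imp_continuous_within)
next
  case (Suc k)
  then show ?case by auto
qed

lemma Ck_const: "Ck k (\<lambda>x::'a::euclidean_space. c)"
proof (induction k arbitrary: c)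
  case (Suc k)
  then show ?case by simp
qed simp

lemma Ck_add: "Ck k f \<Longrightarrow> Ck k g \<Longrightarrow> Ck k (\<lambda>x. f x + g x)"
proof (induction k arbitrary: f g)
  case 0
  then show ?case by (simp add: continuous_on_add continuous_on_mult)
next
  case (Suc k)
  have d: "f differentiable at x" "g differentiable at x" for x
    using Suc.prems by auto
  have "frechet_derivative (\<lambda>x. f x + g x) (at x) b
      = frechet_derivative f (at x) b + frechet_derivative g (at x) b" for x b
  proof -
    have "((\<lambda>x. f x + g x) has_derivative
      (\<lambda>b. frechet_derivative f (at x) b + frechet_derivative g (at x) b)) (at x)"
      using d by (intro has_derivative_add) (simp_all add: frechet_derivative_works[symmetric])
    from frechet_derivative_at[OF this] show ?thesis by metis
  qed
  then show ?case using Suc d by simp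
qed

lemma Ck_mult: "Ck k f \<Longrightarrow> Ck k g \<Longrightarrow> Ck k (\<lambda>x. f x * g x)"
proof (induction k arbitrary: f g)
  case 0
  then show ?case by (simp add: continuous_on_add continuous_on_mult)
next
  case (Suc k)
  have d: "f differentiable at x" "g differentiable at x" for x
    using Suc.prems by auto
  have "frechet_derivative (\<lambda>x. f x * g x) (at x) b
      = f x * frechet_derivative g (at x) b + frechet_derivative f (at x) b * g x" for x b
  proof -
    have "((\<lambda>x. f x * g x) has_derivative
      (\<lambda>b. f x * frechet_derivative g (at x) b + frechet_derivative f (at x) b * g x)) (at x)"
      using d by (intro has_derivative_mult) (simp_all add: frechet_derivative_works[symmetric])
    from frechet_derivative_at[OF this] show ?thesis by metis
  qed
  moreover have "Ck k f" "Ck k g" using Suc.prems Ck_Suc_imp by blast+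
  ultimately show ?case using Suc d by (simp add: Ck_add)
qed

lemma Ck_prod: "finite I \<Longrightarrow> (\<And>i. i \<in> I \<Longrightarrow> Ck k (f i)) \<Longrightarrow> Ck k (\<lambda>x. \<Prod>i\<in>I. f i x)"
  by (induction I rule: finite_induct) (auto intro: Ck_const Ck_mult)

lemma Ck_1_iff:
  "Ck 1 f \<longleftrightarrow> (\<forall>x. (f has_derivative (\<lambda>h. grad f x \<bullet> h)) (at x)) \<and> continuous_on UNIV (grad f)"
proof -
  have *: "frechet_derivative f (at x) h = grad f x \<bullet> h"
    if "f differentiable at x" for x h
  proof -
    interpret linear "frechet_derivative f (at x)"
      using that by (rule linear_frechet_derivative)
    have "frechet_derivative f (at x) h = frechet_derivative f (at x) (\<Sum>b\<in>Basis. (h \<bullet> b) *\<^sub>R b)"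
      by (simp add: euclidean_representation)
    also have "\<dots> = grad f x \<bullet> h"
      unfolding sum scaleR by (simp add: grad_def inner_sum_left inner_commute[of h] mult.commute)
    finally show ?thesis .
  qed
  have **: "(f has_derivative (\<lambda>h. grad f x \<bullet> h)) (at x) \<longleftrightarrow> f differentiable at x" for x
    using * by (metis differentiable_def ext frechet_derivative_works)
  have "continuous_on UNIV (grad f) \<longleftrightarrow>
      (\<forall>b\<in>Basis. continuous_on UNIV (\<lambda>x. frechet_derivative f (at x) b))"
    if "\<forall>x. f differentiable at x"
    using that by (subst continuous_on_componentwise) (simp add: *)
  then show ?thesis by (auto simp: **)
qed

lemma grad_eqI:
  assumes "(f has_derivative (\<lambda>h. g \<bullet> h)) (at x)"
  shows "grad f x = g"
  using frechet_derivative_at[OF assms, symmetric]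
  by (simp add: grad_def euclidean_representation)

lemma Ck_1I:
  assumes "\<And>x. (f has_derivative (\<lambda>h. g x \<bullet> h)) (at x)" "continuous_on UNIV g"
  shows "Ck 1 f" "grad f = g"
proof -
  show "grad f = g" using grad_eqI[OF assms(1)] by auto
  with assms show "Ck 1 f" by (simp only: Ck_1_iff simp_thms)
qed

lemma Ck_1D:
  assumes "Ck 1 f"
  shows "(f has_derivative (\<lambda>h. grad f x \<bullet> h)) (at x)" "continuous_on UNIV (grad f)"
    "continuous_on UNIV f"
proof -
  show "(f has_derivative (\<lambda>h. grad f x \<bullet> h)) (at x)" "continuous_on UNIV (grad f)"
    using assms unfolding Ck_1_iff by blast+
  show "continuous_on UNIV f"
    using assms Ck_Suc_imp[of 0 f] unfolding One_nat_def by (metis Ck.simps(1))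
qed

lemma grad_mult: "Ck 1 f \<Longrightarrow> Ck 1 g \<Longrightarrow> grad (\<lambda>x. f x * g x) x = f x *\<^sub>R grad g x + g x *\<^sub>R grad f x"
  by (rule grad_eqI) (auto intro!: derivative_eq_intros Ck_1D(1) simp: inner_add_left)

lemma Ck_diff: "Ck k f \<Longrightarrow> Ck k g \<Longrightarrow> Ck k (\<lambda>x. f x - g x)"
  using Ck_add[of k f "\<lambda>x. (-1) * g x"] Ck_mult[OF Ck_const[of k "-1"], of g] by simp

lemma grad_diff: "Ck 1 f \<Longrightarrow> Ck 1 g \<Longrightarrow> grad (\<lambda>x. f x - g x) x = grad f x - grad g x"
  by (rule grad_eqI) (auto intro!: derivative_eq_intros Ck_1D(1) simp: inner_diff_left)

lemma C1_difference_quotient_tendsto: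
  fixes b :: "'a::euclidean_space"
  assumes "Ck 1 f" "t \<longlonglongrightarrow> 0" "\<And>n. t n \<noteq> 0"
  shows "(\<lambda>n. (f (x + t n *\<^sub>R b) - f x) / t n) \<longlonglongrightarrow> grad f x \<bullet> b"
proof -
  have "((\<lambda>h. f (x + h *\<^sub>R b)) has_derivative (\<lambda>h. grad f (x + 0 *\<^sub>R b) \<bullet> (h *\<^sub>R b))) (at (0::real))"
    by (rule has_derivative_compose[OF _ Ck_1D(1)[OF assms(1)], where f = "\<lambda>h. x + h *\<^sub>R b"])
      (auto intro!: derivative_eq_intros)
  then have "((\<lambda>h. f (x + h *\<^sub>R b)) has_real_derivative (grad f x \<bullet> b)) (at 0)"
    unfolding has_field_derivative_def
    by (rule has_derivative_eq_rhs) (auto simp: mult.commute)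
  then have "(\<lambda>h. (f (x + h *\<^sub>R b) - f x) / h) \<midarrow>0\<rightarrow> grad f x \<bullet> b"
    by (simp add: DERIV_def)
  then show ?thesis
    by (rule filterlim_compose) (use assms(2,3) in \<open>auto simp: filterlim_at\<close>)
qed

lemma grad_outside_support:
  assumes "x \<notin> closure {x. f x \<noteq> 0}"
  shows "grad f x = 0"
proof (rule grad_eqI)
  have "((\<lambda>x. 0) has_derivative (\<lambda>h. 0 \<bullet> h)) (at x)" by simp
  then show "(f has_derivative (\<lambda>h. 0 \<bullet> h)) (at x)"
  proof (rule has_derivative_transform_within_open)
    show "open (- closure {x. f x \<noteq> 0})" by auto
    show "0 = f y" if "y \<in> - closure {x. f x \<noteq> 0}" for y
      using that closure_subset[of "{x. f x \<noteq> 0}"] by auto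
  qed (use assms in auto)
qed

text \<open>These constants dominate the difference quotients whose limits give the integration by parts
  and the flux identity.\<close>

lemma C1_compact_bounds:
  fixes f :: "'a::euclidean_space \<Rightarrow> real"
  assumes "Ck 1 f" "bounded {x. f x \<noteq> 0}"
  obtains L R where "L > 0" "R > 0" "\<And>x. norm x \<ge> R \<Longrightarrow> f x = 0" "\<And>x. norm x \<ge> R \<Longrightarrow> grad f x = 0"
    "\<And>x. \<bar>f x\<bar> \<le> L" "\<And>x. norm (grad f x) \<le> L" "\<And>x y. \<bar>f x - f y\<bar> \<le> L * norm (x - y)"
proof -
  let ?K = "closure {x. f x \<noteq> 0}"
  have K: "compact ?K" using assms(2) by simp
  obtain R where R: "R > 0" "\<And>x. x \<in> ?K \<Longrightarrow> norm x < R"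
    using compact_imp_bounded[OF K] unfolding bounded_pos_less by blast
  obtain B1 where B1: "B1 > 0" "\<And>x. x \<in> ?K \<Longrightarrow> norm (f x) \<le> B1"
    using compact_imp_bounded[OF compact_continuous_image[OF continuous_on_subset[OF Ck_1D(3)[OF assms(1)] subset_UNIV] K]]
    unfolding bounded_pos by blast
  obtain B2 where B2: "B2 > 0" "\<And>x. x \<in> ?K \<Longrightarrow> norm (grad f x) \<le> B2"
    using compact_imp_bounded[OF compact_continuous_image[OF continuous_on_subset[OF Ck_1D(2)[OF assms(1)] subset_UNIV] K]]
    unfolding bounded_pos by blast
  have out: "f x = 0" "grad f x = 0" if "x \<notin> ?K" for x
    using that closure_subset[of "{x. f x \<noteq> 0}"] grad_outside_support[OF that] by auto
  have b1: "\<bar>f x\<bar> \<le> max B1 B2" and b2: "norm (grad f x) \<le> max B1 B2" for x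
    using B1(1) B1(2)[of x] B2(2)[of x] out[of x] by (cases "x \<in> ?K"; force)+
  have "\<bar>f x - f y\<bar> \<le> max B1 B2 * norm (x - y)" for x y
    unfolding real_norm_def[symmetric]
  proof (rule differentiable_bound[where S = UNIV])
    show "onorm ((\<bullet>) (grad f x)) \<le> max B1 B2" for x
      using b2[of x] by (intro onorm_le) (metis Cauchy_Schwarz_ineq2 dual_order.trans mult_right_mono norm_ge_zero real_norm_def)
  qed (use Ck_1D(1)[OF assms(1)] in auto)
  then show thesis
    using that[of "max B1 B2" R] B1(1) R out b1 b2 by (metis leD less_max_iff_disj)
qed

text \<open>Two \<open>C\<^sup>1\<close> gluings rest on this function: the cutoff in the trace inequality and the extension
  of negative powers of the norm across the origin.\<close>

lemma DERIV_pos_part_squared: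
  "((\<lambda>t::real. (max t 0)\<^sup>2) has_real_derivative 2 * max t 0) (at t)"
proof -
  have *: "norm ((max (t + h) 0)\<^sup>2 - (max t 0)\<^sup>2 - 2 * max t 0 * h) \<le> h\<^sup>2" for h
  proof -
    consider "t \<ge> 0" "t + h \<ge> 0" | "t < 0" "t + h < 0" | "t \<ge> 0" "t + h < 0" | "t < 0" "t + h \<ge> 0"
      by linarith
    then show ?thesis
    proof cases
      case 3
      have a: "(max (t + h) 0)\<^sup>2 - (max t 0)\<^sup>2 - 2 * max t 0 * h = - t\<^sup>2 - 2 * t * h"
        using 3 by (simp add: max_def)
      have "t * (t + h) \<le> 0" "t * h \<le> 0" "(t+h) * h \<ge> 0"
        using 3 by (auto intro: mult_nonneg_nonpos mult_nonpos_nonpos)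
      moreover have "(t+h)\<^sup>2 \<ge> 0" by simp
      ultimately show ?thesis unfolding a real_norm_def
        by (intro abs_leI) (auto simp: power2_eq_square algebra_simps)
    next
      case 4
      then show ?thesis by (auto simp: max_def intro!: power_mono)
    qed (auto simp: max_def power2_eq_square algebra_simps)
  qed
  have "(\<lambda>h. ((max (t + h) 0)\<^sup>2 - (max t 0)\<^sup>2) / h - 2 * max t 0) \<midarrow>0\<rightarrow> 0"
  proof (rule Lim_null_comparison)
    show "(\<lambda>h::real. \<bar>h\<bar>) \<midarrow>0\<rightarrow> 0" by (rule tendsto_rabs_zero) simp
    show "\<forall>\<^sub>F h in at 0. norm (((max (t + h) 0)\<^sup>2 - (max t 0)\<^sup>2) / h - 2 * max t 0) \<le> \<bar>h\<bar>"
    proof (rule eventually_at_ball'[THEN eventually_mono, of 1])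
      fix h :: real assume "h \<in> ball 0 1 \<and> h \<noteq> 0 \<and> h \<in> UNIV"
      then have h: "h \<noteq> 0" by simp
      have "((max (t + h) 0)\<^sup>2 - (max t 0)\<^sup>2) / h - 2 * max t 0
          = ((max (t + h) 0)\<^sup>2 - (max t 0)\<^sup>2 - 2 * max t 0 * h) / h"
        using h by (simp add: field_simps)
      then show "norm (((max (t + h) 0)\<^sup>2 - (max t 0)\<^sup>2) / h - 2 * max t 0) \<le> \<bar>h\<bar>"
        using *[of h] h by (simp add: divide_simps power2_eq_square abs_mult)
    qed simp
  qed
  then show ?thesis
    unfolding DERIV_def by (subst (asm) LIM_zero_iff)
qed

section \<open>Bump functions and the fundamental lemma of the calculus of variations\<close>

text \<open>The factor in front of the exponential makes the family closed under differentiation up to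
  linear combinations, so that smoothness of all orders follows by one induction.\<close>

definition flat_exp :: "nat \<Rightarrow> real \<Rightarrow> real" where
  "flat_exp m t = (if t > 0 then inverse t ^ m * exp (- inverse t) else 0)"

lemma flat_exp_tendsto_0: "(flat_exp m \<longlongrightarrow> 0) (at 0)"
proof (rule filterlim_split_at_real)
  have "\<forall>\<^sub>F t in at_left (0::real). 0 = flat_exp m t"
    by (auto simp: eventually_at_filter flat_exp_def)
  then show "(flat_exp m \<longlongrightarrow> 0) (at_left 0)"
    by (rule Lim_transform_eventually[OF tendsto_const])
  have "((\<lambda>s::real. s ^ m / exp s) \<longlongrightarrow> 0) at_top"
    by (rule tendsto_power_div_exp_0)
  then have "((\<lambda>t::real. inverse t ^ m / exp (inverse t)) \<longlongrightarrow> 0) (at_right 0)"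
    by (rule filterlim_compose) (rule filterlim_inverse_at_top_right)
  moreover have "\<forall>\<^sub>F t in at_right (0::real). inverse t ^ m / exp (inverse t) = flat_exp m t"
    by (auto simp: eventually_at_filter flat_exp_def exp_minus divide_inverse)
  ultimately show "(flat_exp m \<longlongrightarrow> 0) (at_right 0)"
    by (rule Lim_transform_eventually)
qed

lemma DERIV_flat_exp:
  "(flat_exp m has_real_derivative flat_exp (Suc (Suc m)) t - real m * flat_exp (Suc m) t) (at t)"
proof -
  consider "t > 0" | "t < 0" | "t = 0" by linarith
  then show ?thesis
  proof cases
    case 1
    have "((\<lambda>t. inverse t ^ m * exp (- inverse t)) has_real_derivative
        real m * inverse t ^ (m - 1) * (- (inverse t)\<^sup>2) * exp (- inverse t)
          + inverse t ^ m * (exp (- inverse t) * (inverse t)\<^sup>2)) (at t)"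
      using 1 by (auto intro!: derivative_eq_intros simp: power2_eq_square)
    moreover have "real m * inverse t ^ (m - 1) * (- (inverse t)\<^sup>2) * exp (- inverse t)
          + inverse t ^ m * (exp (- inverse t) * (inverse t)\<^sup>2)
        = flat_exp (Suc (Suc m)) t - real m * flat_exp (Suc m) t"
      using 1 by (cases m) (simp_all add: flat_exp_def power2_eq_square algebra_simps)
    ultimately have "((\<lambda>t. inverse t ^ m * exp (- inverse t)) has_real_derivative
        flat_exp (Suc (Suc m)) t - real m * flat_exp (Suc m) t) (at t)" by simp
    then show ?thesis
      by (rule has_field_derivative_transform_within_open[where S = "{0<..}"])
        (use 1 in \<open>auto simp: flat_exp_def\<close>)
  next
    case 2
    have "((\<lambda>t. 0) has_real_derivative
        flat_exp (Suc (Suc m)) t - real m * flat_exp (Suc m) t) (at t)"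
      using 2 by (auto simp: flat_exp_def)
    then show ?thesis
      by (rule has_field_derivative_transform_within_open[where S = "{..<0}"])
        (use 2 in \<open>auto simp: flat_exp_def\<close>)
  next
    case 3
    have "(\<lambda>h. flat_exp m h / h) = flat_exp (Suc m)"
      by (auto simp: flat_exp_def divide_inverse)
    then have "(\<lambda>h. (flat_exp m (0 + h) - flat_exp m 0) / h) \<midarrow>0\<rightarrow> 0"
      using flat_exp_tendsto_0[of "Suc m"] by (simp add: flat_exp_def)
    then show ?thesis
      using 3 by (simp add: DERIV_def flat_exp_def)
  qed
qed

lemma Ck_flat_exp: "Ck k (\<lambda>x::'a::euclidean_space. flat_exp m (x \<bullet> c + d))"
proof (induction k arbitrary: m)
  case 0
  have "continuous_on UNIV (flat_exp m)"
    using DERIV_flat_exp by (intro continuous_at_imp_continuous_on) (blast intro: DERIV_isCont)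
  then show ?case
    by (auto intro!: continuous_on_compose2[of UNIV "flat_exp m"] continuous_intros)
next
  case (Suc k)
  let ?f' = "\<lambda>x::'a. flat_exp (Suc (Suc m)) (x \<bullet> c + d) - real m * flat_exp (Suc m) (x \<bullet> c + d)"
  have D: "((\<lambda>x. flat_exp m (x \<bullet> c + d)) has_derivative (\<lambda>h. ?f' x * (h \<bullet> c))) (at x)" for x
    by (rule has_derivative_compose[OF _ DERIV_flat_exp[THEN has_field_derivative_imp_has_derivative],
          where f = "\<lambda>x. x \<bullet> c + d"])
      (auto intro!: derivative_eq_intros)
  have "frechet_derivative (\<lambda>x. flat_exp m (x \<bullet> c + d)) (at x) h = ?f' x * (h \<bullet> c)" for x h
    using frechet_derivative_at[OF D] by metis
  moreover have "Ck k (\<lambda>x. ?f' x * (b \<bullet> c))" for b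
    by (intro Ck_mult Ck_diff Ck_const Suc.IH)
  ultimately show ?case
    using differentiableI[OF D] by simp
qed

text \<open>A smooth bump on the box with corners \<open>l\<close> and \<open>u\<close>, steepened by the factor \<open>n + 1\<close> so that it tends
  to the indicator of the open box.\<close>

definition box_bump :: "'a::euclidean_space \<Rightarrow> 'a \<Rightarrow> nat \<Rightarrow> 'a \<Rightarrow> real" where
  "box_bump l u n x = (\<Prod>b\<in>Basis. flat_exp 0 (x \<bullet> (real (Suc n) *\<^sub>R b) + (- real (Suc n) * (l \<bullet> b))) *
     flat_exp 0 (x \<bullet> (- real (Suc n) *\<^sub>R b) + real (Suc n) * (u \<bullet> b)))"

lemma box_bump_eq: "box_bump l u n x = (\<Prod>b\<in>Basis. flat_exp 0 (real (Suc n) * (x \<bullet> b - l \<bullet> b)) *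
     flat_exp 0 (real (Suc n) * (u \<bullet> b - x \<bullet> b)))"
  unfolding box_bump_def by (rule prod.cong) (simp_all add: algebra_simps del: of_nat_Suc)

lemma box_bump_nonzero: "{x. box_bump l u n x \<noteq> 0} = box l u"
proof -
  have "flat_exp 0 (real (Suc n) * s) \<noteq> 0 \<longleftrightarrow> s > 0" for s
    by (auto simp: flat_exp_def zero_less_mult_iff)
  then show ?thesis
    unfolding box_bump_eq by (auto simp: box_def simp del: of_nat_Suc)
qed

lemma box_bump_test:
  assumes "cbox l u \<subseteq> U"
  shows "box_bump l u n \<in> test_functions U"
proof -
  have "closure (box l u) \<subseteq> cbox l u"
    by (simp add: box_subset_cbox closure_minimal closed_cbox)
  moreover have "Ck k (box_bump l u n)" for k
    unfolding box_bump_def by (intro Ck_prod Ck_mult Ck_flat_exp) auto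
  ultimately show ?thesis
    using assms unfolding test_functions_def by (auto simp: box_bump_nonzero bounded_box)
qed

lemma flat_exp_0_bounds: "0 \<le> flat_exp 0 t" "flat_exp 0 t \<le> 1"
  by (auto simp: flat_exp_def)

lemma box_bump_bounds: "0 \<le> box_bump l u n x" "box_bump l u n x \<le> 1"
  unfolding box_bump_def
  by (auto intro!: prod_nonneg prod_le_1 mult_nonneg_nonneg mult_le_one flat_exp_0_bounds)

lemma flat_exp_steepen: "(\<lambda>n. flat_exp 0 (real (Suc n) * t)) \<longlonglongrightarrow> (if t > 0 then 1 else 0)"
proof (cases "t > 0")
  case True
  have "(\<lambda>n. exp (- (inverse (real (Suc n)) * inverse t))) \<longlonglongrightarrow> exp (- (0 * inverse t))"
    by (intro tendsto_intros LIMSEQ_inverse_real_of_nat)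
  then show ?thesis using True
    by (simp add: flat_exp_def zero_less_mult_iff del: of_nat_Suc)
next
  case False
  then have "\<not> real (Suc n) * t > 0" for n
    by (simp add: zero_less_mult_iff del: of_nat_Suc)
  then show ?thesis using False by (simp add: flat_exp_def del: of_nat_Suc)
qed

lemma box_bump_tendsto: "(\<lambda>n. box_bump l u n x) \<longlonglongrightarrow> indicator (box l u) x"
proof -
  have "(\<lambda>n. box_bump l u n x) \<longlonglongrightarrow> (\<Prod>b\<in>Basis. (if x \<bullet> b - l \<bullet> b > 0 then 1 else 0) *
     (if u \<bullet> b - x \<bullet> b > 0 then 1 else 0))"
    unfolding box_bump_eq by (intro tendsto_intros flat_exp_steepen)
  also have "(\<Prod>b\<in>Basis. (if x \<bullet> b - l \<bullet> b > 0 then 1 else 0) *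
     (if u \<bullet> b - x \<bullet> b > 0 then 1 else 0)) = (indicator (box l u) x :: real)"
    by (cases "x \<in> box l u") (auto simp: box_def indicator_def)
  finally show ?thesis .
qed

lemma sigma_finite_lebesgue: "sigma_finite_measure (lebesgue :: 'a::euclidean_space measure)"
proof
  obtain A :: "'a set set" where A: "countable A" "A \<subseteq> sets lborel" "\<Union>A = space lborel"
      "\<forall>a\<in>A. emeasure lborel a \<noteq> \<infinity>"
    using lborel.sigma_finite_countable by blast
  then show "\<exists>A. countable A \<and> A \<subseteq> sets (lebesgue :: 'a measure) \<and> \<Union>A = space lebesgue \<and>
      (\<forall>a\<in>A. emeasure lebesgue a \<noteq> \<infinity>)"
    by (intro exI[of _ A]) (auto simp: subset_iff)
qed

text \<open>Boxes are stable under intersection and generate the Borel sets, so the integrals over all Borel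
  sets vanish by Dynkin's theorem.\<close>

lemma AE_zero_of_box_integrals_zero:
  fixes f :: "'a::euclidean_space \<Rightarrow> 'b::euclidean_space"
  assumes f: "integrable lebesgue f"
    and box: "\<And>l u. (\<integral>x. indicator (box l u) x *\<^sub>R f x \<partial>lebesgue) = 0"
  shows "AE x in lebesgue. f x = 0"
proof (rule sigma_finite_measure.density_zero[OF sigma_finite_lebesgue f])
  have int: "integrable lebesgue (\<lambda>x. indicator A x *\<^sub>R f x)" if "A \<in> sets lebesgue" for A
    using integrable_mult_indicator[OF that f] .
  let ?G = "range (\<lambda>(a,b). box a b) :: 'a set set"
  have c1: "(\<integral>x. indicator (box (- (real n *\<^sub>R One)) (real n *\<^sub>R One)) x *\<^sub>R f x \<partial>lebesgue) = 0" for n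
    by (rule box)
  have c2: "(\<lambda>n. \<integral>x. indicator (box (- (real n *\<^sub>R One)) (real n *\<^sub>R One)) x *\<^sub>R f x \<partial>lebesgue)
     \<longlonglongrightarrow> (\<integral>x. f x \<partial>lebesgue)"
  proof (rule integral_dominated_convergence[where w = "\<lambda>x. norm (f x)"])
    show "AE x in lebesgue. (\<lambda>n. indicator (box (- (real n *\<^sub>R One)) (real n *\<^sub>R One)) x *\<^sub>R f x) \<longlonglongrightarrow> f x"
    proof (rule AE_I2)
      fix x :: 'a
      obtain n where n: "x \<in> box (- (real n *\<^sub>R One)) (real n *\<^sub>R One)"
        using UN_box_eq_UNIV by blast
      have "indicator (box (- (real m *\<^sub>R One)) (real m *\<^sub>R One)) x *\<^sub>R f x = f x" if "m \<ge> n" for m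
      proof -
        have "real n \<le> real m" using that by simp
        then have "x \<in> box (- (real m *\<^sub>R One)) (real m *\<^sub>R One)"
          using n by (fastforce simp: box_def)
        then show ?thesis by simp
      qed
      then show "(\<lambda>n. indicator (box (- (real n *\<^sub>R One)) (real n *\<^sub>R One)) x *\<^sub>R f x) \<longlonglongrightarrow> f x"
        by (intro tendsto_eventually) (auto simp: eventually_sequentially)
    qed
  qed (use f int in \<open>auto simp: indicator_def borel_measurable_integrable\<close>)
  have total: "(\<integral>x. f x \<partial>lebesgue) = 0"
    using c2 unfolding c1 by (simp add: LIMSEQ_const_iff)
  have borel: "(\<integral>x. indicator A x *\<^sub>R f x \<partial>lebesgue) = 0" if "A \<in> sets borel" for A
  proof -
    have gen: "A \<in> sigma_sets UNIV ?G"
      using that by (simp add: borel_eq_box)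
    have stable: "Int_stable ?G"
    proof (rule Int_stableI)
      fix a b :: "'a set" assume "a \<in> ?G" "b \<in> ?G"
      then obtain l u l' u' where "a = box l u" "b = box l' u'" by auto
      then have "a \<inter> b = (\<lambda>(a,b). box a b) (\<Sum>i\<in>Basis. max (l \<bullet> i) (l' \<bullet> i) *\<^sub>R i,
          \<Sum>i\<in>Basis. min (u \<bullet> i) (u' \<bullet> i) *\<^sub>R i)"
        by (simp add: box_Int_box)
      then show "a \<inter> b \<in> ?G" by (rule range_eqI)
    qed
    have pow: "?G \<subseteq> Pow UNIV" by simp
    show ?thesis
      using stable pow gen
    proof (induction rule: sigma_sets_induct_disjoint)
      case (basic A)
      then show ?case using box by auto
    next
      case (compl A)
      then have A: "A \<in> sets borel" by (simp add: borel_eq_box)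
      have "(\<integral>x. indicator (UNIV - A) x *\<^sub>R f x \<partial>lebesgue)
          = (\<integral>x. f x - indicator A x *\<^sub>R f x \<partial>lebesgue)"
        by (intro Bochner_Integration.integral_cong) (auto simp: indicator_def)
      also have "\<dots> = 0"
        using compl A by (subst Bochner_Integration.integral_diff) (auto intro: f int simp: total)
      finally show ?case .
    next
      case (union A)
      have "A i \<in> sets borel" for i
        using subsetD[OF union.hyps(2), of "A i"] by (simp add: borel_eq_box)
      then have A: "A i \<in> sets lebesgue" for i
        by simp
      have "set_lebesgue_integral lebesgue (\<Union>i. A i) f = (\<Sum>i. set_lebesgue_integral lebesgue (A i) f)"
      proof (rule lebesgue_integral_countable_add)
        show "A i \<inter> A j = {}" if "i \<noteq> j" for i j
          using union.hyps that by (auto simp: disjoint_family_on_def)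
        show "set_integrable lebesgue (\<Union> (range A)) f"
          unfolding set_integrable_def using A by (intro int) auto
      qed (use A in auto)
      then show ?case
        using union by (simp add: set_lebesgue_integral_def)
    qed auto
  qed
  fix A :: "'a set" assume "A \<in> sets lebesgue"
  then obtain S N N' where A: "A = S \<union> N" "N \<subseteq> N'" "N' \<in> null_sets lborel" "S \<in> sets lborel"
    by (elim sets_completionE)
  have "AE x in lborel. x \<notin> N'" using A(3) by (rule AE_not_in)
  then have "AE x in lebesgue. x \<notin> N'" by (rule AE_completion)
  then have "AE x in lebesgue. indicator A x *\<^sub>R f x = indicator S x *\<^sub>R f x"
    by eventually_elim (use A in \<open>auto simp: indicator_def\<close>)
  then have "(\<integral>x. indicator A x *\<^sub>R f x \<partial>lebesgue) = (\<integral>x. indicator S x *\<^sub>R f x \<partial>lebesgue)"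
    using \<open>A \<in> sets lebesgue\<close> A
    by (intro integral_cong_AE) (auto intro!: borel_measurable_integrable int)
  then show "set_lebesgue_integral lebesgue A f = 0"
    using borel[of S] A(4) by (simp add: set_lebesgue_integral_def)
qed

text \<open>Testing against the bumps on a box and letting them steepen shows that the integral over every box
  whose closure lies in the open set is zero.\<close>

lemma fundamental_lemma:
  fixes f :: "'a::euclidean_space \<Rightarrow> 'b::euclidean_space"
  assumes U: "open U"
    and int: "\<And>K. compact K \<Longrightarrow> K \<subseteq> U \<Longrightarrow> set_integrable lebesgue K f"
    and zero: "\<And>\<phi>. \<phi> \<in> test_functions U \<Longrightarrow> (LINT x:U|lebesgue. \<phi> x *\<^sub>R f x) = 0"
  shows "AE x in lebesgue. x \<in> U \<longrightarrow> f x = 0"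
proof -
  have box_zero: "(\<integral>x. indicator (box l u) x *\<^sub>R f x \<partial>lebesgue) = 0" if lu: "cbox l u \<subseteq> U" for l u
  proof -
    have i: "integrable lebesgue (\<lambda>x. indicator (cbox l u) x *\<^sub>R f x)"
      using int[OF compact_cbox lu] by (simp add: set_integrable_def)
    have bs: "box_bump l u n x \<noteq> 0 \<Longrightarrow> x \<in> box l u" for n x
      using box_bump_nonzero[of l u n] by blast
    have meas: "box_bump l u n \<in> borel_measurable lebesgue" for n
    proof -
      have "Ck 0 (box_bump l u n)" using box_bump_test[OF lu] by (auto simp only: test_functions_def)
      then have "box_bump l u n \<in> borel_measurable borel"
        by (simp add: borel_measurable_continuous_onI)
      then show ?thesis by (simp add: measurable_completion)
    qed
    have eq: "indicator U x *\<^sub>R (box_bump l u n x *\<^sub>R f x) =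
        box_bump l u n x *\<^sub>R (indicator (cbox l u) x *\<^sub>R f x)" for n x
      using bs[of n x] lu box_subset_cbox[of l u] by (cases "x \<in> box l u") (auto simp: indicator_def)
    have "(\<lambda>n. \<integral>x. box_bump l u n x *\<^sub>R (indicator (cbox l u) x *\<^sub>R f x) \<partial>lebesgue)
      \<longlonglongrightarrow> (\<integral>x. indicator (box l u) x *\<^sub>R f x \<partial>lebesgue)"
    proof (rule integral_dominated_convergence[where w = "\<lambda>x. norm (indicator (cbox l u) x *\<^sub>R f x)"])
      have *: "indicator (box l u) x *\<^sub>R f x = indicator (box l u) x *\<^sub>R (indicator (cbox l u) x *\<^sub>R f x)" for x
        using box_subset_cbox[of l u] by (auto simp: indicator_def)
      show "(\<lambda>x. indicator (box l u) x *\<^sub>R f x) \<in> borel_measurable lebesgue"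
        unfolding * by (intro borel_measurable_scaleR[OF _ borel_measurable_integrable[OF i]]
            borel_measurable_indicator) simp
      show "(\<lambda>x. box_bump l u n x *\<^sub>R (indicator (cbox l u) x *\<^sub>R f x)) \<in> borel_measurable lebesgue" for n
        by (intro borel_measurable_scaleR borel_measurable_integrable[OF i] meas)
      show "AE x in lebesgue. (\<lambda>n. box_bump l u n x *\<^sub>R (indicator (cbox l u) x *\<^sub>R f x))
        \<longlonglongrightarrow> indicator (box l u) x *\<^sub>R f x"
        unfolding * by (intro AE_I2 tendsto_scaleR box_bump_tendsto tendsto_const)
      show "AE x in lebesgue. norm (box_bump l u n x *\<^sub>R (indicator (cbox l u) x *\<^sub>R f x))
         \<le> norm (indicator (cbox l u) x *\<^sub>R f x)" for n
        unfolding norm_scaleR[of "box_bump l u n _"] abs_of_nonneg[OF box_bump_bounds(1)]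
        by (intro AE_I2 mult_left_le_one_le box_bump_bounds norm_ge_zero)
    qed (rule integrable_norm[OF i])
    moreover have "(\<integral>x. box_bump l u n x *\<^sub>R (indicator (cbox l u) x *\<^sub>R f x) \<partial>lebesgue) = 0" for n
      using zero[OF box_bump_test[OF lu], of n] unfolding set_lebesgue_integral_def eq .
    ultimately show ?thesis
      by (simp add: LIMSEQ_const_iff)
  qed
  obtain D where D: "countable D" "D \<subseteq> Pow U" "\<And>X. X \<in> D \<Longrightarrow> \<exists>a b. X = cbox a b" "\<Union>D = U"
    using open_countable_Union_open_cbox[OF U] by metis
  have "AE x in lebesgue. x \<in> X \<longrightarrow> f x = 0" if X: "X \<in> D" for X
  proof -
    obtain a b where ab: "X = cbox a b" using D(3) X by blast
    have sub: "cbox a b \<subseteq> U" using D(2) X ab by auto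
    have i: "integrable lebesgue (\<lambda>x. indicator (cbox a b) x *\<^sub>R f x)"
      using int[OF compact_cbox sub] by (simp add: set_integrable_def)
    have "integrable lebesgue (\<lambda>x. indicator (box a b) x *\<^sub>R (indicator (cbox a b) x *\<^sub>R f x))"
      by (rule integrable_mult_indicator[OF _ i]) auto
    also have "(\<lambda>x. indicator (box a b) x *\<^sub>R (indicator (cbox a b) x *\<^sub>R f x)) = (\<lambda>x. indicator (box a b) x *\<^sub>R f x)"
      using box_subset_cbox[of a b] by (auto simp: indicator_def fun_eq_iff)
    finally have i': "integrable lebesgue (\<lambda>x. indicator (box a b) x *\<^sub>R f x)" .
    have "AE x in lebesgue. indicator (box a b) x *\<^sub>R f x = 0"
    proof (rule AE_zero_of_box_integrals_zero[OF i'])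
      fix l u :: 'a
      define l' u' where "l' = (\<Sum>i\<in>Basis. max (l \<bullet> i) (a \<bullet> i) *\<^sub>R i)"
        and "u' = (\<Sum>i\<in>Basis. min (u \<bullet> i) (b \<bullet> i) *\<^sub>R i)"
      have 1: "box l u \<inter> box a b = box l' u'" "cbox l u \<inter> cbox a b = cbox l' u'"
        by (auto simp: box_Int_box Int_interval l'_def u'_def)
      have "cbox l' u' \<subseteq> U" using 1(2) sub by blast
      from box_zero[OF this]
      show "(\<integral>x. indicator (box l u) x *\<^sub>R indicator (box a b) x *\<^sub>R f x \<partial>lebesgue) = 0"
        unfolding 1(1)[symmetric] by (simp add: indicator_inter_arith)
    qed
    moreover have "AE x in lebesgue. x \<notin> cbox a b - box a b"
    proof (rule AE_not_in)
      have "frontier (cbox a b) = cbox a b - box a b" by (simp add: frontier_cbox)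
      then show "cbox a b - box a b \<in> null_sets lebesgue"
        using negligible_frontier_interval[of a b] by (simp add: negligible_iff_null_sets)
    qed
    ultimately show ?thesis unfolding ab
      by eventually_elim (auto simp: indicator_def)
  qed
  then have "AE x in lebesgue. \<forall>X\<in>D. x \<in> X \<longrightarrow> f x = 0"
    by (rule AE_ball_countable'[OF _ D(1)])
  then show ?thesis
    by eventually_elim (use D(4) in blast)
qed

section \<open>Weak gradients\<close>

lemma integrable_continuous_bounded_support:
  fixes f :: "'a::euclidean_space \<Rightarrow> 'b::euclidean_space"
  assumes "continuous_on UNIV f" "\<And>x. norm x \<ge> R \<Longrightarrow> f x = 0"
  shows "integrable lborel f"
proof -
  have "set_integrable lborel (cball 0 R) f"
    unfolding set_integrable_def
    by (rule borel_integrable_compact) (auto intro: continuous_on_subset[OF assms(1)])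
  moreover have "(\<lambda>x. indicator (cball 0 R) x *\<^sub>R f x) = f"
    using assms(2) by (auto simp: indicator_def fun_eq_iff)
  ultimately show ?thesis by (simp add: set_integrable_def)
qed

text \<open>Translation invariance kills the difference quotients of a compactly supported
  \<open>C\<^sup>1\<close> function, and they converge boundedly to the directional derivative.\<close>

lemma integral_grad_zero:
  fixes f :: "'a::euclidean_space \<Rightarrow> real"
  assumes "Ck 1 f" "bounded {x. f x \<noteq> 0}"
  shows "integrable lborel (grad f)" "(\<integral>x. grad f x \<partial>lborel) = 0"
proof -
  obtain L R where LR: "L > 0" "R > 0" "\<And>x. norm x \<ge> R \<Longrightarrow> f x = 0" "\<And>x. norm x \<ge> R \<Longrightarrow> grad f x = 0"
    "\<And>x. \<bar>f x\<bar> \<le> L" "\<And>x. norm (grad f x) \<le> L" "\<And>x y. \<bar>f x - f y\<bar> \<le> L * norm (x - y)"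
    by (rule C1_compact_bounds[OF assms], rule that)
  note c = Ck_1D[OF assms(1)]
  show ig: "integrable lborel (grad f)"
    by (rule integrable_continuous_bounded_support[OF c(2) LR(4)])
  have if': "integrable lborel f"
    by (rule integrable_continuous_bounded_support[OF c(3) LR(3)])
  have [measurable]: "f \<in> borel_measurable borel" "grad f \<in> borel_measurable borel"
    using c by (auto intro: borel_measurable_continuous_onI)
  have "(\<integral>x. grad f x \<bullet> b \<partial>lborel) = 0" if b: "b \<in> Basis" for b
  proof -
    define t where "t n = inverse (real (Suc n))" for n
    have t: "t n > 0" "t n \<le> 1" for n by (auto simp: t_def inverse_le_1_iff)
    have t0: "t \<longlonglongrightarrow> 0" unfolding t_def by (rule LIMSEQ_inverse_real_of_nat)
    let ?q = "\<lambda>n x. (f (x + t n *\<^sub>R b) - f x) / t n"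
    have lim: "(\<lambda>n. \<integral>x. ?q n x \<partial>lborel) \<longlonglongrightarrow> (\<integral>x. grad f x \<bullet> b \<partial>lborel)"
    proof (rule integral_dominated_convergence[where w = "\<lambda>x. indicator (cball 0 (R + 1)) x * L"])
      show "integrable lborel (\<lambda>x::'a. indicator (cball 0 (R + 1)) x * L)"
        using emeasure_bounded_finite[of "cball (0::'a) (R + 1)"]
        by (intro integrable_mult_left integrable_real_indicator) auto
      show "AE x in lborel. (\<lambda>n. ?q n x) \<longlonglongrightarrow> grad f x \<bullet> b"
        using t(1) by (intro AE_I2 C1_difference_quotient_tendsto assms(1) t0) (simp add: less_imp_neq[THEN not_sym])
      show "AE x in lborel. norm (?q n x) \<le> indicator (cball 0 (R + 1)) x * L" for n
      proof (rule AE_I2)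
        fix x :: 'a
        have "norm (t n *\<^sub>R b) \<le> 1" using t[of n] b by simp
        then have "norm (x + t n *\<^sub>R b) \<ge> R" if "norm x > R + 1"
          using that norm_triangle_ineq2[of x "- (t n *\<^sub>R b)"] by simp
        then have "?q n x = 0" if "x \<notin> cball 0 (R + 1)"
          using that LR(3)[of x] LR(3)[of "x + t n *\<^sub>R b"] by simp
        moreover have "norm (?q n x) \<le> L"
          using LR(7)[of "x + t n *\<^sub>R b" x] t[of n] b by (simp add: divide_simps)
        ultimately show "norm (?q n x) \<le> indicator (cball 0 (R + 1)) x * L"
          by (cases "x \<in> cball 0 (R + 1)") auto
      qed
    qed measurable
    have zero: "(\<integral>x. ?q n x \<partial>lborel) = 0" for n
    proof -
      have i2: "integrable lborel (\<lambda>x. f (x + t n *\<^sub>R b))" and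
        e2: "(\<integral>x. f (x + t n *\<^sub>R b) \<partial>lborel) = (\<integral>x. f x \<partial>lborel)"
      proof -
        have "integrable (distr lborel borel ((+) (t n *\<^sub>R b))) f"
          using if' by (simp add: lborel_distr_plus)
        then show "integrable lborel (\<lambda>x. f (x + t n *\<^sub>R b))"
          by (subst (asm) integrable_distr_eq) (auto simp: add.commute)
        have "(\<integral>x. f x \<partial>lborel) = (\<integral>x. f x \<partial>distr lborel borel ((+) (t n *\<^sub>R b)))"
          by (simp add: lborel_distr_plus)
        also have "\<dots> = (\<integral>x. f (t n *\<^sub>R b + x) \<partial>lborel)"
          by (rule integral_distr) auto
        finally show "(\<integral>x. f (x + t n *\<^sub>R b) \<partial>lborel) = (\<integral>x. f x \<partial>lborel)"
          by (simp add: add.commute)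
      qed
      show ?thesis
        using i2 if' e2 by (simp add: Bochner_Integration.integral_diff)
    qed
    show ?thesis using lim unfolding zero by (simp add: LIMSEQ_const_iff)
  qed
  then show "(\<integral>x. grad f x \<partial>lborel) = 0"
    using integral_inner_left[of _ lborel "grad f"] ig
    by (intro euclidean_eqI[where 'a = 'a]) simp
qed

lemma test_functionD:
  assumes "\<phi> \<in> test_functions U"
  shows "Ck k \<phi>" "bounded {x. \<phi> x \<noteq> 0}" "compact (closure {x. \<phi> x \<noteq> 0})"
    "closure {x. \<phi> x \<noteq> 0} \<subseteq> U"
proof -
  show "Ck k \<phi>" and c: "compact (closure {x. \<phi> x \<noteq> 0})" and "closure {x. \<phi> x \<noteq> 0} \<subseteq> U"
    using assms unfolding test_functions_def by blast+
  show "bounded {x. \<phi> x \<noteq> 0}"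
    using bounded_subset[OF compact_imp_bounded[OF c] closure_subset] .
qed

lemma test_function_outside:
  assumes "\<phi> \<in> test_functions U" "x \<notin> U"
  shows "\<phi> x = 0" "grad \<phi> x = 0"
proof -
  have "x \<notin> closure {x. \<phi> x \<noteq> 0}" using assms test_functionD(4) by blast
  then show "\<phi> x = 0" "grad \<phi> x = 0"
    using closure_subset[of "{x. \<phi> x \<noteq> 0}"] grad_outside_support[of x \<phi>] by auto
qed

lemma continuous_imp_borel_lebesgue:
  fixes f :: "'a::euclidean_space \<Rightarrow> 'b::euclidean_space"
  assumes "continuous_on UNIV f"
  shows "f \<in> borel_measurable borel" "f \<in> borel_measurable lebesgue"
  using borel_measurable_continuous_onI[OF assms] by (auto simp: measurable_completion)

lemma set_integrable_continuous_compact: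
  fixes f :: "'a::euclidean_space \<Rightarrow> 'b::euclidean_space"
  assumes "compact K" "continuous_on UNIV f"
  shows "set_integrable lebesgue K f"
proof -
  have "integrable lborel (\<lambda>x. indicator K x *\<^sub>R f x)"
    by (rule borel_integrable_compact[OF assms(1) continuous_on_subset[OF assms(2)]]) simp
  then show ?thesis
    unfolding set_integrable_def
    by (subst integrable_completion) (auto dest: borel_measurable_integrable)
qed

text \<open>The product with a test function is compactly supported, so its gradient integrates to zero.\<close>

lemma weak_gradient_of_C1:
  assumes "open U" "Ck 1 f"
  shows "is_weak_gradient U f (grad f)"
  unfolding is_weak_gradient_def
proof (intro conjI allI impI ballI)
  note c = Ck_1D[OF assms(2)]
  fix K assume "compact K \<and> K \<subseteq> U"
  then show "set_integrable lebesgue K f" "set_integrable lebesgue K (grad f)"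
    using c by (auto intro: set_integrable_continuous_compact)
next
  note c = Ck_1D[OF assms(2)]
  fix \<phi> assume \<phi>: "\<phi> \<in> test_functions U"
  note p = test_functionD[OF \<phi>]
  note cp = Ck_1D[OF p(1)[of 1]]
  have "bounded {x. f x * \<phi> x \<noteq> 0}"
    by (rule bounded_subset[OF p(2)]) auto
  from integral_grad_zero[OF Ck_mult[OF assms(2) p(1)[of 1]] this]
  have 0: "(\<integral>x. f x *\<^sub>R grad \<phi> x + \<phi> x *\<^sub>R grad f x \<partial>lborel) = 0"
    by (simp add: grad_mult[OF assms(2) p(1)[of 1]])
  obtain L R where R: "\<And>x. norm x \<ge> R \<Longrightarrow> \<phi> x = 0" "\<And>x. norm x \<ge> R \<Longrightarrow> grad \<phi> x = 0"
    by (rule C1_compact_bounds[OF p(1)[of 1] p(2)], rule that)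
  have i: "integrable lborel (\<lambda>x. f x *\<^sub>R grad \<phi> x)" "integrable lborel (\<lambda>x. \<phi> x *\<^sub>R grad f x)"
    by (rule integrable_continuous_bounded_support[where R = R];
        use R in \<open>auto intro!: continuous_intros c cp\<close>)+
  have eq: "indicator U x *\<^sub>R (f x *\<^sub>R grad \<phi> x) = f x *\<^sub>R grad \<phi> x"
     "indicator U x *\<^sub>R (\<phi> x *\<^sub>R grad f x) = \<phi> x *\<^sub>R grad f x" for x
    using test_function_outside[OF \<phi>, of x] by (auto simp: indicator_def)
  show "(LINT x:U|lebesgue. f x *\<^sub>R grad \<phi> x) = - (LINT x:U|lebesgue. \<phi> x *\<^sub>R grad f x)"
    unfolding set_lebesgue_integral_def eq
    using 0 i by (simp add: integral_completion borel_measurable_integrable eq_neg_iff_add_eq_0)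
qed

lemma weak_gradient_restrict_integral:
  assumes "\<phi> \<in> test_functions U" "S = closure {x. \<phi> x \<noteq> 0}"
  shows "(LINT x:U|lebesgue. \<phi> x *\<^sub>R G x) = (\<integral>x. \<phi> x *\<^sub>R (indicator S x *\<^sub>R G x) \<partial>lebesgue)"
    "(LINT x:U|lebesgue. u x *\<^sub>R grad \<phi> x) = (\<integral>x. (indicator S x *\<^sub>R u x) *\<^sub>R grad \<phi> x \<partial>lebesgue)"
proof -
  have "\<phi> x = 0" "grad \<phi> x = 0" if "x \<notin> S" for x
    using that closure_subset[of "{x. \<phi> x \<noteq> 0}"] grad_outside_support[of x \<phi>] assms(2) by auto
  moreover have "S \<subseteq> U" using assms test_functionD(4) by blast
  ultimately show "(LINT x:U|lebesgue. \<phi> x *\<^sub>R G x) = (\<integral>x. \<phi> x *\<^sub>R (indicator S x *\<^sub>R G x) \<partial>lebesgue)"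
    "(LINT x:U|lebesgue. u x *\<^sub>R grad \<phi> x) = (\<integral>x. (indicator S x *\<^sub>R u x) *\<^sub>R grad \<phi> x \<partial>lebesgue)"
    unfolding set_lebesgue_integral_def
    by (auto intro!: Bochner_Integration.integral_cong simp: indicator_def)
qed

text \<open>The pairings of a function with a test function and with its gradient have their factors in opposite
  order, which the bilinear operation accounts for.\<close>

lemma bilinear_set_integrable:
  fixes m :: "'a::euclidean_space \<Rightarrow> 'c::euclidean_space" and h :: "'a \<Rightarrow> 'b::euclidean_space"
    and P :: "'c \<Rightarrow> 'b \<Rightarrow> 'd::euclidean_space"
  assumes P: "bounded_bilinear P" and m: "m \<in> borel_measurable lebesgue" "\<And>x. norm (m x) \<le> L"
    and h: "set_integrable lebesgue S h"
  shows "integrable lebesgue (\<lambda>x. P (m x) (indicator S x *\<^sub>R h x))"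
proof -
  obtain K where K: "K > 0" "\<And>a b. norm (P a b) \<le> norm a * norm b * K"
    using bounded_bilinear.pos_bounded[OF P] by blast
  have i: "integrable lebesgue (\<lambda>x. indicator S x *\<^sub>R h x)" using h by (simp add: set_integrable_def)
  show ?thesis
  proof (rule Bochner_Integration.integrable_bound)
    show "integrable lebesgue (\<lambda>x. L * norm (indicator S x *\<^sub>R h x) * K)"
      by (intro integrable_mult_left integrable_mult_right integrable_norm i)
    show "(\<lambda>x. P (m x) (indicator S x *\<^sub>R h x)) \<in> borel_measurable lebesgue"
      by (rule borel_measurable_continuous_Pair[OF m(1) borel_measurable_integrable[OF i]
            bounded_bilinear.continuous_on[OF P continuous_on_fst[OF continuous_on_id]
              continuous_on_snd[OF continuous_on_id]]])
    show "AE x in lebesgue. norm (P (m x) (indicator S x *\<^sub>R h x)) \<le> norm (L * norm (indicator S x *\<^sub>R h x) * K)"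
    proof (rule AE_I2)
      fix x
      have "norm (P (m x) (indicator S x *\<^sub>R h x)) \<le> norm (m x) * norm (indicator S x *\<^sub>R h x) * K"
        by (rule K(2))
      also have "\<dots> \<le> L * norm (indicator S x *\<^sub>R h x) * K"
        using K(1) m(2)[of x] by (intro mult_right_mono) auto
      finally show "norm (P (m x) (indicator S x *\<^sub>R h x)) \<le> norm (L * norm (indicator S x *\<^sub>R h x) * K)"
        by (rule order_trans) simp
    qed
  qed
qed

lemma bilinear_L1_limit:
  fixes m :: "'a::euclidean_space \<Rightarrow> 'c::euclidean_space" and h :: "'a \<Rightarrow> 'b::euclidean_space"
    and P :: "'c \<Rightarrow> 'b \<Rightarrow> 'd::euclidean_space"
  assumes P: "bounded_bilinear P" and m: "m \<in> borel_measurable lebesgue" "\<And>x. norm (m x) \<le> L"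
    and h: "set_integrable lebesgue S h" "\<And>k. set_integrable lebesgue S (h' k)"
    and lim: "(\<lambda>k. \<integral>\<^sup>+x. ennreal (norm (h' k x - h x)) * indicator S x \<partial>lebesgue) \<longlonglongrightarrow> 0"
  shows "(\<lambda>k. \<integral>x. P (m x) (indicator S x *\<^sub>R h' k x) \<partial>lebesgue)
    \<longlonglongrightarrow> (\<integral>x. P (m x) (indicator S x *\<^sub>R h x) \<partial>lebesgue)"
proof (rule tendsto_L1_int)
  obtain K where K: "K > 0" "\<And>a b. norm (P a b) \<le> norm a * norm b * K"
    using bounded_bilinear.pos_bounded[OF P] by blast
  have L: "L \<ge> 0" using m(2)[of 0] norm_ge_zero[of "m 0"] by linarith
  let ?d = "\<lambda>k x. ennreal (norm (h' k x - h x)) * indicator S x"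
  have d: "?d k x = ennreal (norm (indicator S x *\<^sub>R h' k x - indicator S x *\<^sub>R h x))" for k x
    by (auto simp: indicator_def)
  have "(\<lambda>k. ennreal (L * K) * (\<integral>\<^sup>+x. ?d k x \<partial>lebesgue)) \<longlonglongrightarrow> ennreal (L * K) * 0"
    by (intro ennreal_tendsto_cmult lim) simp
  then have l: "(\<lambda>k. ennreal (L * K) * (\<integral>\<^sup>+x. ?d k x \<partial>lebesgue)) \<longlonglongrightarrow> 0" by simp
  have "(\<integral>\<^sup>+x. norm (P (m x) (indicator S x *\<^sub>R h' k x) - P (m x) (indicator S x *\<^sub>R h x)) \<partial>lebesgue)
      \<le> ennreal (L * K) * (\<integral>\<^sup>+x. ?d k x \<partial>lebesgue)" for k
  proof -
    have "ennreal (norm (P (m x) (indicator S x *\<^sub>R h' k x) - P (m x) (indicator S x *\<^sub>R h x)))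
        \<le> ennreal (L * K) * ?d k x" for x
    proof -
      let ?y = "indicator S x *\<^sub>R h' k x - indicator S x *\<^sub>R h x"
      have "norm (P (m x) ?y) \<le> norm (m x) * norm ?y * K" by (rule K(2))
      also have "\<dots> \<le> L * norm ?y * K"
        using K(1) m(2)[of x] by (intro mult_right_mono) auto
      finally have "norm (P (m x) ?y) \<le> L * K * norm ?y" by (simp add: mult_ac)
      then show ?thesis
        unfolding d bounded_bilinear.diff_right[OF P, symmetric]
        using K(1) L by (simp add: ennreal_mult[symmetric] ennreal_leI)
    qed
    then have "(\<integral>\<^sup>+x. norm (P (m x) (indicator S x *\<^sub>R h' k x) - P (m x) (indicator S x *\<^sub>R h x)) \<partial>lebesgue)
        \<le> (\<integral>\<^sup>+x. ennreal (L * K) * ?d k x \<partial>lebesgue)"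
      by (intro nn_integral_mono)
    also have "\<dots> = ennreal (L * K) * (\<integral>\<^sup>+x. ?d k x \<partial>lebesgue)"
    proof (rule nn_integral_cmult)
      show "?d k \<in> borel_measurable lebesgue"
        unfolding d using h(2)[of k] h(1) unfolding set_integrable_def
        by (intro measurable_compose[OF _ measurable_ennreal] borel_measurable_integrable
            integrable_norm Bochner_Integration.integrable_diff)
    qed
    finally show ?thesis .
  qed
  then show "(\<lambda>k. \<integral>\<^sup>+x. norm (P (m x) (indicator S x *\<^sub>R h' k x) - P (m x) (indicator S x *\<^sub>R h x)) \<partial>lebesgue) \<longlonglongrightarrow> 0"
    by (intro tendsto_sandwich[OF _ _ tendsto_const l]) auto
qed (intro bilinear_set_integrable[OF P m] h)+

lemma test_function_bounds:
  assumes "\<phi> \<in> test_functions U"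
  obtains L where "\<And>x. norm (\<phi> x) \<le> L" "\<And>x. norm (grad \<phi> x) \<le> L"
    "\<phi> \<in> borel_measurable lebesgue" "grad \<phi> \<in> borel_measurable lebesgue"
proof -
  note p = test_functionD[OF assms]
  obtain L where L: "\<And>x. \<bar>\<phi> x\<bar> \<le> L" "\<And>x. norm (grad \<phi> x) \<le> L"
    by (rule C1_compact_bounds[OF p(1,2)], rule that)
  show thesis
    by (rule that[of L]) (use L Ck_1D[OF p(1)[of 1]] in \<open>auto intro: continuous_imp_borel_lebesgue\<close>)
qed

text \<open>The difference of two weak gradients is orthogonal to all test functions.\<close>

lemma weak_gradient_unique:
  assumes U: "open U" and G: "is_weak_gradient U u G" "is_weak_gradient U u G'"
  shows "AE x in lebesgue. x \<in> U \<longrightarrow> G x = G' x"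
proof -
  have "AE x in lebesgue. x \<in> U \<longrightarrow> G x - G' x = 0"
  proof (rule fundamental_lemma[OF U])
    fix K assume "compact K" "K \<subseteq> U"
    then show "set_integrable lebesgue K (\<lambda>x. G x - G' x)"
      using G by (auto simp: is_weak_gradient_def intro!: set_integral_diff)
  next
    fix \<phi> assume \<phi>: "\<phi> \<in> test_functions U"
    define S where "S = closure {x. \<phi> x \<noteq> 0}"
    have S: "compact S" "S \<subseteq> U" using test_functionD[OF \<phi>] by (auto simp: S_def)
    obtain L where L: "\<And>x. norm (\<phi> x) \<le> L" "\<And>x. norm (grad \<phi> x) \<le> L"
      "\<phi> \<in> borel_measurable lebesgue" "grad \<phi> \<in> borel_measurable lebesgue"
      by (rule test_function_bounds[OF \<phi>], rule that)
    have "(LINT x:U|lebesgue. \<phi> x *\<^sub>R G x) = (LINT x:U|lebesgue. \<phi> x *\<^sub>R G' x)"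
      using G \<phi> unfolding is_weak_gradient_def by (metis neg_equal_iff_equal)
    then have "(\<integral>x. \<phi> x *\<^sub>R (indicator S x *\<^sub>R G x) \<partial>lebesgue) = (\<integral>x. \<phi> x *\<^sub>R (indicator S x *\<^sub>R G' x) \<partial>lebesgue)"
      unfolding weak_gradient_restrict_integral[OF \<phi> S_def] .
    moreover have "integrable lebesgue (\<lambda>x. \<phi> x *\<^sub>R (indicator S x *\<^sub>R G x))"
      "integrable lebesgue (\<lambda>x. \<phi> x *\<^sub>R (indicator S x *\<^sub>R G' x))"
      using G S by (auto simp: is_weak_gradient_def intro!: bilinear_set_integrable[OF bounded_bilinear_scaleR L(3,1)] simp del: scaleR_scaleR)
    ultimately show "(LINT x:U|lebesgue. \<phi> x *\<^sub>R (G x - G' x)) = 0"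
      unfolding weak_gradient_restrict_integral(1)[OF \<phi> S_def]
      by (simp add: Bochner_Integration.integral_diff scaleR_diff_right)
  qed
  then show ?thesis by simp
qed

lemma weak_grad_unique:
  assumes "open U" "is_weak_gradient U u G"
  shows "AE x in lebesgue. x \<in> U \<longrightarrow> weak_grad U u x = G x"
    "is_weak_gradient U u (weak_grad U u)"
proof -
  show "is_weak_gradient U u (weak_grad U u)"
    unfolding weak_grad_def using someI[of "is_weak_gradient U u", OF assms(2)] by simp
  then show "AE x in lebesgue. x \<in> U \<longrightarrow> weak_grad U u x = G x"
    using weak_gradient_unique[OF assms(1) _ assms(2)] by blast
qed

text \<open>Test functions have compact support, so being a weak gradient is a local property.\<close>

lemma weak_gradient_local:
  assumes "\<And>K. compact K \<Longrightarrow> K \<subseteq> U \<Longrightarrow> \<exists>V. K \<subseteq> V \<and> V \<subseteq> U \<and> is_weak_gradient V u G"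
  shows "is_weak_gradient U u G"
  unfolding is_weak_gradient_def
proof (intro conjI allI impI ballI)
  fix K assume "compact K \<and> K \<subseteq> U"
  then show "set_integrable lebesgue K u" "set_integrable lebesgue K G"
    using assms[of K] by (auto simp: is_weak_gradient_def)
next
  fix \<phi> assume \<phi>: "\<phi> \<in> test_functions U"
  then obtain V where V: "closure {x. \<phi> x \<noteq> 0} \<subseteq> V" "V \<subseteq> U" "is_weak_gradient V u G"
    using assms[OF test_functionD(3,4)[OF \<phi>]] by blast
  then have \<phi>': "\<phi> \<in> test_functions V" using \<phi> by (auto simp: test_functions_def)
  then have "(LINT x:V|lebesgue. u x *\<^sub>R grad \<phi> x) = - (LINT x:V|lebesgue. \<phi> x *\<^sub>R G x)"
    using V(3) unfolding is_weak_gradient_def by blast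
  then show "(LINT x:U|lebesgue. u x *\<^sub>R grad \<phi> x) = - (LINT x:U|lebesgue. \<phi> x *\<^sub>R G x)"
    unfolding weak_gradient_restrict_integral[OF \<phi> refl] weak_gradient_restrict_integral[OF \<phi>' refl] .
qed

text \<open>Lebesgue measure is complete, so two functions that agree almost everywhere are measurable or not
  together. This allows congruences for the chosen weak gradients, whose measurability is not at hand.\<close>

lemma integral_lebesgue_cong_AE:
  fixes f g :: "'a::euclidean_space \<Rightarrow> 'b::euclidean_space"
  assumes eq: "AE x in lebesgue. f x = g x"
  shows "integral\<^sup>L lebesgue f = integral\<^sup>L lebesgue g"
proof (cases "f \<in> borel_measurable lebesgue")
  case True
  then show ?thesis using eq borel_measurable_AE[OF True eq] by (intro integral_cong_AE)
next
  case False
  have "AE x in lebesgue. g x = f x" using eq by eventually_elim simp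
  then have "g \<notin> borel_measurable lebesgue" using False borel_measurable_AE by blast
  then have "\<not> integrable lebesgue f" "\<not> integrable lebesgue g"
    using False by (auto dest: borel_measurable_integrable)
  then show ?thesis by (simp add: not_integrable_integral_eq)
qed

lemma weak_gradient_cong_AE:
  assumes "AE x in lebesgue. x \<in> U \<longrightarrow> u x = u' x" "is_weak_gradient U u G"
  shows "is_weak_gradient U u' G"
proof -
  obtain N where N: "N \<in> null_sets lebesgue" "\<And>x. x \<in> U \<Longrightarrow> x \<notin> N \<Longrightarrow> u x = u' x"
    using assms(1) by (auto simp: eventually_ae_filter)
  then have neg: "negligible N" by (simp add: negligible_iff_null_sets)
  show ?thesis
    unfolding is_weak_gradient_def
  proof (intro conjI allI impI ballI)
    fix K assume K: "compact K \<and> K \<subseteq> U"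
    then have u: "set_integrable lebesgue K u" and "set_integrable lebesgue K G"
      using assms(2) by (auto simp: is_weak_gradient_def)
    then show "set_integrable lebesgue K G" by simp
    show "set_integrable lebesgue K u'"
      by (rule absolutely_integrable_spike[OF u neg]) (use K N(2) in auto)
  next
    fix \<phi> assume \<phi>: "\<phi> \<in> test_functions U"
    have eq: "(LINT x:U|lebesgue. u x *\<^sub>R grad \<phi> x) = - (LINT x:U|lebesgue. \<phi> x *\<^sub>R G x)"
      using assms(2) \<phi> by (auto simp: is_weak_gradient_def)
    have "(LINT x:U|lebesgue. u' x *\<^sub>R grad \<phi> x) = (LINT x:U|lebesgue. u x *\<^sub>R grad \<phi> x)"
      unfolding set_lebesgue_integral_def
      by (intro integral_lebesgue_cong_AE eventually_mono[OF assms(1)]) (auto simp: indicator_def)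
    then show "(LINT x:U|lebesgue. u' x *\<^sub>R grad \<phi> x) = - (LINT x:U|lebesgue. \<phi> x *\<^sub>R G x)"
      using eq by simp
  qed
qed

text \<open>The two functions have the same weak gradients, and the choice operator is applied to the same
  predicate, so the chosen gradients are equal and not only equal almost everywhere.\<close>

lemma weak_grad_cong_AE:
  assumes "AE x in lebesgue. x \<in> U \<longrightarrow> u x = u' x"
  shows "weak_grad U u = weak_grad U u'"
proof -
  have "AE x in lebesgue. x \<in> U \<longrightarrow> u' x = u x"
    using assms by eventually_elim simp
  then have "is_weak_gradient U u = is_weak_gradient U u'"
    using assms weak_gradient_cong_AE by blast
  then show ?thesis by (simp add: weak_grad_def)
qed

text \<open>Test functions and their gradients are bounded with compact support, so both sides of the
  defining identity converge when the functions and gradients converge in \<open>L\<^sup>1\<close> on compact sets.\<close>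

lemma weak_gradient_limit:
  fixes u :: "'a::euclidean_space \<Rightarrow> real"
  assumes G: "\<And>k. is_weak_gradient U (u' k) (G' k)"
    and i: "\<And>K. compact K \<Longrightarrow> K \<subseteq> U \<Longrightarrow> set_integrable lebesgue K u"
       "\<And>K. compact K \<Longrightarrow> K \<subseteq> U \<Longrightarrow> set_integrable lebesgue K G"
    and L: "\<And>K. compact K \<Longrightarrow> K \<subseteq> U \<Longrightarrow> (\<lambda>k. \<integral>\<^sup>+x. ennreal (norm (u' k x - u x)) * indicator K x \<partial>lebesgue) \<longlonglongrightarrow> 0"
       "\<And>K. compact K \<Longrightarrow> K \<subseteq> U \<Longrightarrow> (\<lambda>k. \<integral>\<^sup>+x. ennreal (norm (G' k x - G x)) * indicator K x \<partial>lebesgue) \<longlonglongrightarrow> 0"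
  shows "is_weak_gradient U u G"
  unfolding is_weak_gradient_def
proof (intro conjI allI impI ballI)
  fix \<phi> assume \<phi>: "\<phi> \<in> test_functions U"
  define S where "S = closure {x. \<phi> x \<noteq> 0}"
  have S: "compact S" "S \<subseteq> U" using test_functionD[OF \<phi>] by (auto simp: S_def)
  have iG: "set_integrable lebesgue S (u' k)" "set_integrable lebesgue S (G' k)" for k
    using G S by (auto simp: is_weak_gradient_def)
  obtain B where B: "\<And>x. norm (\<phi> x) \<le> B" "\<And>x. norm (grad \<phi> x) \<le> B"
    "\<phi> \<in> borel_measurable lebesgue" "grad \<phi> \<in> borel_measurable lebesgue"
    by (rule test_function_bounds[OF \<phi>], rule that)
  note limG = bilinear_L1_limit[OF bounded_bilinear_scaleR B(3,1) i(2)[OF S] iG(2) L(2)[OF S]]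
  note limu = bilinear_L1_limit[OF bounded_bilinear.flip[OF bounded_bilinear_scaleR] B(4,2) i(1)[OF S] iG(1) L(1)[OF S]]
  have eq: "(\<integral>x. (indicator S x *\<^sub>R u' k x) *\<^sub>R grad \<phi> x \<partial>lebesgue) = - (\<integral>x. \<phi> x *\<^sub>R (indicator S x *\<^sub>R G' k x) \<partial>lebesgue)" for k
    using G[of k] \<phi> unfolding is_weak_gradient_def weak_gradient_restrict_integral[OF \<phi> S_def, symmetric] by blast
  show "(LINT x:U|lebesgue. u x *\<^sub>R grad \<phi> x) = - (LINT x:U|lebesgue. \<phi> x *\<^sub>R G x)"
    unfolding weak_gradient_restrict_integral[OF \<phi> S_def]
    using LIMSEQ_unique[OF limu[unfolded eq] tendsto_minus[OF limG]] .
qed (use i in auto)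

section \<open>Convergence in \<open>L\<^sup>2\<close>\<close>

abbreviation nn_sq_norm :: "'a measure \<Rightarrow> ('a \<Rightarrow> 'b::real_normed_vector) \<Rightarrow> ennreal" where
  "nn_sq_norm M f \<equiv> \<integral>\<^sup>+x. ennreal ((norm (f x))\<^sup>2) \<partial>M"

lemma L2_tendsto_dominated:
  fixes f :: "nat \<Rightarrow> 'a \<Rightarrow> 'b::euclidean_space" and h :: "nat \<Rightarrow> 'a \<Rightarrow> 'c::euclidean_space"
  assumes f: "L2_tendsto M f g"
    and h: "\<And>k. h k \<in> borel_measurable M" "h' \<in> borel_measurable M"
    and le: "\<And>k. AE x in M. norm (h k x - h' x) \<le> C * norm (f k x - g x)" and C: "C \<ge> 0"
  shows "L2_tendsto M h h'"
  unfolding L2_tendsto_def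
proof (intro conjI allI h)
  have m[measurable]: "f k \<in> borel_measurable M" "g \<in> borel_measurable M" for k
    using f by (auto simp: L2_tendsto_def)
  have "(\<lambda>k. ennreal (C\<^sup>2) * nn_sq_norm M (\<lambda>x. f k x - g x)) \<longlonglongrightarrow> ennreal (C\<^sup>2) * 0"
    using f by (intro ennreal_tendsto_cmult) (auto simp: L2_tendsto_def)
  then have lim: "(\<lambda>k. ennreal (C\<^sup>2) * nn_sq_norm M (\<lambda>x. f k x - g x)) \<longlonglongrightarrow> 0"
    by simp
  have "nn_sq_norm M (\<lambda>x. h k x - h' x)
      \<le> ennreal (C\<^sup>2) * nn_sq_norm M (\<lambda>x. f k x - g x)" for k
  proof -
    have "nn_sq_norm M (\<lambda>x. h k x - h' x)
        \<le> (\<integral>\<^sup>+x. ennreal (C\<^sup>2) * ennreal ((norm (f k x - g x))\<^sup>2) \<partial>M)"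
    proof (rule nn_integral_mono_AE)
      show "AE x in M. ennreal ((norm (h k x - h' x))\<^sup>2) \<le> ennreal (C\<^sup>2) * ennreal ((norm (f k x - g x))\<^sup>2)"
        using le[of k]
      proof eventually_elim
        case (elim x)
        then have "(norm (h k x - h' x))\<^sup>2 \<le> (C * norm (f k x - g x))\<^sup>2"
          by (intro power_mono) auto
        then show ?case
          by (simp add: ennreal_mult[symmetric] power_mult_distrib ennreal_leI)
      qed
    qed
    then show ?thesis by (simp add: nn_integral_cmult)
  qed
  then show "(\<lambda>k. nn_sq_norm M (\<lambda>x. h k x - h' x)) \<longlonglongrightarrow> 0"
    by (intro tendsto_sandwich[OF _ _ tendsto_const lim]) auto
qed

lemma norm_add_squared_le: "(norm (a + b :: 'a::real_normed_vector))\<^sup>2 \<le> 2 * (norm a)\<^sup>2 + 2 * (norm b)\<^sup>2"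
proof -
  have "(norm (a + b))\<^sup>2 \<le> (norm a + norm b)\<^sup>2"
    by (intro power_mono norm_triangle_ineq norm_ge_zero)
  also have "\<dots> \<le> 2 * (norm a)\<^sup>2 + 2 * (norm b)\<^sup>2"
    using sum_squares_bound[of "norm a" "norm b"] by (simp add: power2_sum)
  finally show ?thesis .
qed

lemma nn_integral_norm_add_squared_le:
  fixes f g :: "'a \<Rightarrow> 'b::euclidean_space"
  assumes [measurable]: "f \<in> borel_measurable M" "g \<in> borel_measurable M"
  shows "nn_sq_norm M (\<lambda>x. f x + g x)
    \<le> 2 * nn_sq_norm M f + 2 * nn_sq_norm M g"
proof -
  have "ennreal ((norm (f x + g x))\<^sup>2) \<le> 2 * ennreal ((norm (f x))\<^sup>2) + 2 * ennreal ((norm (g x))\<^sup>2)" for x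
  proof -
    have "ennreal ((norm (f x + g x))\<^sup>2) \<le> ennreal (2 * (norm (f x))\<^sup>2 + 2 * (norm (g x))\<^sup>2)"
      by (intro ennreal_leI norm_add_squared_le)
    then show ?thesis by (simp add: ennreal_mult)
  qed
  then have "nn_sq_norm M (\<lambda>x. f x + g x)
    \<le> (\<integral>\<^sup>+x. 2 * ennreal ((norm (f x))\<^sup>2) + 2 * ennreal ((norm (g x))\<^sup>2) \<partial>M)"
    by (intro nn_integral_mono)
  then show ?thesis by (simp add: nn_integral_add nn_integral_cmult)
qed

lemma L2_tendsto_add:
  fixes f g :: "nat \<Rightarrow> 'a \<Rightarrow> 'b::euclidean_space"
  assumes "L2_tendsto M f f'" "L2_tendsto M g g'"
  shows "L2_tendsto M (\<lambda>k x. f k x + g k x) (\<lambda>x. f' x + g' x)"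
  unfolding L2_tendsto_def
proof (intro conjI allI)
  have m[measurable]: "f k \<in> borel_measurable M" "f' \<in> borel_measurable M" 
    "g k \<in> borel_measurable M" "g' \<in> borel_measurable M" for k
    using assms by (auto simp: L2_tendsto_def)
  show "(\<lambda>x. f k x + g k x) \<in> borel_measurable M" "(\<lambda>x. f' x + g' x) \<in> borel_measurable M" for k
    by measurable
  have "(\<lambda>k. 2 * nn_sq_norm M (\<lambda>x. f k x - f' x) + 2 * nn_sq_norm M (\<lambda>x. g k x - g' x))
     \<longlonglongrightarrow> 2 * 0 + 2 * 0"
    using assms by (intro tendsto_add ennreal_tendsto_cmult) (auto simp: L2_tendsto_def)
  then have lim: "(\<lambda>k. 2 * nn_sq_norm M (\<lambda>x. f k x - f' x) + 2 * nn_sq_norm M (\<lambda>x. g k x - g' x))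
     \<longlonglongrightarrow> 0" by simp
  have "nn_sq_norm M (\<lambda>x. f k x + g k x - (f' x + g' x)) \<le>
     2 * nn_sq_norm M (\<lambda>x. f k x - f' x) + 2 * nn_sq_norm M (\<lambda>x. g k x - g' x)" for k
    using nn_integral_norm_add_squared_le[of "\<lambda>x. f k x - f' x" M "\<lambda>x. g k x - g' x"]
    by (simp add: add_diff_add)
  then show "(\<lambda>k. nn_sq_norm M (\<lambda>x. f k x + g k x - (f' x + g' x))) \<longlonglongrightarrow> 0"
    by (intro tendsto_sandwich[OF _ _ tendsto_const lim]) auto
qed

text \<open>The difference of the squared norms is at most \<open>(1 + 1/d) \<bar>f - g\<bar>\<^sup>2 + d \<bar>g\<bar>\<^sup>2\<close> pointwise for every
  \<open>d > 0\<close>; first \<open>d\<close> is chosen small against the norm of the limit, then the index large.\<close>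

lemma L2_tendsto_norm:
  fixes f :: "nat \<Rightarrow> 'a \<Rightarrow> 'b::euclidean_space"
  assumes f: "L2_tendsto M f g" and fin: "\<And>k. integrable M (\<lambda>x. (norm (f k x))\<^sup>2)"
  shows "integrable M (\<lambda>x. (norm (g x))\<^sup>2)"
    "(\<lambda>k. \<integral>x. (norm (f k x))\<^sup>2 \<partial>M) \<longlonglongrightarrow> (\<integral>x. (norm (g x))\<^sup>2 \<partial>M)"
proof -
  have m[measurable]: "f k \<in> borel_measurable M" "g \<in> borel_measurable M" for k
    using f by (auto simp: L2_tendsto_def)
  let ?D = "\<lambda>k. nn_sq_norm M (\<lambda>x. f k x - g x)"
  have D: "?D \<longlonglongrightarrow> 0" using f by (auto simp: L2_tendsto_def)
  then have "\<forall>\<^sub>F k in sequentially. ?D k < 1"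
    by (rule order_tendstoD) simp
  then obtain k where k: "?D k < 1" by (auto simp: eventually_sequentially)
  have "nn_sq_norm M g \<le> 2 * nn_sq_norm M (\<lambda>x. f k x) + 2 * ?D k"
    using nn_integral_norm_add_squared_le[of "f k" M "\<lambda>x. g x - f k x"]
    by (simp add: norm_minus_commute)
  also have "nn_sq_norm M (\<lambda>x. f k x) = ennreal (\<integral>x. (norm (f k x))\<^sup>2 \<partial>M)"
    using fin[of k] by (intro nn_integral_eq_integral) auto
  also have "2 * ennreal (\<integral>x. (norm (f k x))\<^sup>2 \<partial>M) + 2 * ?D k < \<infinity>"
    using k by (auto simp: ennreal_mult_less_top ennreal_mult_eq_top_iff less_top[symmetric])
  finally have g_fin: "nn_sq_norm M g < \<infinity>" .
  show ig: "integrable M (\<lambda>x. (norm (g x))\<^sup>2)"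
    by (rule integrableI_bounded) (use g_fin in auto)
  define I where "I = (\<integral>x. (norm (g x))\<^sup>2 \<partial>M)"
  have I: "I \<ge> 0" unfolding I_def by (intro Bochner_Integration.integral_nonneg) auto
  show "(\<lambda>k. \<integral>x. (norm (f k x))\<^sup>2 \<partial>M) \<longlonglongrightarrow> (\<integral>x. (norm (g x))\<^sup>2 \<partial>M)"
  proof (rule tendstoI)
    fix e :: real assume e: "e > 0"
    define d where "d = e / (2 * (I + 1))"
    have d: "d > 0" using e I by (simp add: d_def)
    define c where "c = e / (2 * (1 + inverse d))"
    have c: "c > 0" using e d by (simp add: c_def add_pos_pos)
    have "\<forall>\<^sub>F k in sequentially. ?D k < ennreal c"
      using D by (rule order_tendstoD) (use c in simp)
    then show "\<forall>\<^sub>F k in sequentially. dist (\<integral>x. (norm (f k x))\<^sup>2 \<partial>M) (\<integral>x. (norm (g x))\<^sup>2 \<partial>M) < e"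
    proof eventually_elim
      case (elim k)
      have iD: "integrable M (\<lambda>x. (norm (f k x - g x))\<^sup>2)"
        by (rule integrableI_bounded) (use elim in \<open>auto simp: less_top[symmetric]\<close>)
      have "?D k = ennreal (\<integral>x. (norm (f k x - g x))\<^sup>2 \<partial>M)"
        using iD by (intro nn_integral_eq_integral) auto
      then have Dc: "(\<integral>x. (norm (f k x - g x))\<^sup>2 \<partial>M) < c"
        using elim c by (simp add: ennreal_less_iff)
      have pt: "\<bar>(norm (f k x))\<^sup>2 - (norm (g x))\<^sup>2\<bar> \<le> (1 + inverse d) * (norm (f k x - g x))\<^sup>2 + d * (norm (g x))\<^sup>2" for x
      proof -
        let ?a = "norm (f k x)" and ?b = "norm (g x)" and ?n = "norm (f k x - g x)"
        have 1: "\<bar>?a - ?b\<bar> \<le> ?n" by (rule norm_triangle_ineq3)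
        then have 2: "?a + ?b \<le> ?n + 2 * ?b" by linarith
        have "\<bar>?a\<^sup>2 - ?b\<^sup>2\<bar> = \<bar>?a - ?b\<bar> * (?a + ?b)"
          by (simp add: power2_eq_square square_diff_square_factored abs_mult mult.commute)
        also have "\<dots> \<le> ?n * (?n + 2 * ?b)" by (intro mult_mono 1 2) auto
        also have "2 * (?n * ?b) \<le> inverse d * ?n\<^sup>2 + d * ?b\<^sup>2"
        proof -
          have "0 \<le> inverse d * (?n - d * ?b)\<^sup>2" using d by simp
          also have "\<dots> = inverse d * ?n\<^sup>2 + d * ?b\<^sup>2 - 2 * (?n * ?b)"
            using d by (simp add: power2_eq_square field_simps)
          finally show ?thesis by simp
        qed
        then have "?n * (?n + 2 * ?b) \<le> (1 + inverse d) * ?n\<^sup>2 + d * ?b\<^sup>2"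
          by (simp add: power2_eq_square algebra_simps)
        finally show ?thesis .
      qed
      have "\<bar>(\<integral>x. (norm (f k x))\<^sup>2 \<partial>M) - (\<integral>x. (norm (g x))\<^sup>2 \<partial>M)\<bar> = \<bar>\<integral>x. (norm (f k x))\<^sup>2 - (norm (g x))\<^sup>2 \<partial>M\<bar>"
        using fin ig by simp
      also have "\<dots> \<le> (\<integral>x. \<bar>(norm (f k x))\<^sup>2 - (norm (g x))\<^sup>2\<bar> \<partial>M)"
        by (rule integral_abs_bound)
      also have "\<dots> \<le> (\<integral>x. (1 + inverse d) * (norm (f k x - g x))\<^sup>2 + d * (norm (g x))\<^sup>2 \<partial>M)"
        using fin ig iD pt by (intro integral_mono) auto
      also have "\<dots> = (1 + inverse d) * (\<integral>x. (norm (f k x - g x))\<^sup>2 \<partial>M) + d * I"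
        using ig iD by (simp add: I_def)
      also have "(1 + inverse d) * (\<integral>x. (norm (f k x - g x))\<^sup>2 \<partial>M) < (1 + inverse d) * c"
        using Dc d by (intro mult_strict_left_mono) (auto simp: add_pos_pos)
      also have "(1 + inverse d) * c = e / 2"
      proof -
        have "q * (e / (2 * q)) = e / 2" if "q > 0" for q :: real using that by simp
        from this[of "1 + inverse d"] show ?thesis unfolding c_def using d by (simp add: add_pos_pos)
      qed
      also have "d * I \<le> e / 2"
        using I e by (simp add: d_def field_simps)
      finally show ?case by (simp add: dist_real_def)
    qed
  qed
qed

text \<open>Completeness of \<open>L\<^sup>2\<close>: along a subsequence whose successive differences have squared norm at
  most \<open>8\<^sup>-\<^sup>i\<close>, the series of \<open>4\<^sup>i\<close> times those squares has a finite integral, so the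
  subsequence converges almost everywhere; Fatou's lemma then controls the distance to its limit.\<close>

lemma L2_complete:
  fixes f :: "nat \<Rightarrow> 'a \<Rightarrow> 'b::euclidean_space"
  assumes m[measurable]: "\<And>k. f k \<in> borel_measurable M"
    and cauchy: "\<And>e. e > 0 \<Longrightarrow> \<exists>N. \<forall>j\<ge>N. \<forall>k\<ge>N. nn_sq_norm M (\<lambda>x. f j x - f k x) < ennreal e"
  obtains g where "L2_tendsto M f g"
proof -
  have "\<forall>i. \<exists>N. \<forall>j\<ge>N. \<forall>k\<ge>N. nn_sq_norm M (\<lambda>x. f j x - f k x) < ennreal ((1/8) ^ i)"
    using cauchy by simp
  then obtain N where N: "\<And>i j k. j \<ge> N i \<Longrightarrow> k \<ge> N i \<Longrightarrow>
      nn_sq_norm M (\<lambda>x. f j x - f k x) < ennreal ((1/8) ^ i)"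
    by metis
  define n where "n i = (\<Sum>j\<le>i. N j) + i" for i
  have nN: "n i \<ge> N i" "n (Suc i) \<ge> N i" "n i \<ge> i" for i
    by (auto simp: n_def intro: order_trans[OF member_le_sum[of i "{..i}" N]])
  let ?d = "\<lambda>i x. norm (f (n (Suc i)) x - f (n i) x)"
  have "(\<integral>\<^sup>+x. (\<Sum>i. ennreal (4 ^ i * (?d i x)\<^sup>2)) \<partial>M) = (\<Sum>i. \<integral>\<^sup>+x. ennreal (4 ^ i * (?d i x)\<^sup>2) \<partial>M)"
    by (rule nn_integral_suminf) measurable
  also have "\<dots> \<le> (\<Sum>i. ennreal ((1/2) ^ i))"
  proof (rule suminf_le)
    fix i
    have "(\<integral>\<^sup>+x. ennreal (4 ^ i * (?d i x)\<^sup>2) \<partial>M) = ennreal (4 ^ i) * (\<integral>\<^sup>+x. ennreal ((?d i x)\<^sup>2) \<partial>M)"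
      by (simp add: ennreal_mult nn_integral_cmult)
    also have "\<dots> \<le> ennreal (4 ^ i) * ennreal ((1/8) ^ i)"
      using N[OF nN(2) nN(1), of i] by (intro mult_left_mono) auto
    also have "\<dots> = ennreal ((1/2) ^ i)"
      by (simp add: ennreal_mult[symmetric] power_mult_distrib[symmetric])
    finally show "(\<integral>\<^sup>+x. ennreal (4 ^ i * (?d i x)\<^sup>2) \<partial>M) \<le> ennreal ((1/2) ^ i)" .
  qed auto
  also have "\<dots> = ennreal (\<Sum>i. (1/2) ^ i)"
    by (intro suminf_ennreal2) (auto simp: summable_geometric)
  finally have fin: "(\<integral>\<^sup>+x. (\<Sum>i. ennreal (4 ^ i * (?d i x)\<^sup>2)) \<partial>M) \<noteq> \<infinity>"
    by (auto simp: top_unique)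
  have "AE x in M. (\<Sum>i. ennreal (4 ^ i * (?d i x)\<^sup>2)) \<noteq> \<infinity>"
    by (rule nn_integral_PInf_AE[OF _ fin]) measurable
  then have conv: "AE x in M. convergent (\<lambda>i. f (n i) x)"
  proof eventually_elim
    case (elim x)
    have "summable (\<lambda>i. 4 ^ i * (?d i x)\<^sup>2)"
      using elim by (intro summable_suminf_not_top) auto
    then have "(\<lambda>i. 4 ^ i * (?d i x)\<^sup>2) \<longlonglongrightarrow> 0" by (rule summable_LIMSEQ_zero)
    then have "\<forall>\<^sub>F i in sequentially. 4 ^ i * (?d i x)\<^sup>2 < 1"
      by (rule order_tendstoD) simp
    then have "\<forall>\<^sub>F i in sequentially. norm (f (n (Suc i)) x - f (n i) x) \<le> (1/2) ^ i"
    proof eventually_elim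
      case (elim i)
      have "(4::real) ^ i = (2 ^ i)\<^sup>2" by (simp add: power_mult_distrib[symmetric] power2_eq_square)
      then have "(2 ^ i * ?d i x)\<^sup>2 < 1\<^sup>2" using elim by (simp add: power_mult_distrib)
      then have "2 ^ i * ?d i x < 1" by (rule power_less_imp_less_base) simp
      then show ?case by (simp add: field_simps)
    qed
    then have "summable (\<lambda>i. f (n (Suc i)) x - f (n i) x)"
      by (rule summable_comparison_test_ev) (simp add: summable_geometric)
    then have "(\<lambda>i. \<Sum>j<i. f (n (Suc j)) x - f (n j) x) \<longlonglongrightarrow> (\<Sum>i. f (n (Suc i)) x - f (n i) x)"
      by (rule summable_LIMSEQ)
    then have "(\<lambda>i. f (n i) x - f (n 0) x) \<longlonglongrightarrow> (\<Sum>i. f (n (Suc i)) x - f (n i) x)"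
      by (simp only: sum_lessThan_telescope[of "\<lambda>i. f (n i) x"])
    then have "(\<lambda>i. (f (n i) x - f (n 0) x) + f (n 0) x) \<longlonglongrightarrow> (\<Sum>i. f (n (Suc i)) x - f (n i) x) + f (n 0) x"
      by (intro tendsto_add tendsto_const)
    then show ?case by (simp add: convergentI)
  qed
  define g where "g x = lim (\<lambda>i. f (n i) x)" for x
  have [measurable]: "g \<in> borel_measurable M"
    unfolding g_def by (rule borel_measurable_lim_metric) measurable
  have lim: "AE x in M. (\<lambda>i. f (n i) x) \<longlonglongrightarrow> g x"
    using conv by eventually_elim (simp add: g_def convergent_LIMSEQ_iff)
  have "(\<lambda>k. nn_sq_norm M (\<lambda>x. f k x - g x)) \<longlonglongrightarrow> 0"
  proof (rule tendsto_0_if_Limsup_eq_0_ennreal[OF antisym[OF _ zero_le]], rule ennreal_le_epsilon)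
    fix e :: real assume e: "e > 0"
    obtain N where N: "\<And>j k. j \<ge> N \<Longrightarrow> k \<ge> N \<Longrightarrow> nn_sq_norm M (\<lambda>x. f j x - f k x) < ennreal e"
      using cauchy[OF e] by blast
    have "nn_sq_norm M (\<lambda>x. f j x - g x) \<le> ennreal e" if j: "j \<ge> N" for j
    proof -
      have "nn_sq_norm M (\<lambda>x. f j x - g x)
          = (\<integral>\<^sup>+x. liminf (\<lambda>i. ennreal ((norm (f j x - f (n i) x))\<^sup>2)) \<partial>M)"
      proof (rule nn_integral_cong_AE)
        show "AE x in M. ennreal ((norm (f j x - g x))\<^sup>2) = liminf (\<lambda>i. ennreal ((norm (f j x - f (n i) x))\<^sup>2))"
          using lim
        proof eventually_elim
          case (elim x)
          have "(\<lambda>i. ennreal ((norm (f j x - f (n i) x))\<^sup>2)) \<longlonglongrightarrow> ennreal ((norm (f j x - g x))\<^sup>2)"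
            by (intro tendsto_ennrealI tendsto_intros elim)
          from lim_imp_Liminf[OF _ this] show ?case by simp
        qed
      qed
      also have "\<dots> \<le> liminf (\<lambda>i. nn_sq_norm M (\<lambda>x. f j x - f (n i) x))"
        by (rule nn_integral_liminf) measurable
      also have "\<dots> \<le> limsup (\<lambda>i. nn_sq_norm M (\<lambda>x. f j x - f (n i) x))"
        by (rule Liminf_le_Limsup) simp
      also have "\<dots> \<le> ennreal e"
      proof (rule Limsup_bounded)
        show "\<forall>\<^sub>F i in sequentially. nn_sq_norm M (\<lambda>x. f j x - f (n i) x) \<le> ennreal e"
          using eventually_ge_at_top[of N]
          by eventually_elim (use N[OF j] nN(3) in \<open>meson less_imp_le order_trans\<close>)
      qed
      finally show ?thesis .
    qed
    then have "limsup (\<lambda>k. nn_sq_norm M (\<lambda>x. f k x - g x)) \<le> ennreal e"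
      by (intro Limsup_bounded) (auto simp: eventually_sequentially)
    then show "limsup (\<lambda>k. nn_sq_norm M (\<lambda>x. f k x - g x)) \<le> 0 + ennreal e" by simp
  qed
  then have "L2_tendsto M f g" by (simp add: L2_tendsto_def)
  then show thesis by (rule that)
qed

lemma L2_tendsto_unique_AE:
  fixes g :: "'a \<Rightarrow> 'b::euclidean_space"
  assumes f: "L2_tendsto M f g" and f': "L2_tendsto M f' g'"
    and d: "(\<lambda>k. nn_sq_norm M (\<lambda>x. f k x - f' k x)) \<longlonglongrightarrow> 0"
  shows "AE x in M. g x = g' x"
proof -
  have m[measurable]: "f k \<in> borel_measurable M" "g \<in> borel_measurable M"
    "f' k \<in> borel_measurable M" "g' \<in> borel_measurable M" for k
    using f f' by (auto simp: L2_tendsto_def)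
  let ?I = "\<lambda>h. nn_sq_norm M h"
  have le: "?I (\<lambda>x. g x - g' x) \<le> 2 * ?I (\<lambda>x. f k x - g x)
       + 2 * (2 * ?I (\<lambda>x. f k x - f' k x) + 2 * ?I (\<lambda>x. f' k x - g' x))" for k
  proof -
    have "?I (\<lambda>x. g x - g' x) \<le> 2 * ?I (\<lambda>x. g x - f k x) + 2 * ?I (\<lambda>x. f k x - g' x)"
      using nn_integral_norm_add_squared_le[of "\<lambda>x. g x - f k x" M "\<lambda>x. f k x - g' x"] by simp
    also have "?I (\<lambda>x. f k x - g' x) \<le> 2 * ?I (\<lambda>x. f k x - f' k x) + 2 * ?I (\<lambda>x. f' k x - g' x)"
      using nn_integral_norm_add_squared_le[of "\<lambda>x. f k x - f' k x" M "\<lambda>x. f' k x - g' x"] by simp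
    finally show ?thesis by (simp add: norm_minus_commute mult_left_mono add_left_mono)
  qed
  have "(\<lambda>k. 2 * ?I (\<lambda>x. f k x - g x) + 2 * (2 * ?I (\<lambda>x. f k x - f' k x) + 2 * ?I (\<lambda>x. f' k x - g' x)))
      \<longlonglongrightarrow> 2 * 0 + 2 * (2 * 0 + 2 * 0)"
    using f f' d by (intro tendsto_add ennreal_tendsto_cmult) (auto simp: L2_tendsto_def)
  then have "?I (\<lambda>x. g x - g' x) \<le> 2 * 0 + 2 * (2 * 0 + 2 * 0)"
    by (rule LIMSEQ_le_const) (use le in auto)
  then have "?I (\<lambda>x. g x - g' x) = 0" by simp
  then show ?thesis by (subst (asm) nn_integral_0_iff_AE) auto
qed

lemma L2_tendsto_imp_L1:
  fixes f :: "nat \<Rightarrow> 'a \<Rightarrow> 'b::euclidean_space"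
  assumes f: "L2_tendsto M f g" and fin: "emeasure M (space M) < \<infinity>"
  shows "(\<lambda>k. \<integral>\<^sup>+x. norm (f k x - g x) \<partial>M) \<longlonglongrightarrow> 0"
proof -
  have m[measurable]: "f k \<in> borel_measurable M" "g \<in> borel_measurable M" for k
    using f by (auto simp: L2_tendsto_def)
  let ?m = "emeasure M (space M)"
  have CS: "(\<integral>\<^sup>+x. norm (f k x - g x) \<partial>M)\<^sup>2 \<le> ?m * nn_sq_norm M (\<lambda>x. f k x - g x)" for k
    using Cauchy_Schwarz_nn_integral[of "\<lambda>x. ennreal (norm (f k x - g x))" M "\<lambda>_. 1"]
    by (simp add: ennreal_power mult.commute)
  have "(\<lambda>k. ?m * nn_sq_norm M (\<lambda>x. f k x - g x)) \<longlonglongrightarrow> ?m * 0"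
    using f fin by (intro ennreal_tendsto_cmult) (auto simp: L2_tendsto_def)
  then have lim: "(\<lambda>k. ?m * nn_sq_norm M (\<lambda>x. f k x - g x)) \<longlonglongrightarrow> 0" by simp
  show ?thesis
  proof (rule tendsto_0_if_Limsup_eq_0_ennreal[OF antisym[OF _ zero_le]], rule ennreal_le_epsilon)
    fix e :: real assume e: "e > 0"
    have "\<forall>\<^sub>F k in sequentially. ?m * nn_sq_norm M (\<lambda>x. f k x - g x) < ennreal (e\<^sup>2)"
      using lim by (rule order_tendstoD) (use e in simp)
    then have "\<forall>\<^sub>F k in sequentially. (\<integral>\<^sup>+x. norm (f k x - g x) \<partial>M) \<le> ennreal e"
    proof eventually_elim
      case (elim k)
      then have "(\<integral>\<^sup>+x. norm (f k x - g x) \<partial>M)\<^sup>2 < (ennreal e)\<^sup>2"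
        using CS[of k] e by (simp add: ennreal_power)
      then show ?case using power_mono[of "ennreal e" "\<integral>\<^sup>+x. norm (f k x - g x) \<partial>M" 2]
        by (meson leD less_imp_le not_le zero_le)
    qed
    then show "limsup (\<lambda>k. \<integral>\<^sup>+x. ennreal (norm (f k x - g x)) \<partial>M) \<le> 0 + ennreal e"
      by (simp add: Limsup_bounded)
  qed
qed

section \<open>Flux of a compactly supported function through a sphere\<close>

lemma lborel_scale:
  fixes H :: "'a::euclidean_space \<Rightarrow> real"
  assumes [measurable]: "H \<in> borel_measurable borel" and c: "c > 0"
  shows "(\<integral>x. H x \<partial>lborel) = c ^ DIM('a) * (\<integral>x. H (c *\<^sub>R x) \<partial>lborel)"
proof -
  have "(\<integral>x. H x \<partial>lborel) = (\<integral>x. H x \<partial>density (distr lborel borel (\<lambda>x. 0 + c *\<^sub>R x)) (\<lambda>_. \<bar>c\<bar>^DIM('a)))"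
    using c by (subst lborel_affine[of c 0]) auto
  also have "\<dots> = (\<integral>x. \<bar>c\<bar>^DIM('a) * H x \<partial>distr lborel borel (\<lambda>x. 0 + c *\<^sub>R x))"
    by (subst integral_density) auto
  also have "\<dots> = (\<integral>x. \<bar>c\<bar>^DIM('a) * H (c *\<^sub>R x) \<partial>lborel)"
    by (subst integral_distr) auto
  finally show ?thesis using c by simp
qed

lemma nn_integral_lborel_scale:
  fixes H :: "'a::euclidean_space \<Rightarrow> ennreal"
  assumes [measurable]: "H \<in> borel_measurable borel" and c: "c > 0"
  shows "(\<integral>\<^sup>+x. H x \<partial>lborel) = ennreal (c ^ DIM('a)) * (\<integral>\<^sup>+x. H (c *\<^sub>R x) \<partial>lborel)"
proof -
  have "(\<integral>\<^sup>+x. H x \<partial>lborel) = (\<integral>\<^sup>+x. H x \<partial>density (distr lborel borel (\<lambda>x. 0 + c *\<^sub>R x)) (\<lambda>_. \<bar>c\<bar>^DIM('a)))"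
    using c by (subst lborel_affine[of c 0]) auto
  also have "\<dots> = (\<integral>\<^sup>+x. ennreal (\<bar>c\<bar>^DIM('a)) * H x \<partial>distr lborel borel (\<lambda>x. 0 + c *\<^sub>R x))"
    by (subst nn_integral_density) auto
  also have "\<dots> = (\<integral>\<^sup>+x. ennreal (\<bar>c\<bar>^DIM('a)) * H (c *\<^sub>R x) \<partial>lborel)"
    by (subst nn_integral_distr) auto
  finally show ?thesis using c by (simp add: nn_integral_cmult)
qed

lemma integrable_bounded_on_cball:
  fixes g :: "'a::euclidean_space \<Rightarrow> real"
  assumes "g \<in> borel_measurable borel" "\<And>x. \<bar>g x\<bar> \<le> indicator (cball 0 R) x * B"
  shows "integrable lborel g"
proof (rule Bochner_Integration.integrable_bound)
  show "integrable lborel (\<lambda>x::'a. indicator (cball 0 R) x * B)"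
    using emeasure_bounded_finite[of "cball (0::'a) R"]
    by (intro integrable_mult_left integrable_real_indicator) auto
  show "AE x in lborel. norm (g x) \<le> norm (indicator (cball 0 R) x * B)"
    using assms(2) by (intro AE_I2) (metis abs_ge_self order_trans real_norm_def)
qed (use assms(1) in simp)

text \<open>Bernoulli's inequality; the bound is uniform in the step \<open>e\<close> and dominates the difference quotients
  of the kernel in the flux identity.\<close>

lemma inverse_power_quotient_bound:
  assumes p: "0 < p" "p \<le> q" "q \<le> (1 + e) * p" and e: "e > 0"
  shows "\<bar>((1 / q) ^ n - (1 / p) ^ n) / e\<bar> \<le> real n * (1 / p) ^ n"
proof -
  have q: "q > 0" using p by simp
  have 1: "(1 / q) ^ n \<le> (1 / p) ^ n"
    using p q by (intro power_mono) (auto simp: divide_simps)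
  have "1 - real n * e \<le> 1 + real n * (- (e / (1 + e)))"
    using e by (auto simp: field_simps intro!: mult_left_mono)
  also have "\<dots> \<le> (1 + (- (e / (1 + e)))) ^ n"
    using e by (intro Bernoulli_inequality) (simp add: divide_simps)
  also have "1 + (- (e / (1 + e))) = 1 / (1 + e)"
    using e by (simp add: field_simps)
  finally have "(1 - real n * e) * (1 / p) ^ n \<le> (1 / (1 + e)) ^ n * (1 / p) ^ n"
    using p by (intro mult_right_mono) auto
  also have "\<dots> = (1 / ((1 + e) * p)) ^ n"
    by (simp add: power_mult_distrib[symmetric])
  also have "\<dots> \<le> (1 / q) ^ n"
    using p q e by (intro power_mono divide_left_mono) auto
  finally have "(1 / p) ^ n - (1 / q) ^ n \<le> e * (real n * (1 / p) ^ n)"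
    by (simp add: algebra_simps)
  then have "\<bar>(1 / q) ^ n - (1 / p) ^ n\<bar> \<le> e * (real n * (1 / p) ^ n)"
    using 1 by linarith
  then have "\<bar>(1 / q) ^ n - (1 / p) ^ n\<bar> / e \<le> real n * (1 / p) ^ n"
    using e by (simp only: pos_divide_le_eq mult.commute)
  then show ?thesis using e by (simp only: abs_divide abs_of_pos)
qed

text \<open>Extend \<open>f\<close> from \<open>\<bar>x\<bar> \<ge> r\<close> to a function \<open>F\<close> that is constant along rays inside the ball, and let
  \<open>k = max (\<bar>x\<bar>, r)\<^sup>-\<^sup>N\<close>. The integral of \<open>F (s x) k (x)\<close> can be differentiated at \<open>s = 1\<close> in two ways.
  Directly, it yields the integral of \<open>x \<cdot> \<nabla>f / \<bar>x\<bar>\<^sup>N\<close> outside the ball. After the substitution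
  \<open>y = s x\<close> the parameter enters only through the kernel \<open>max (\<bar>y\<bar>, r s)\<^sup>-\<^sup>N\<close>, which depends on \<open>s\<close>
  only for \<open>\<bar>y\<bar> < r s\<close>, and yields a multiple of the integral of \<open>F\<close> over the ball. That integral is
  the one by which the surface measure is defined.\<close>

lemma radial_flux:
  fixes f :: "'a::euclidean_space \<Rightarrow> real"
  assumes f: "Ck 1 f" "bounded {x. f x \<noteq> 0}" and r: "r > 0"
  shows "integrable lborel (\<lambda>x. indicator (- ball 0 r) x * ((grad f x \<bullet> x) / norm x ^ DIM('a)))"
    "(\<integral>x. indicator (- ball 0 r) x * ((grad f x \<bullet> x) / norm x ^ DIM('a)) \<partial>lborel)
      = - (real DIM('a) / r ^ DIM('a)) * (\<integral>x. indicator (cball 0 r) x * f ((r / norm x) *\<^sub>R x) \<partial>lborel)"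
proof -
  let ?N = "DIM('a)"
  obtain L R where LR: "L > 0" "R > 0" "\<And>x. norm x \<ge> R \<Longrightarrow> f x = 0" "\<And>x. norm x \<ge> R \<Longrightarrow> grad f x = 0"
    "\<And>x. \<bar>f x\<bar> \<le> L" "\<And>x. norm (grad f x) \<le> L" "\<And>x y. \<bar>f x - f y\<bar> \<le> L * norm (x - y)"
    by (rule C1_compact_bounds[OF f], rule that)
  note c = Ck_1D[OF f(1)]
  have [measurable]: "f \<in> borel_measurable borel" "grad f \<in> borel_measurable borel"
    using c by (auto intro: borel_measurable_continuous_onI)
  \<comment> \<open>The factors \<open>s = 1 + e n\<close> exceed 1, so that the limits also hold on the sphere itself.\<close>
  define e where "e n = inverse (real (Suc n))" for n
  have e: "e n > 0" "e n \<le> 1" "e n \<noteq> 0" for n by (auto simp: e_def inverse_le_1_iff)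
  have e0: "e \<longlonglongrightarrow> 0" unfolding e_def by (rule LIMSEQ_inverse_real_of_nat)
  \<comment> \<open>Radial projection onto the complement of the ball.\<close>
  define P where "P x = (max (norm x) r / norm x) *\<^sub>R x" for x :: 'a
  define F where "F x = f (P x)" for x
  define k where "k x = (1 / max (norm x) r) ^ ?N" for x :: 'a
  have [measurable]: "P \<in> borel_measurable borel" unfolding P_def by measurable
  have [measurable]: "F \<in> borel_measurable borel" unfolding F_def by measurable
  have [measurable]: "k \<in> borel_measurable borel" unfolding k_def by measurable
  have P_out: "P x = x" if "norm x \<ge> r" for x
    using that r by (auto simp: P_def max_def)
  have P_in: "P x = (r / norm x) *\<^sub>R x" if "norm x \<le> r" for x
    using that by (auto simp: P_def max_def)
  have P_scale: "P (s *\<^sub>R x) = (max (s * norm x) r / norm x) *\<^sub>R x" if "s > 0" for s x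
    using that by (auto simp: P_def)
  have F_zero: "F x = 0" if "norm x \<ge> R" for x
  proof -
    have "x \<noteq> 0" using that LR(2) by auto
    then have "norm (P x) = max (norm x) r" using r by (simp add: P_def)
    then show ?thesis using that LR(3) by (simp add: F_def)
  qed
  have F_bound: "\<bar>F x\<bar> \<le> L" for x unfolding F_def by (rule LR)
  have k_bound: "0 \<le> k x" "k x \<le> (1 / r) ^ ?N" for x
    using r by (auto simp: k_def intro!: power_mono divide_left_mono)
  define A where "A n x = (F ((1 + e n) *\<^sub>R x) - F x) / e n * k x" for n x
  define B where "B n x = F x * (((1 / max (norm x) (r * (1 + e n))) ^ ?N - (1 / max (norm x) r) ^ ?N) / e n)" for n x
  have AB: "(\<integral>x. A n x \<partial>lborel) = (\<integral>x. B n x \<partial>lborel)" for n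
  proof -
    let ?s = "1 + e n"
    have s: "?s > 0" "?s \<ge> 1" using e[of n] by auto
    define H where "H y = F y * (1 / max (norm y) (r * ?s)) ^ ?N" for y
    have [measurable]: "H \<in> borel_measurable borel" unfolding H_def by measurable
    have max_s: "max (?s * norm x) (r * ?s) = ?s * max (norm x) r" for x :: 'a
      using s by (simp add: max_mult_distrib_left mult.commute)
    have Hs: "H (?s *\<^sub>R x) = F (?s *\<^sub>R x) * k x * (1 / ?s) ^ ?N" for x
      using s max_s[of x] by (simp add: H_def k_def power_mult_distrib power_divide)
    have "(\<integral>x. H x \<partial>lborel) = ?s ^ ?N * (\<integral>x. H (?s *\<^sub>R x) \<partial>lborel)"
      by (rule lborel_scale) (use s in auto)
    also have "\<dots> = (\<integral>x. F (?s *\<^sub>R x) * k x \<partial>lborel)"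
      unfolding Hs using s by (simp add: power_divide)
    finally have scaled: "(\<integral>x. F (?s *\<^sub>R x) * k x \<partial>lborel) = (\<integral>x. H x \<partial>lborel)" by simp
    have i1: "integrable lborel (\<lambda>x. F x * k x)"
    proof (rule integrable_bounded_on_cball)
      show "\<bar>F x * k x\<bar> \<le> indicator (cball 0 R) x * (L * (1 / r) ^ ?N)" for x
        using F_zero[of x] F_bound[of x] k_bound[of x] LR(1)
        by (cases "norm x \<le> R") (auto simp: abs_mult intro!: mult_mono)
    qed measurable
    have i2: "integrable lborel (\<lambda>x. F (?s *\<^sub>R x) * k x)"
    proof (rule integrable_bounded_on_cball)
      have "norm x \<le> ?s * norm x" for x :: 'a using s mult_right_mono[of 1 ?s "norm x"] by simp
      then have "F (?s *\<^sub>R x) = 0" if "norm x > R" for x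
        using that F_zero[of "?s *\<^sub>R x"] s by (simp add: less_le_trans order.strict_implies_order)
      then show "\<bar>F (?s *\<^sub>R x) * k x\<bar> \<le> indicator (cball 0 R) x * (L * (1 / r) ^ ?N)" for x
        using F_bound[of "?s *\<^sub>R x"] k_bound[of x] LR(1)
        by (cases "norm x \<le> R") (auto simp: abs_mult intro!: mult_mono)
    qed measurable
    have i3: "integrable lborel H"
    proof (rule integrable_bounded_on_cball)
      have "\<bar>(1 / max (norm x) (r * ?s)) ^ ?N\<bar> \<le> (1 / r) ^ ?N" for x :: 'a
      proof -
        have "r \<le> r * ?s" using r s by simp
        then have "r \<le> max (norm x) (r * ?s)" by linarith
        then have "0 \<le> 1 / max (norm x) (r * ?s)" "1 / max (norm x) (r * ?s) \<le> 1 / r"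
          using r by (auto intro!: divide_left_mono)
        then show ?thesis by (simp only: abs_of_nonneg zero_le_power power_mono)
      qed
      then show "\<bar>H x\<bar> \<le> indicator (cball 0 R) x * (L * (1 / r) ^ ?N)" for x
        unfolding H_def abs_mult
        using F_zero[of x] F_bound[of x] LR(1)
        by (cases "norm x \<le> R") (auto intro!: mult_mono)
    qed measurable
    have "(\<integral>x. A n x \<partial>lborel) = (\<integral>x. (F (?s *\<^sub>R x) * k x - F x * k x) / e n \<partial>lborel)"
      unfolding A_def by (intro Bochner_Integration.integral_cong) (auto simp: field_simps)
    also have "\<dots> = ((\<integral>x. F (?s *\<^sub>R x) * k x \<partial>lborel) - (\<integral>x. F x * k x \<partial>lborel)) / e n"
      using i1 i2 by simp
    also have "\<dots> = (\<integral>x. (H x - F x * k x) / e n \<partial>lborel)"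
      unfolding scaled using i1 i3 by simp
    also have "\<dots> = (\<integral>x. B n x \<partial>lborel)"
      unfolding B_def H_def k_def by (intro Bochner_Integration.integral_cong) (auto simp: field_simps)
    finally show ?thesis .
  qed
  let ?lim1 = "\<lambda>x. indicator (- ball 0 r) x * ((grad f x \<bullet> x) / norm x ^ ?N)"
  have A_lim: "(\<lambda>n. A n x) \<longlonglongrightarrow> ?lim1 x" for x
  proof (cases "norm x \<ge> r")
    case True
    have "F ((1 + e n) *\<^sub>R x) = f (x + e n *\<^sub>R x)" for n
    proof -
      have "norm ((1 + e n) *\<^sub>R x) \<ge> r"
        using True e(1)[of n] mult_right_mono[of 1 "1 + e n" "norm x"] by simp
      then show ?thesis by (simp add: F_def P_out algebra_simps)
    qed
    moreover have "F x = f x" by (simp add: F_def P_out True)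
    moreover have "k x = 1 / norm x ^ ?N" using True by (simp add: k_def max_def power_divide)
    ultimately have "A n x = (f (x + e n *\<^sub>R x) - f x) / e n * (1 / norm x ^ ?N)" for n
      by (simp add: A_def)
    moreover have "(\<lambda>n. (f (x + e n *\<^sub>R x) - f x) / e n * (1 / norm x ^ ?N)) \<longlonglongrightarrow> (grad f x \<bullet> x) * (1 / norm x ^ ?N)"
      by (intro tendsto_mult tendsto_const C1_difference_quotient_tendsto f(1) e0 e(3))
    ultimately show ?thesis using True by simp
  next
    case False
    have "(\<lambda>n. (1 + e n) * norm x) \<longlonglongrightarrow> (1 + 0) * norm x" by (intro tendsto_intros e0)
    then have "\<forall>\<^sub>F n in sequentially. (1 + e n) * norm x < r"
      using False by (intro order_tendstoD) auto
    then have "\<forall>\<^sub>F n in sequentially. A n x = 0"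
    proof eventually_elim
      case (elim n)
      have "1 + e n > 0" using e(1)[of n] by simp
      from P_scale[OF this, of x] elim have "P ((1 + e n) *\<^sub>R x) = (r / norm x) *\<^sub>R x"
        by (simp add: max_def)
      then show ?case using False P_in[of x] by (simp add: A_def F_def)
    qed
    then show ?thesis using False by (simp add: tendsto_eventually)
  qed
  have A_bound: "\<bar>A n x\<bar> \<le> indicator (cball 0 R) x * (L * R * (1 / r) ^ ?N)" for n x
  proof (cases "norm x \<le> R")
    case True
    have s: "1 + e n > 0" using e(1)[of n] by simp
    have "norm (P ((1 + e n) *\<^sub>R x) - P x) \<le> e n * norm x"
    proof (cases "x = 0")
      case False
      have "P ((1 + e n) *\<^sub>R x) - P x = ((max ((1 + e n) * norm x) r - max (norm x) r) / norm x) *\<^sub>R x"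
        unfolding P_scale[OF s] by (simp add: P_def scaleR_diff_left[symmetric] diff_divide_distrib)
      then have "norm (P ((1 + e n) *\<^sub>R x) - P x) = \<bar>max ((1 + e n) * norm x) r - max (norm x) r\<bar>"
        using False by simp
      also have "\<dots> \<le> \<bar>(1 + e n) * norm x - norm x\<bar>" by (simp add: max_def)
      also have "\<dots> = e n * norm x" using e(1)[of n] by (simp add: algebra_simps)
      finally show ?thesis .
    qed (simp add: P_def)
    then have "L * norm (P ((1 + e n) *\<^sub>R x) - P x) \<le> L * (e n * norm x)"
      using LR(1) by simp
    then have "\<bar>F ((1 + e n) *\<^sub>R x) - F x\<bar> \<le> L * (e n * norm x)"
      using LR(7)[of "P ((1 + e n) *\<^sub>R x)" "P x"] unfolding F_def by linarith
    then have "\<bar>(F ((1 + e n) *\<^sub>R x) - F x) / e n\<bar> \<le> L * norm x"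
      using e(1)[of n] by (simp add: divide_simps mult_ac)
    also have "\<dots> \<le> L * R" using True LR(1) by simp
    finally have "\<bar>A n x\<bar> \<le> (L * R) * (1 / r) ^ ?N"
      unfolding A_def abs_mult using k_bound[of x] LR(1,2) by (intro mult_mono) auto
    then show ?thesis using True by simp
  next
    case False
    then have "norm x \<le> norm ((1 + e n) *\<^sub>R x)"
      using e(1)[of n] mult_right_mono[of 1 "1 + e n" "norm x"] by simp
    then show ?thesis using False by (simp add: A_def F_zero)
  qed
  have i_dom: "integrable lborel (\<lambda>x::'a. indicator (cball 0 R) x * b)" for b :: real
    using emeasure_bounded_finite[of "cball (0::'a) R"]
    by (intro integrable_mult_left integrable_real_indicator) auto
  have A_conv: "(\<lambda>n. \<integral>x. A n x \<partial>lborel) \<longlonglongrightarrow> (\<integral>x. ?lim1 x \<partial>lborel)"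
    and A_int: "integrable lborel ?lim1"
  proof -
    have m: "A n \<in> borel_measurable lborel" "?lim1 \<in> borel_measurable lborel" for n
      unfolding A_def by measurable
    note * = m(2) m(1) i_dom[of "L * R * (1 / r) ^ ?N"]
    show "(\<lambda>n. \<integral>x. A n x \<partial>lborel) \<longlonglongrightarrow> (\<integral>x. ?lim1 x \<partial>lborel)"
      by (rule integral_dominated_convergence[OF *]) (use A_lim A_bound in auto)
    show "integrable lborel ?lim1"
      by (rule integrable_dominated_convergence[where s = A, OF *]) (use A_lim A_bound in auto)
  qed
  let ?lim2 = "\<lambda>x. - (real ?N / r ^ ?N) * (indicator (cball 0 r) x * f ((r / norm x) *\<^sub>R x))"
  have B_lim: "(\<lambda>n. B n x) \<longlonglongrightarrow> ?lim2 x" for x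
  proof (cases "norm x \<le> r")
    case True
    have B_eq: "B n x = f ((r / norm x) *\<^sub>R x) * ((1 / r) ^ ?N * (((1 / (1 + e n)) ^ ?N - 1) / e n))" for n
    proof -
      have "r \<le> r * (1 + e n)" using r e(1)[of n] by simp
      then have m: "max (norm x) (r * (1 + e n)) = r * (1 + e n)" "max (norm x) r = r" using True by auto
      have p: "(1 / (r * (1 + e n))) ^ ?N = (1 / r) ^ ?N * (1 / (1 + e n)) ^ ?N"
        by (simp add: power_mult_distrib[symmetric])
      show ?thesis
        unfolding B_def F_def P_in[OF True] m p by (simp add: right_diff_distrib)
    qed
    have "((\<lambda>h. (1 / (1 + h)) ^ ?N) has_real_derivative - real ?N) (at 0)"
      by (auto intro!: derivative_eq_intros)
    then have "(\<lambda>h. ((1 / (1 + h)) ^ ?N - 1) / h) \<midarrow>0\<rightarrow> - real ?N"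
      by (simp add: DERIV_def)
    then have "(\<lambda>n. ((1 / (1 + e n)) ^ ?N - 1) / e n) \<longlonglongrightarrow> - real ?N"
      by (rule filterlim_compose) (use e0 e(3) in \<open>auto simp: filterlim_at\<close>)
    then have "(\<lambda>n. B n x) \<longlonglongrightarrow> f ((r / norm x) *\<^sub>R x) * ((1 / r) ^ ?N * - real ?N)"
      unfolding B_eq by (intro tendsto_intros)
    then show ?thesis using True by (simp add: power_divide mult_ac)
  next
    case False
    have "(\<lambda>n. r * (1 + e n)) \<longlonglongrightarrow> r * (1 + 0)" by (intro tendsto_intros e0)
    then have "\<forall>\<^sub>F n in sequentially. r * (1 + e n) < norm x"
      using False by (intro order_tendstoD) auto
    then have "\<forall>\<^sub>F n in sequentially. B n x = 0"
      by eventually_elim (use False in \<open>simp add: B_def max_def\<close>)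
    then show ?thesis using False by (simp add: tendsto_eventually)
  qed
  have B_bound: "\<bar>B n x\<bar> \<le> indicator (cball 0 R) x * (L * (real ?N * (1 / r) ^ ?N))" for n x
  proof (cases "norm x \<le> R")
    case True
    have "max (norm x) (r * (1 + e n)) \<le> (1 + e n) * max (norm x) r"
    proof (rule max.boundedI)
      have "max (norm x) r \<le> (1 + e n) * max (norm x) r"
        using mult_right_mono[of 1 "1 + e n" "max (norm x) r"] e(1)[of n] r by auto
      then show "norm x \<le> (1 + e n) * max (norm x) r" by linarith
      have "(1 + e n) * r \<le> (1 + e n) * max (norm x) r"
        using e(1)[of n] by (intro mult_left_mono) auto
      then show "r * (1 + e n) \<le> (1 + e n) * max (norm x) r" by (simp add: mult.commute)
    qed
    moreover have "max (norm x) r \<le> max (norm x) (r * (1 + e n))"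
      using e(1)[of n] r by (intro max.mono) auto
    ultimately have "\<bar>((1 / max (norm x) (r * (1 + e n))) ^ ?N - (1 / max (norm x) r) ^ ?N) / e n\<bar>
        \<le> real ?N * (1 / max (norm x) r) ^ ?N"
      using r e(1)[of n] by (intro inverse_power_quotient_bound) auto
    also have "\<dots> \<le> real ?N * (1 / r) ^ ?N"
      using k_bound[of x] by (intro mult_left_mono) (auto simp: k_def)
    finally have "\<bar>B n x\<bar> \<le> L * (real ?N * (1 / r) ^ ?N)"
      unfolding B_def abs_mult using F_bound[of x] LR(1) by (intro mult_mono) auto
    then show ?thesis using True by simp
  next
    case False
    then show ?thesis by (simp add: B_def F_zero)
  qed
  have B_conv: "(\<lambda>n. \<integral>x. B n x \<partial>lborel) \<longlonglongrightarrow> (\<integral>x. ?lim2 x \<partial>lborel)"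
  proof -
    have m: "B n \<in> borel_measurable lborel" for n
      unfolding B_def by measurable
    have "(\<lambda>x. f ((r / norm x) *\<^sub>R x)) \<in> borel_measurable borel" by measurable
    then have m2: "?lim2 \<in> borel_measurable lborel"
      by (intro borel_measurable_times borel_measurable_const borel_measurable_indicator) auto
    show ?thesis
      by (rule integral_dominated_convergence[OF m2 m i_dom[of "L * (real ?N * (1 / r) ^ ?N)"]])
        (use B_lim B_bound in auto)
  qed
  show "integrable lborel ?lim1" by (rule A_int)
  have "(\<integral>x. ?lim1 x \<partial>lborel) = (\<integral>x. ?lim2 x \<partial>lborel)"
    using LIMSEQ_unique[OF A_conv[unfolded AB] B_conv] .
  then show "(\<integral>x. ?lim1 x \<partial>lborel)
      = - (real ?N / r ^ ?N) * (\<integral>x. indicator (cball 0 r) x * f ((r / norm x) *\<^sub>R x) \<partial>lborel)"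
    by (simp only: integral_mult_right_zero)
qed

lemma sets_sphere_measure [simp, measurable_cong]: "sets (sphere_measure r) = sets borel"
  by (simp add: sphere_measure_def)

lemma nn_integral_sphere_measure:
  fixes f :: "'a::euclidean_space \<Rightarrow> ennreal"
  assumes [measurable]: "f \<in> borel_measurable borel"
  shows "(\<integral>\<^sup>+x. f x \<partial>sphere_measure r) = ennreal (real DIM('a) / r) *
    (\<integral>\<^sup>+x. f ((r / norm x) *\<^sub>R x) * indicator (cball 0 r - {0}) x \<partial>lborel)"
proof -
  have [measurable]: "(\<lambda>x. (r / norm x) *\<^sub>R x) \<in> restrict_space lborel (cball 0 r - {0::'a}) \<rightarrow>\<^sub>M borel"
    by (rule measurable_restrict_space1) measurable
  show ?thesis
    unfolding sphere_measure_def
    by (subst nn_integral_scale_measure, simp, subst nn_integral_distr, measurable)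
       (subst nn_integral_restrict_space, auto)
qed

lemma AE_sphere_measure:
  assumes "r > 0"
  shows "AE x in sphere_measure r. norm (x::'a::euclidean_space) = r"
proof -
  have "(\<integral>\<^sup>+x. indicator {x::'a. norm x \<noteq> r} x \<partial>sphere_measure r) = 0"
  proof -
    have 0: "indicator {x::'a. norm x \<noteq> r} ((r / norm x) *\<^sub>R x) * indicator (cball 0 r - {0}) x = (0::ennreal)" for x
      using assms by (auto simp: indicator_def)
    show ?thesis by (subst nn_integral_sphere_measure) (simp_all only: 0 nn_integral_const, auto)
  qed
  then have "emeasure (sphere_measure r) {x::'a. norm x \<noteq> r} = 0" by simp
  then show ?thesis
    by (intro AE_I[where N = "{x. norm x \<noteq> r}"]) auto
qed

lemma sphere_flux:
  fixes f :: "'a::euclidean_space \<Rightarrow> real"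
  assumes f: "Ck 1 f" "bounded {x. f x \<noteq> 0}" "\<And>x. f x \<ge> 0" and r: "r > 0"
  shows "(\<integral>\<^sup>+x. f x \<partial>sphere_measure r) =
     ennreal (- (r ^ DIM('a) / r) * (\<integral>x. indicator (- ball 0 r) x * ((grad f x \<bullet> x) / norm x ^ DIM('a)) \<partial>lborel))"
proof -
  obtain L where L: "\<And>x. \<bar>f x\<bar> \<le> L"
    by (rule C1_compact_bounds[OF f(1,2)], rule that)
  have [measurable]: "f \<in> borel_measurable borel"
    using Ck_1D[OF f(1)] by (auto intro: borel_measurable_continuous_onI)
  let ?g = "\<lambda>x. indicator (cball 0 r) x * f ((r / norm x) *\<^sub>R x)"
  have i: "integrable lborel ?g"
    by (rule integrable_bounded_on_cball[where R = r and B = L]) (use L in \<open>auto simp: indicator_def\<close>)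
  have "AE x in lborel. x \<noteq> (0::'a)" by (rule AE_lborel_singleton)
  then have "(\<integral>\<^sup>+x. ennreal (f ((r / norm x) *\<^sub>R x)) * indicator (cball 0 r - {0}) x \<partial>lborel) = (\<integral>\<^sup>+x. ennreal (?g x) \<partial>lborel)"
    by (intro nn_integral_cong_AE) (auto elim!: eventually_mono simp: indicator_def)
  also have "\<dots> = ennreal (\<integral>x. ?g x \<partial>lborel)"
    using i f(3) by (intro nn_integral_eq_integral) auto
  finally have "(\<integral>\<^sup>+x. f x \<partial>sphere_measure r) = ennreal (real DIM('a) / r * (\<integral>x. ?g x \<partial>lborel))"
    using r f(3) by (subst nn_integral_sphere_measure)
      (auto simp: ennreal_mult[symmetric] intro!: Bochner_Integration.integral_nonneg)
  then show ?thesis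
    unfolding radial_flux(2)[OF f(1,2) r] using r by simp
qed

lemma AE_lborel_norm_neq: "AE x in lborel. norm (x::'a::euclidean_space) \<noteq> r"
proof -
  have "AE x in lebesgue. x \<notin> sphere (0::'a) r"
    using negligible_sphere[of "0::'a" r] by (intro AE_not_in) (simp add: negligible_iff_null_sets)
  then show ?thesis by (simp add: AE_completion_iff)
qed

text \<open>The flux identity for the square of the function times a cutoff that vanishes outside a
  larger ball bounds the mean square on the sphere by the energy in the shell.\<close>

lemma trace_inequality:
  assumes r: "0 < r" "r < R"
  obtains C where "C > 0" "\<And>w::'a::euclidean_space \<Rightarrow> real. Ck 1 w \<Longrightarrow>
    (\<integral>\<^sup>+x. ennreal ((w x)\<^sup>2) \<partial>sphere_measure r) \<le>
    ennreal C * (\<integral>\<^sup>+x. ennreal ((w x)\<^sup>2 + (norm (grad w x))\<^sup>2) * indicator (ball 0 R - cball 0 r) x \<partial>lborel)"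
proof -
  let ?N = "DIM('a)"
  \<comment> \<open>The cutoff is the constant \<open>c\<close> on the sphere of radius \<open>r\<close> and vanishes outside the ball of radius \<open>R\<close>.\<close>
  define \<eta> where "\<eta> x = (max (R\<^sup>2 - x \<bullet> x) 0)\<^sup>2" for x :: 'a
  have D\<eta>: "(\<eta> has_derivative (\<lambda>h. (- 4 * max (R\<^sup>2 - x \<bullet> x) 0) *\<^sub>R x \<bullet> h)) (at x)" for x
  proof -
    have "((\<lambda>x. R\<^sup>2 - x \<bullet> x) has_derivative (\<lambda>h. - 2 * (x \<bullet> h))) (at x)"
      by (auto intro!: derivative_eq_intros simp: inner_commute)
    from has_derivative_compose[OF this DERIV_pos_part_squared[THEN has_field_derivative_imp_has_derivative]]
    show ?thesis unfolding \<eta>_def by (rule has_derivative_eq_rhs) (auto simp: fun_eq_iff)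
  qed
  have "continuous_on UNIV (\<lambda>x::'a. (- 4 * max (R\<^sup>2 - x \<bullet> x) 0) *\<^sub>R x)"
    by (intro continuous_intros)
  note \<eta>C = Ck_1I[OF D\<eta> this]
  have sq: "x \<bullet> x < R\<^sup>2 \<longleftrightarrow> norm x < R" for x :: 'a
    using r power_less_imp_less_base[of "norm x" 2 R] power_strict_mono[of "norm x" R 2]
    by (auto simp: power2_norm_eq_inner)
  have out: "\<eta> x = 0" "grad \<eta> x = 0" if "norm x \<ge> R" for x
    using that sq[of x] by (auto simp: \<eta>_def \<eta>C(2) max_def)
  have \<eta>b: "bounded {x. \<eta> x \<noteq> 0}"
  proof (rule bounded_subset[OF bounded_cball[of 0 R]])
    have "norm x \<le> R" if "\<eta> x \<noteq> 0" for x
      using out(1)[of x] that by (cases "norm x \<le> R") auto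
    then show "{x. \<eta> x \<noteq> 0} \<subseteq> cball 0 R" by auto
  qed
  obtain L where L: "L > 0" "\<And>x. \<bar>\<eta> x\<bar> \<le> L" "\<And>x. norm (grad \<eta> x) \<le> L"
    by (rule C1_compact_bounds[OF \<eta>C(1) \<eta>b], rule that)
  define c where "c = (R\<^sup>2 - r\<^sup>2)\<^sup>2"
  have "r\<^sup>2 < R\<^sup>2" using r by (simp add: power_strict_mono)
  then have c: "c > 0" by (simp add: c_def)
  define C where "C = inverse c * (r ^ ?N / r) * (2 * L * R / r ^ ?N)"
  have "C > 0" using c r L(1) by (simp add: C_def)
  moreover have "(\<integral>\<^sup>+x. ennreal ((w x)\<^sup>2) \<partial>sphere_measure r) \<le>
    ennreal C * (\<integral>\<^sup>+x. ennreal ((w x)\<^sup>2 + (norm (grad w x))\<^sup>2) * indicator (ball 0 R - cball 0 r) x \<partial>lborel)"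
    if w: "Ck 1 w" for w :: "'a \<Rightarrow> real"
  proof -
    have [measurable]: "w \<in> borel_measurable borel" "grad w \<in> borel_measurable borel"
      using Ck_1D[OF w] by (auto intro: borel_measurable_continuous_onI)
    define f where "f x = \<eta> x * (w x * w x)" for x
    have f: "Ck 1 f" "\<And>x. grad f x = \<eta> x *\<^sub>R (2 * w x) *\<^sub>R grad w x + (w x)\<^sup>2 *\<^sub>R grad \<eta> x"
      unfolding f_def
      using grad_mult[OF \<eta>C(1) Ck_mult[OF w w]] grad_mult[OF w w] Ck_mult[OF \<eta>C(1) Ck_mult[OF w w]]
      by (simp_all add: power2_eq_square scaleR_left_distrib[symmetric])
    have fb: "bounded {x. f x \<noteq> 0}" by (rule bounded_subset[OF \<eta>b]) (auto simp: f_def)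
    have f0: "f x \<ge> 0" for x by (simp add: f_def \<eta>_def)
    let ?q = "\<lambda>x. indicator (- ball 0 r) x * ((grad f x \<bullet> x) / norm x ^ ?N)"
    let ?E = "\<lambda>x. ennreal ((w x)\<^sup>2 + (norm (grad w x))\<^sup>2) * indicator (ball 0 R - cball 0 r) x"
    have "ennreal c * (\<integral>\<^sup>+x. ennreal ((w x)\<^sup>2) \<partial>sphere_measure r) = (\<integral>\<^sup>+x. ennreal c * ennreal ((w x)\<^sup>2) \<partial>sphere_measure r)"
      by (rule nn_integral_cmult[symmetric]) measurable
    also have "\<dots> = (\<integral>\<^sup>+x. ennreal (f x) \<partial>sphere_measure r)"
    proof (rule nn_integral_cong_AE)
      show "AE x in sphere_measure r. ennreal c * ennreal ((w x)\<^sup>2) = ennreal (f x)"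
        using AE_sphere_measure[OF r(1)]
      proof eventually_elim
        case (elim x)
        then have "\<eta> x = c" using \<open>r\<^sup>2 < R\<^sup>2\<close> by (simp add: \<eta>_def c_def dot_square_norm)
        then show ?case using c by (simp add: f_def ennreal_mult[symmetric] power2_eq_square)
      qed
    qed
    also have "\<dots> = ennreal (- (r ^ ?N / r) * (\<integral>x. ?q x \<partial>lborel))"
      by (rule sphere_flux[OF f(1) fb f0 r(1)])
    also have "\<dots> \<le> ennreal ((r ^ ?N / r) * (\<integral>x. norm (?q x) \<partial>lborel))"
    proof (rule ennreal_leI)
      have "- (\<integral>x. ?q x \<partial>lborel) \<le> (\<integral>x. norm (?q x) \<partial>lborel)"
        using integral_norm_bound[of lborel ?q] by simp
      then show "- (r ^ ?N / r) * (\<integral>x. ?q x \<partial>lborel) \<le> (r ^ ?N / r) * (\<integral>x. norm (?q x) \<partial>lborel)"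
        using mult_left_mono[of "- (\<integral>x. ?q x \<partial>lborel)" "\<integral>x. norm (?q x) \<partial>lborel" "r ^ ?N / r"] r(1) by simp
    qed
    also have "\<dots> = ennreal (r ^ ?N / r) * ennreal (\<integral>x. norm (?q x) \<partial>lborel)"
      using r(1) by (intro ennreal_mult Bochner_Integration.integral_nonneg) auto
    also have "ennreal (\<integral>x. norm (?q x) \<partial>lborel) = (\<integral>\<^sup>+x. ennreal (norm (?q x)) \<partial>lborel)"
      by (rule nn_integral_eq_integral[OF integrable_norm[OF radial_flux(1)[OF f(1) fb r(1)]], symmetric]) simp
    also have "(\<integral>\<^sup>+x. ennreal (norm (?q x)) \<partial>lborel) \<le> (\<integral>\<^sup>+x. ennreal (2 * L * R / r ^ ?N) * ?E x \<partial>lborel)"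
    proof (rule nn_integral_mono_AE)
      show "AE x in lborel. ennreal (norm (?q x)) \<le> ennreal (2 * L * R / r ^ ?N) * ?E x"
        using AE_lborel_norm_neq[of r]
      proof eventually_elim
        case (elim x)
        show ?case
        proof (cases "x \<in> ball 0 R - cball 0 r")
          case True
          let ?a = "\<bar>w x\<bar>" and ?g = "norm (grad w x)"
          have nx: "r < norm x" "norm x < R" using True by auto
          have "norm (grad f x) \<le> norm (\<eta> x *\<^sub>R (2 * w x) *\<^sub>R grad w x) + norm ((w x)\<^sup>2 *\<^sub>R grad \<eta> x)"
            unfolding f(2) by (rule norm_triangle_ineq)
          also have "\<dots> = \<bar>\<eta> x\<bar> * (2 * (?a * ?g)) + ?a\<^sup>2 * norm (grad \<eta> x)"
            by (simp add: abs_mult)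
          also have "\<dots> \<le> L * (2 * (?a * ?g)) + ?a\<^sup>2 * L"
            using L by (intro add_mono mult_mono) auto
          also have "\<dots> \<le> 2 * L * ((w x)\<^sup>2 + ?g\<^sup>2)"
          proof -
            have "0 \<le> (?a - ?g)\<^sup>2 + ?g\<^sup>2" by simp
            then have "2 * (?a * ?g) + ?a\<^sup>2 \<le> 2 * (?a\<^sup>2 + ?g\<^sup>2)"
              unfolding power2_eq_square by (simp add: algebra_simps)
            from mult_left_mono[OF this, of L] show ?thesis
              using L(1) by (simp add: algebra_simps)
          qed
          finally have gf: "norm (grad f x) \<le> 2 * L * ((w x)\<^sup>2 + ?g\<^sup>2)" .
          have "\<bar>grad f x \<bullet> x\<bar> \<le> norm (grad f x) * norm x" by (rule Cauchy_Schwarz_ineq2)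
          also have "\<dots> \<le> (2 * L * ((w x)\<^sup>2 + ?g\<^sup>2)) * R"
            using gf nx L(1) by (intro mult_mono) auto
          finally have "\<bar>grad f x \<bullet> x\<bar> / norm x ^ ?N \<le> ((2 * L * ((w x)\<^sup>2 + ?g\<^sup>2)) * R) / r ^ ?N"
            using nx r L(1) by (intro frac_le) (auto intro!: power_mono)
          then have "norm (?q x) \<le> (2 * L * R / r ^ ?N) * ((w x)\<^sup>2 + ?g\<^sup>2)"
            using True r(1) by (simp add: mult_ac abs_mult)
          then have "ennreal (norm (?q x)) \<le> ennreal ((2 * L * R / r ^ ?N) * ((w x)\<^sup>2 + ?g\<^sup>2))"
            by (rule ennreal_leI)
          also have "\<dots> = ennreal (2 * L * R / r ^ ?N) * ennreal ((w x)\<^sup>2 + ?g\<^sup>2)"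
            using r L(1) by (intro ennreal_mult) auto
          finally show ?thesis using True by (simp only: indicator_simps mult_1_right)
        next
          case False
          then have "?q x = 0" using elim out[of x] by (auto simp: f(2) indicator_def)
          then have "ennreal (norm (?q x)) = 0" by (simp only: norm_zero ennreal_0)
          then show ?thesis by (simp only: zero_le)
        qed
      qed
    qed
    also have "(\<integral>\<^sup>+x. ennreal (2 * L * R / r ^ ?N) * ?E x \<partial>lborel) = ennreal (2 * L * R / r ^ ?N) * (\<integral>\<^sup>+x. ?E x \<partial>lborel)"
    proof (rule nn_integral_cmult)
      have "(\<lambda>x. ennreal ((w x)\<^sup>2 + (norm (grad w x))\<^sup>2)) \<in> borel_measurable lborel" by measurable
      then show "?E \<in> borel_measurable lborel"
        by (intro borel_measurable_times_ennreal borel_measurable_indicator) auto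
    qed
    finally have *: "ennreal c * (\<integral>\<^sup>+x. ennreal ((w x)\<^sup>2) \<partial>sphere_measure r)
       \<le> ennreal (r ^ ?N / r) * (ennreal (2 * L * R / r ^ ?N) * (\<integral>\<^sup>+x. ?E x \<partial>lborel))"
      by (simp add: mult_left_mono)
    have "(\<integral>\<^sup>+x. ennreal ((w x)\<^sup>2) \<partial>sphere_measure r)
        = ennreal (inverse c) * (ennreal c * (\<integral>\<^sup>+x. ennreal ((w x)\<^sup>2) \<partial>sphere_measure r))"
      using c by (simp add: mult.assoc[symmetric] ennreal_mult[symmetric])
    also have "\<dots> \<le> ennreal (inverse c) * (ennreal (r ^ ?N / r) * (ennreal (2 * L * R / r ^ ?N) * (\<integral>\<^sup>+x. ?E x \<partial>lborel)))"
      by (intro mult_left_mono *) simp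
    also have "\<dots> = ennreal C * (\<integral>\<^sup>+x. ?E x \<partial>lborel)"
    proof -
      have nn: "0 \<le> r ^ ?N / r" "0 \<le> 2 * L * R / r ^ ?N" using r L(1) by auto
      show ?thesis
        unfolding C_def ennreal_mult''[OF nn(2)] ennreal_mult''[OF nn(1)] by (simp only: mult.assoc)
    qed
    finally show ?thesis .
  qed
  ultimately show thesis by (rule that)
qed

section \<open>The weight and the completion\<close>

text \<open>Halving the ball multiplies the integral by \<open>2\<^sup>b\<^sup>-\<^sup>N < 1\<close>, while the remaining shell contributes a
  bounded amount. For the truncated function the integral is finite, so the inequality bounds it
  independently of the truncation, and Fatou's lemma removes the truncation.\<close>

lemma integrable_norm_powr_cball:
  fixes R :: real
  assumes b: "0 \<le> b" "b < real DIM('a::euclidean_space)" and R: "R > 0"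
  shows "integrable lborel (\<lambda>x::'a. indicator (ball 0 R) x * norm x powr (- b))"
proof -
  let ?N = "DIM('a)"
  let ?w = "\<lambda>x::'a. norm x powr (- b)"
  define J where "J M = (\<integral>\<^sup>+x. ennreal (indicator (ball 0 R) x * min (?w x) (real M)) \<partial>lborel)" for M
  define V where "V = measure lborel (ball (0::'a) R)"
  have V: "emeasure lborel (ball (0::'a) R) = ennreal V"
    unfolding V_def using emeasure_bounded_finite[of "ball (0::'a) R"]
    by (intro emeasure_eq_ennreal_measure) auto
  define q where "q = 2 powr b * (1 / 2) ^ ?N"
  have q: "0 < q" "q < 1"
  proof -
    have "2 powr b < (2::real) powr real ?N" using b by (intro powr_less_mono) auto
    then show "0 < q" "q < 1"
      by (auto simp: q_def powr_realpow power_divide divide_simps)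
  qed
  define K where "K = (R / 2) powr (- b) * V"
  have K: "K \<ge> 0" by (simp add: K_def V_def)
  have mw: "?w \<in> borel_measurable borel" by measurable
  have mJ: "(\<lambda>x. ennreal (indicator (ball 0 c) x * min (?w x) (real M))) \<in> borel_measurable borel" for c M
    by (intro measurable_compose[OF _ measurable_ennreal] borel_measurable_times
        borel_measurable_indicator borel_measurable_min mw) auto
  have J_fin: "J M < \<infinity>" for M
  proof -
    have "J M \<le> (\<integral>\<^sup>+x. ennreal (real M) * indicator (ball (0::'a) R) x \<partial>lborel)"
      unfolding J_def by (intro nn_integral_mono) (auto simp: indicator_def intro!: ennreal_leI)
    also have "\<dots> < \<infinity>" by (subst nn_integral_cmult_indicator) (auto simp: V ennreal_mult_less_top)
    finally show ?thesis .
  qed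
  have J_le: "J M \<le> ennreal K + ennreal q * J M" for M
  proof -
    let ?h = "\<lambda>x::'a. ennreal (indicator (ball 0 (R / 2)) x * min (?w x) (real M))"
    have ptw: "ennreal (indicator (ball 0 R) x * min (?w x) (real M))
        \<le> ennreal ((R / 2) powr (- b)) * indicator (ball 0 R) x + ?h x" for x
    proof (cases "norm x < R / 2")
      case True
      then show ?thesis by (simp add: indicator_def)
    next
      case False
      have "?w x \<le> (R / 2) powr (- b)" using False R b by (intro powr_mono2') auto
      then show ?thesis using False by (auto simp: indicator_def intro!: ennreal_leI)
    qed
    have "J M \<le> (\<integral>\<^sup>+x. ennreal ((R / 2) powr (- b)) * indicator (ball (0::'a) R) x + ?h x \<partial>lborel)"
      unfolding J_def by (intro nn_integral_mono ptw)
    also have "\<dots> = ennreal K + (\<integral>\<^sup>+x. ?h x \<partial>lborel)"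
    proof -
      have "(\<integral>\<^sup>+x. ennreal ((R / 2) powr (- b)) * indicator (ball (0::'a) R) x \<partial>lborel) = ennreal K"
        by (subst nn_integral_cmult_indicator) (auto simp: V K_def ennreal_mult V_def)
      moreover have "(\<lambda>x. ennreal ((R / 2) powr (- b)) * indicator (ball (0::'a) R) x) \<in> borel_measurable lborel"
        by (intro borel_measurable_times_ennreal borel_measurable_const borel_measurable_indicator) simp
      moreover have "?h \<in> borel_measurable lborel" using mJ by simp
      ultimately show ?thesis by (simp only: nn_integral_add)
    qed
    also have "(\<integral>\<^sup>+x. ?h x \<partial>lborel) = ennreal ((1 / 2) ^ ?N) * (\<integral>\<^sup>+x. ?h ((1 / 2) *\<^sub>R x) \<partial>lborel)"
      by (rule nn_integral_lborel_scale[OF mJ]) simp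
    also have "(\<integral>\<^sup>+x. ?h ((1 / 2) *\<^sub>R x) \<partial>lborel)
        \<le> (\<integral>\<^sup>+x. ennreal (2 powr b) * ennreal (indicator (ball 0 R) x * min (?w x) (real M)) \<partial>lborel)"
    proof (rule nn_integral_mono)
      fix x :: 'a
      have w: "?w ((1 / 2) *\<^sub>R x) = 2 powr b * ?w x"
        by (simp add: powr_divide powr_minus_divide)
      have "1 \<le> (2::real) powr b" using b by (intro ge_one_powr_ge_zero) auto
      then have "real M \<le> 2 powr b * real M" using mult_right_mono[of 1 "2 powr b" "real M"] by simp
      then have "min (?w ((1 / 2) *\<^sub>R x)) (real M) \<le> 2 powr b * min (?w x) (real M)"
        unfolding w by (cases "?w x \<le> real M") (simp_all only: min_absorb1 min_absorb2 min.coboundedI1 min.coboundedI2 order_refl nle_le)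
      moreover have "norm ((1 / 2) *\<^sub>R x) < R / 2 \<longleftrightarrow> norm x < R" by simp
      ultimately have "indicator (ball 0 (R / 2)) ((1 / 2) *\<^sub>R x) * min (?w ((1 / 2) *\<^sub>R x)) (real M)
          \<le> 2 powr b * (indicator (ball 0 R) x * min (?w x) (real M))"
        by (auto simp: indicator_def)
      then show "?h ((1 / 2) *\<^sub>R x) \<le> ennreal (2 powr b) * ennreal (indicator (ball 0 R) x * min (?w x) (real M))"
        by (simp add: ennreal_mult'[symmetric] ennreal_leI)
    qed
    also have "\<dots> = ennreal (2 powr b) * J M"
      unfolding J_def by (rule nn_integral_cmult) (use mJ in simp)
    finally have "J M \<le> ennreal K + ennreal ((1 / 2) ^ ?N) * (ennreal (2 powr b) * J M)"
      by (simp add: mult_left_mono add_left_mono)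
    also have "ennreal ((1 / 2) ^ ?N) * (ennreal (2 powr b) * J M) = ennreal q * J M"
      unfolding q_def mult.assoc[symmetric]
      by (subst ennreal_mult[symmetric]) (auto simp: mult.commute)
    finally show ?thesis .
  qed
  have J_bound: "J M \<le> ennreal (K / (1 - q))" for M
  proof -
    obtain j where j: "J M = ennreal j" "j \<ge> 0"
      using J_fin[of M] by (cases "J M") auto
    have "ennreal j \<le> ennreal (K + q * j)"
      using J_le[of M] j K q by (simp add: ennreal_mult ennreal_plus)
    then have "j \<le> K + q * j" using K q j by (subst (asm) ennreal_le_iff) auto
    then have "j \<le> K / (1 - q)" using q by (simp add: field_simps)
    then show ?thesis using j by (simp add: ennreal_leI)
  qed
  have "(\<integral>\<^sup>+x. ennreal (indicator (ball 0 R) x * ?w x) \<partial>lborel)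
     = (\<integral>\<^sup>+x. liminf (\<lambda>M. ennreal (indicator (ball 0 R) x * min (?w x) (real M))) \<partial>lborel)"
  proof (rule nn_integral_cong)
    fix x :: 'a
    obtain M0 :: nat where "?w x \<le> real M0" using real_arch_simple by blast
    then have "\<forall>\<^sub>F M in sequentially. ennreal (indicator (ball 0 R) x * min (?w x) (real M)) = ennreal (indicator (ball 0 R) x * ?w x)"
      by (intro eventually_sequentiallyI[of M0]) (auto simp: min_def)
    then have "(\<lambda>M. ennreal (indicator (ball 0 R) x * min (?w x) (real M))) \<longlonglongrightarrow> ennreal (indicator (ball 0 R) x * ?w x)"
      by (rule tendsto_eventually)
    from lim_imp_Liminf[OF _ this]
    show "ennreal (indicator (ball 0 R) x * ?w x) = liminf (\<lambda>M. ennreal (indicator (ball 0 R) x * min (?w x) (real M)))"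
      by simp
  qed
  also have "\<dots> \<le> liminf J"
    unfolding J_def by (rule nn_integral_liminf) (use mJ in simp)
  also have "\<dots> \<le> limsup J" by (rule Liminf_le_Limsup) simp
  also have "\<dots> \<le> ennreal (K / (1 - q))" by (rule Limsup_bounded) (use J_bound in auto)
  finally have "(\<integral>\<^sup>+x. ennreal (indicator (ball (0::'a) R) x * ?w x) \<partial>lborel) < \<infinity>"
    by (rule order.strict_trans1) simp
  moreover have "(\<lambda>x. indicator (ball 0 R) x * ?w x) \<in> borel_measurable lborel"
    using mw by (intro borel_measurable_times borel_measurable_indicator) auto
  ultimately show ?thesis by (intro integrableI_nonneg) auto
qed

abbreviation hardy_weight :: "'a::euclidean_space \<Rightarrow> real" where
  "hardy_weight x \<equiv> norm x powr (- (real DIM('a) - 2))"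

lemma open_lebesgue_sets: "open U \<Longrightarrow> U \<in> sets lebesgue"
  by simp

lemma nn_integral_restrict_lebesgue:
  "S \<in> sets lebesgue \<Longrightarrow> (\<integral>\<^sup>+x. f x \<partial>lebesgue_on S) = (\<integral>\<^sup>+x. f x * indicator S x \<partial>lebesgue)"
  by (rule nn_integral_restrict_space) simp

lemma nn_integral_weighted_measure:
  fixes \<Omega> :: "'a::euclidean_space set"
  assumes "open \<Omega>" "f \<in> borel_measurable (lebesgue_on \<Omega>)"
  shows "(\<integral>\<^sup>+x. f x \<partial>weighted_measure \<Omega>)
    = (\<integral>\<^sup>+x. ennreal (hardy_weight x) * f x * indicator \<Omega> x \<partial>lebesgue)"
proof -
  have "(\<lambda>x::'a. hardy_weight x) \<in> borel_measurable lebesgue" by (simp add: measurable_completion)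
  then have "(\<lambda>x. ennreal (hardy_weight x)) \<in> borel_measurable (lebesgue_on \<Omega>)"
    by (intro measurable_restrict_space1 measurable_compose[OF _ measurable_ennreal])
  then show ?thesis
    unfolding weighted_measure_def
    using assms by (subst nn_integral_density) (auto simp: nn_integral_restrict_lebesgue open_lebesgue_sets)
qed

lemma measurable_weighted_measure:
  "f \<in> borel_measurable (weighted_measure \<Omega>) \<longleftrightarrow> f \<in> borel_measurable (lebesgue_on \<Omega>)"
  by (simp add: weighted_measure_def)

lemma L2_tendsto_transfer:
  assumes f: "L2_tendsto M f g"
    and m: "\<And>k. f k \<in> borel_measurable M'" "g \<in> borel_measurable M'"
    and le: "\<And>k. nn_sq_norm M' (\<lambda>x. f k x - g x) \<le> ennreal C * nn_sq_norm M (\<lambda>x. f k x - g x)"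
  shows "L2_tendsto M' f g"
  unfolding L2_tendsto_def
proof (intro conjI allI m)
  have "(\<lambda>k. ennreal C * nn_sq_norm M (\<lambda>x. f k x - g x)) \<longlonglongrightarrow> ennreal C * 0"
    using f by (intro ennreal_tendsto_cmult) (auto simp: L2_tendsto_def)
  then have lim: "(\<lambda>k. ennreal C * nn_sq_norm M (\<lambda>x. f k x - g x)) \<longlonglongrightarrow> 0" by simp
  show "(\<lambda>k. nn_sq_norm M' (\<lambda>x. f k x - g x)) \<longlonglongrightarrow> 0"
    using le by (intro tendsto_sandwich[OF _ _ tendsto_const lim]) auto
qed

lemma L2_tendsto_restrict_subset:
  fixes f :: "nat \<Rightarrow> 'a::euclidean_space \<Rightarrow> 'b::euclidean_space"
  assumes f: "L2_tendsto (lebesgue_on S) f g"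
    and T: "T \<subseteq> S" "S \<in> sets lebesgue" "T \<in> sets lebesgue"
  shows "L2_tendsto (lebesgue_on T) f g"
proof (rule L2_tendsto_transfer[OF f, where C = 1])
  show "f k \<in> borel_measurable (lebesgue_on T)" "g \<in> borel_measurable (lebesgue_on T)" for k
    using f T(1) by (auto simp: L2_tendsto_def intro: measurable_restrict_mono)
  show "nn_sq_norm (lebesgue_on T) (\<lambda>x. f k x - g x)
      \<le> ennreal 1 * nn_sq_norm (lebesgue_on S) (\<lambda>x. f k x - g x)" for k
    using T by (auto simp: nn_integral_restrict_lebesgue indicator_def intro!: nn_integral_mono)
qed

text \<open>On a bounded set the weight is bounded below by a positive constant away from the origin.\<close>

lemma L2_tendsto_unweighted:
  fixes f :: "nat \<Rightarrow> 'a::euclidean_space \<Rightarrow> 'b::euclidean_space"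
  assumes f: "L2_tendsto (weighted_measure \<Omega>) f g"
    and \<Omega>: "open \<Omega>" "bounded \<Omega>" and dim: "DIM('a) \<ge> 2"
  shows "L2_tendsto (lebesgue_on \<Omega>) f g"
proof -
  obtain D where D: "D > 0" "\<And>x. x \<in> \<Omega> \<Longrightarrow> norm x \<le> D"
    using \<Omega>(2) by (auto simp: bounded_pos)
  let ?C = "D powr (real DIM('a) - 2)"
  have m: "f k \<in> borel_measurable (lebesgue_on \<Omega>)" "g \<in> borel_measurable (lebesgue_on \<Omega>)" for k
    using f by (auto simp: L2_tendsto_def measurable_weighted_measure)
  have m': "(\<lambda>x. ennreal ((norm (f k x - g x))\<^sup>2)) \<in> borel_measurable (lebesgue_on \<Omega>)" for k
    using m by measurable
  have w: "1 \<le> ?C * hardy_weight x" if "x \<in> \<Omega>" "x \<noteq> 0" for x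
  proof -
    have "norm x powr (real DIM('a) - 2) \<le> ?C"
      using that D dim by (intro powr_mono2) auto
    moreover have "hardy_weight x = inverse (norm x powr (real DIM('a) - 2))" by (rule powr_minus)
    moreover have "norm x powr (real DIM('a) - 2) > 0" using that by simp
    ultimately show ?thesis by (simp only: divide_inverse[symmetric] le_divide_eq_1_pos)
  qed
  show ?thesis
  proof (rule L2_tendsto_transfer[OF f m, where C = ?C])
    fix k
    let ?F = "\<lambda>x. ennreal ((norm (f k x - g x))\<^sup>2)"
    have mF: "(\<lambda>x. ?F x * indicator \<Omega> x) \<in> borel_measurable lebesgue"
      using m'[of k] \<Omega>(1) by (subst (asm) borel_measurable_restrict_space_iff_ennreal) auto
    have mw: "(\<lambda>x::'a. ennreal (hardy_weight x)) \<in> borel_measurable lebesgue"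
      by (simp add: measurable_completion)
    have "(\<integral>\<^sup>+x. ?F x \<partial>lebesgue_on \<Omega>) = (\<integral>\<^sup>+x. ?F x * indicator \<Omega> x \<partial>lebesgue)"
      using \<Omega>(1) by (simp add: nn_integral_restrict_lebesgue)
    also have "\<dots> \<le> (\<integral>\<^sup>+x. ennreal ?C * (ennreal (hardy_weight x) * (?F x * indicator \<Omega> x)) \<partial>lebesgue)"
    proof (rule nn_integral_mono_AE)
      have "AE x in lebesgue. x \<noteq> (0::'a)"
        by (intro AE_completion AE_lborel_singleton)
      then show "AE x in lebesgue. ?F x * indicator \<Omega> x \<le> ennreal ?C * (ennreal (hardy_weight x) * (?F x * indicator \<Omega> x))"
      proof eventually_elim
        case (elim x)
        show ?case
        proof (cases "x \<in> \<Omega>")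
          case True
          have "1 * ?F x \<le> (ennreal ?C * ennreal (hardy_weight x)) * ?F x"
            using w[OF True elim] by (intro mult_right_mono) (auto simp: ennreal_mult[symmetric] simp flip: ennreal_1)
          then show ?thesis using True by (simp add: mult.assoc)
        qed simp
      qed
    qed
    also have "\<dots> = ennreal ?C * (\<integral>\<^sup>+x. ennreal (hardy_weight x) * (?F x * indicator \<Omega> x) \<partial>lebesgue)"
      by (intro nn_integral_cmult borel_measurable_times_ennreal mw mF)
    also have "(\<integral>\<^sup>+x. ennreal (hardy_weight x) * (?F x * indicator \<Omega> x) \<partial>lebesgue) = (\<integral>\<^sup>+x. ?F x \<partial>weighted_measure \<Omega>)"
      by (simp add: nn_integral_weighted_measure[OF \<Omega>(1) m'] mult.assoc)
    finally show "(\<integral>\<^sup>+x. ?F x \<partial>lebesgue_on \<Omega>) \<le> ennreal ?C * (\<integral>\<^sup>+x. ?F x \<partial>weighted_measure \<Omega>)" .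
  qed
qed

lemma set_integrable_L2_limit:
  fixes f :: "nat \<Rightarrow> 'a::euclidean_space \<Rightarrow> 'b::euclidean_space"
  assumes f: "L2_tendsto (lebesgue_on K) f g" and K: "compact K"
    and i: "\<And>k. set_integrable lebesgue K (f k)"
  shows "set_integrable lebesgue K g"
    "(\<lambda>k. \<integral>\<^sup>+x. ennreal (norm (f k x - g x)) * indicator K x \<partial>lebesgue) \<longlonglongrightarrow> 0"
proof -
  have Ks: "K \<in> sets lebesgue" using K by (simp add: compact_imp_closed)
  have "emeasure lebesgue K = emeasure lborel K"
    using K by (simp add: compact_imp_closed)
  also have "\<dots> < \<infinity>" by (rule emeasure_bounded_finite[OF compact_imp_bounded[OF K]])
  finally have fin: "emeasure (lebesgue_on K) (space (lebesgue_on K)) < \<infinity>"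
    using Ks by (simp add: space_restrict_space emeasure_restrict_space)
  have lim0: "(\<lambda>k. \<integral>\<^sup>+x. ennreal (norm (f k x - g x)) \<partial>lebesgue_on K) \<longlonglongrightarrow> 0"
    by (rule L2_tendsto_imp_L1[OF f fin])
  then show lim: "(\<lambda>k. \<integral>\<^sup>+x. ennreal (norm (f k x - g x)) * indicator K x \<partial>lebesgue) \<longlonglongrightarrow> 0"
    unfolding nn_integral_restrict_lebesgue[OF Ks] .
  have "\<forall>\<^sub>F k in sequentially. (\<integral>\<^sup>+x. ennreal (norm (f k x - g x)) \<partial>lebesgue_on K) < 1"
    using lim0 by (rule order_tendstoD) simp
  then obtain k where k: "(\<integral>\<^sup>+x. ennreal (norm (f k x - g x)) \<partial>lebesgue_on K) < 1"
    by (auto simp: eventually_sequentially)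
  have m: "f k \<in> borel_measurable (lebesgue_on K)" "g \<in> borel_measurable (lebesgue_on K)" for k
    using f by (auto simp: L2_tendsto_def)
  have 1: "integrable (lebesgue_on K) (\<lambda>x. f k x - g x)"
    by (rule integrableI_bounded) (use m k in \<open>auto intro: order.strict_trans simp: less_top[symmetric]\<close>)
  have 2: "integrable (lebesgue_on K) (f k)"
    using i[of k] Ks by (simp add: integrable_restrict_space set_integrable_def)
  have "integrable (lebesgue_on K) g"
    using Bochner_Integration.integrable_diff[OF 2 1] by simp
  then show "set_integrable lebesgue K g"
    using Ks by (simp add: integrable_restrict_space set_integrable_def)
qed

text \<open>On compact sets \<open>L\<^sup>2\<close> convergence implies \<open>L\<^sup>1\<close> convergence, which is enough for weak gradients.\<close>

lemma weak_gradient_L2_limit: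
  fixes \<psi> :: "nat \<Rightarrow> 'a::euclidean_space \<Rightarrow> real"
  assumes U: "open U" and \<psi>: "\<And>k. Ck 1 (\<psi> k)"
    and L: "L2_tendsto (lebesgue_on U) \<psi> u"
      "L2_tendsto (lebesgue_on U) (\<lambda>k. grad (\<psi> k)) G"
  shows "is_weak_gradient U u G"
proof (rule weak_gradient_limit)
  show "is_weak_gradient U (\<psi> k) (grad (\<psi> k))" for k
    by (rule weak_gradient_of_C1[OF U \<psi>])
  fix K assume K: "compact K" "K \<subseteq> U"
  have s: "K \<in> sets lebesgue" "U \<in> sets lebesgue" using K(1) U by (simp_all add: compact_imp_closed)
  have i: "set_integrable lebesgue K (\<psi> k)" "set_integrable lebesgue K (grad (\<psi> k))" for k
    using Ck_1D[OF \<psi>[of k]] by (auto intro: set_integrable_continuous_compact[OF K(1)])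
  note 1 = set_integrable_L2_limit[OF L2_tendsto_restrict_subset[OF L(1) K(2) s(2,1)] K(1) i(1)]
  note 2 = set_integrable_L2_limit[OF L2_tendsto_restrict_subset[OF L(2) K(2) s(2,1)] K(1) i(2)]
  show "set_integrable lebesgue K u" "set_integrable lebesgue K G" by (rule 1(1) 2(1))+
  show "(\<lambda>k. \<integral>\<^sup>+x. ennreal (norm (\<psi> k x - u x)) * indicator K x \<partial>lebesgue) \<longlonglongrightarrow> 0"
    "(\<lambda>k. \<integral>\<^sup>+x. ennreal (norm (grad (\<psi> k) x - G x)) * indicator K x \<partial>lebesgue) \<longlonglongrightarrow> 0"
    by (rule 1(2) 2(2))+
qed

lemma test_functions_diff:
  assumes "\<phi> \<in> test_functions U" "\<psi> \<in> test_functions U"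
  shows "(\<lambda>x. \<phi> x - \<psi> x) \<in> test_functions U"
proof -
  note p = test_functionD[OF assms(1)] and q = test_functionD[OF assms(2)]
  have "{x. \<phi> x - \<psi> x \<noteq> 0} \<subseteq> {x. \<phi> x \<noteq> 0} \<union> {x. \<psi> x \<noteq> 0}" by auto
  then have sub: "closure {x. \<phi> x - \<psi> x \<noteq> 0} \<subseteq> closure {x. \<phi> x \<noteq> 0} \<union> closure {x. \<psi> x \<noteq> 0}"
    by (metis closure_Un closure_mono)
  have "compact (closure {x. \<phi> x - \<psi> x \<noteq> 0})"
    using compact_Int_closed[OF compact_Un[OF p(3) q(3)] closed_closure[of "{x. \<phi> x - \<psi> x \<noteq> 0}"]] sub
    by (simp add: Int_absorb1)
  moreover have "\<forall>k. Ck k (\<lambda>x. \<phi> x - \<psi> x)" using p(1) q(1) Ck_diff by blast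
  ultimately show ?thesis
    using sub p(4) q(4) unfolding test_functions_def by blast
qed

lemma integrable_weight_test:
  fixes \<phi> :: "'a::euclidean_space \<Rightarrow> real"
  assumes \<phi>: "\<phi> \<in> test_functions U" and dim: "DIM('a) \<ge> 2"
  shows "integrable lborel (\<lambda>x. hardy_weight x * (norm (grad \<phi> x))\<^sup>2)"
proof -
  obtain L R where LR: "L > 0" "R > 0" "\<And>x. norm x \<ge> R \<Longrightarrow> grad \<phi> x = 0" "\<And>x. norm (grad \<phi> x) \<le> L"
    by (rule C1_compact_bounds[OF test_functionD(1,2)[OF \<phi>]], rule that)
  have [measurable]: "grad \<phi> \<in> borel_measurable borel"
    using Ck_1D[OF test_functionD(1)[OF \<phi>, of 1]] by (auto intro: borel_measurable_continuous_onI)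
  show ?thesis
  proof (rule Bochner_Integration.integrable_bound)
    show "integrable lborel (\<lambda>x::'a. indicator (ball 0 R) x * hardy_weight x * L\<^sup>2)"
      using dim LR(2) by (intro integrable_mult_left integrable_norm_powr_cball) auto
    show "AE x in lborel. norm (hardy_weight x * (norm (grad \<phi> x))\<^sup>2) \<le> norm (indicator (ball 0 R) x * hardy_weight x * L\<^sup>2)"
    proof (rule AE_I2)
      fix x :: 'a
      show "norm (hardy_weight x * (norm (grad \<phi> x))\<^sup>2) \<le> norm (indicator (ball 0 R) x * hardy_weight x * L\<^sup>2)"
      proof (cases "norm x < R")
        case True
        have "(norm (grad \<phi> x))\<^sup>2 \<le> L\<^sup>2" by (intro power_mono LR(4)) simp
        then show ?thesis using True by (simp add: mult_left_mono)
      qed (use LR(3)[of x] in simp)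
    qed
  qed measurable
qed

text \<open>The weak gradient of a test function is its gradient, so the norm of the completion is the weighted
  \<open>L\<^sup>2\<close> norm of the gradient. Local integrability of the weight matters here: otherwise the Bochner
  integral in the norm would be zero by default.\<close>

lemma Htilde_norm_test:
  fixes \<phi> :: "'a::euclidean_space \<Rightarrow> real"
  assumes \<phi>: "\<phi> \<in> test_functions \<Omega>" and \<Omega>: "open \<Omega>" and dim: "DIM('a) \<ge> 2"
  shows "nn_sq_norm (weighted_measure \<Omega>) (\<lambda>x. grad \<phi> x) = ennreal ((Htilde_norm \<Omega> \<phi>)\<^sup>2)"
proof -
  note c = Ck_1D[OF test_functionD(1)[OF \<phi>, of 1]]
  let ?h = "\<lambda>x. hardy_weight x * (norm (grad \<phi> x))\<^sup>2"
  have i: "integrable lborel ?h" by (rule integrable_weight_test[OF \<phi> dim])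
  have "AE x in lebesgue. x \<in> \<Omega> \<longrightarrow> weak_grad \<Omega> \<phi> x = grad \<phi> x"
    by (rule weak_grad_unique(1)[OF \<Omega> weak_gradient_of_C1[OF \<Omega> test_functionD(1)[OF \<phi>]]])
  then have "(LINT x:\<Omega>|lebesgue. hardy_weight x * (norm (weak_grad \<Omega> \<phi> x))\<^sup>2) = (\<integral>x. ?h x \<partial>lebesgue)"
    unfolding set_lebesgue_integral_def
    by (intro integral_lebesgue_cong_AE, elim eventually_mono)
      (use test_function_outside[OF \<phi>] in \<open>auto simp: indicator_def\<close>)
  also have "\<dots> = (\<integral>x. ?h x \<partial>lborel)"
    by (rule integral_completion[OF borel_measurable_integrable[OF i]])
  finally have "(Htilde_norm \<Omega> \<phi>)\<^sup>2 = (\<integral>x. ?h x \<partial>lborel)"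
    by (simp add: Htilde_norm_def Bochner_Integration.integral_nonneg)
  moreover have "nn_sq_norm (weighted_measure \<Omega>) (\<lambda>x. grad \<phi> x) = ennreal (\<integral>x. ?h x \<partial>lborel)"
  proof -
    have "(\<lambda>x. ennreal ((norm (grad \<phi> x))\<^sup>2)) \<in> borel_measurable (lebesgue_on \<Omega>)"
      using continuous_imp_borel_lebesgue(2)[OF c(2)] by (intro measurable_restrict_space1) measurable
    then have "nn_sq_norm (weighted_measure \<Omega>) (\<lambda>x. grad \<phi> x)
        = (\<integral>\<^sup>+x. ennreal (hardy_weight x) * ennreal ((norm (grad \<phi> x))\<^sup>2) * indicator \<Omega> x \<partial>lebesgue)"
      by (rule nn_integral_weighted_measure[OF \<Omega>])
    also have "\<dots> = (\<integral>\<^sup>+x. ennreal (?h x) \<partial>lebesgue)"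
      using test_function_outside[OF \<phi>] by (intro nn_integral_cong) (auto simp: indicator_def ennreal_mult)
    also have "\<dots> = (\<integral>\<^sup>+x. ennreal (?h x) \<partial>lborel)"
      by (rule nn_integral_completion) (use borel_measurable_integrable[OF i] in measurable)
    also have "\<dots> = ennreal (\<integral>x. ?h x \<partial>lborel)"
      by (rule nn_integral_eq_integral[OF i]) auto
    finally show ?thesis .
  qed
  ultimately show ?thesis by simp
qed

text \<open>The Cauchy condition on the test functions says that their gradients form a Cauchy sequence in
  the weighted \<open>L\<^sup>2\<close> space.\<close>

lemma Htilde_sequence:
  fixes v :: "'a::euclidean_space \<Rightarrow> real"
  assumes v: "v \<in> Htilde \<Omega>" and \<Omega>: "open \<Omega>" and dim: "DIM('a) \<ge> 2"
  obtains \<phi> G where "\<And>k. \<phi> k \<in> test_functions \<Omega>" "L2_tendsto (weighted_measure \<Omega>) \<phi> v"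
    "L2_tendsto (weighted_measure \<Omega>) (\<lambda>k. grad (\<phi> k)) G"
proof -
  obtain \<phi> where \<phi>: "\<And>k. \<phi> k \<in> test_functions \<Omega>" "L2_tendsto (weighted_measure \<Omega>) \<phi> v"
    and c: "\<And>e. e > 0 \<Longrightarrow> \<exists>M. \<forall>j\<ge>M. \<forall>k\<ge>M. Htilde_norm \<Omega> (\<lambda>x. \<phi> j x - \<phi> k x) < e"
    using v unfolding Htilde_def by blast
  have C1: "Ck 1 (\<phi> k)" for k using test_functionD(1)[OF \<phi>(1)] .
  obtain G where "L2_tendsto (weighted_measure \<Omega>) (\<lambda>k. grad (\<phi> k)) G"
  proof (rule L2_complete[of "\<lambda>k. grad (\<phi> k)" "weighted_measure \<Omega>"])
    show "grad (\<phi> k) \<in> borel_measurable (weighted_measure \<Omega>)" for k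
      unfolding measurable_weighted_measure
      by (intro measurable_restrict_space1 continuous_imp_borel_lebesgue(2) Ck_1D(2) C1)
    fix e :: real assume e: "e > 0"
    obtain M where M: "\<And>j k. j \<ge> M \<Longrightarrow> k \<ge> M \<Longrightarrow> Htilde_norm \<Omega> (\<lambda>x. \<phi> j x - \<phi> k x) < sqrt e"
      using c[of "sqrt e"] e by auto
    show "\<exists>N. \<forall>j\<ge>N. \<forall>k\<ge>N. nn_sq_norm (weighted_measure \<Omega>) (\<lambda>x. grad (\<phi> j) x - grad (\<phi> k) x) < ennreal e"
    proof (intro exI[of _ M] allI impI)
      fix j k assume jk: "M \<le> j" "M \<le> k"
      let ?h = "Htilde_norm \<Omega> (\<lambda>x. \<phi> j x - \<phi> k x)"
      have "0 \<le> ?h" unfolding Htilde_norm_def set_lebesgue_integral_def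
        by (intro real_sqrt_ge_zero Bochner_Integration.integral_nonneg) (auto simp: indicator_def)
      then have "?h\<^sup>2 < (sqrt e)\<^sup>2" using M[OF jk] by (intro power_strict_mono) auto
      then have "?h\<^sup>2 < e" using e by simp
      then have "ennreal (?h\<^sup>2) < ennreal e" using e by (simp add: ennreal_less_iff)
      then show "nn_sq_norm (weighted_measure \<Omega>) (\<lambda>x. grad (\<phi> j) x - grad (\<phi> k) x) < ennreal e"
        using Htilde_norm_test[OF test_functions_diff[OF \<phi>(1)[of j] \<phi>(1)[of k]] \<Omega> dim]
        by (simp add: grad_diff[OF C1 C1])
    qed
  qed blast
  then show thesis using that \<phi> by blast
qed

text \<open>The power is applied not to the squared norm but to an expression that is bounded away from zero
  and differs from the squared norm only inside the ball, by the square of a positive part.\<close>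

lemma powr_norm_C1_extension:
  fixes a r :: real
  assumes r: "r > 0"
  obtains \<rho> :: "'a::euclidean_space \<Rightarrow> real" where "Ck 1 \<rho>" "\<And>x. norm x \<ge> r \<Longrightarrow> \<rho> x = norm x powr (- a)"
    "\<And>x. norm x \<ge> r \<Longrightarrow> grad \<rho> x = (- (a * norm x powr (- a - 2))) *\<^sub>R x"
proof -
  \<comment> \<open>For \<open>s \<le> r\<^sup>2\<close> this is a quadratic in \<open>s\<close> without real zeros.\<close>
  define m where "m s = s + (max (r\<^sup>2 - s) 0)\<^sup>2 / r\<^sup>2" for s
  define m' where "m' s = 1 - 2 * max (r\<^sup>2 - s) 0 / r\<^sup>2" for s
  have r2: "r\<^sup>2 > 0" using r by simp
  have m_pos: "m s > 0" for s
  proof (cases "s < r\<^sup>2")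
    case True
    have "0 < (s - r\<^sup>2 / 2)\<^sup>2 + 3 / 4 * (r\<^sup>2)\<^sup>2" using r2 by (intro add_nonneg_pos) auto
    then have "0 < s * r\<^sup>2 + (r\<^sup>2 - s)\<^sup>2" by (simp add: power2_eq_square algebra_simps)
    moreover have "m s = (s * r\<^sup>2 + (r\<^sup>2 - s)\<^sup>2) / r\<^sup>2" using True r2 by (simp add: m_def field_simps)
    ultimately show ?thesis using r2 by simp
  next
    case False
    then have "s > 0" using r2 by linarith
    then show ?thesis using False by (simp add: m_def max_def)
  qed
  have Dm: "(m has_real_derivative m' s) (at s)" for s
  proof -
    have "((\<lambda>s. (max (r\<^sup>2 - s) 0)\<^sup>2) has_real_derivative (2 * max (r\<^sup>2 - s) 0) * (-1)) (at s)"
      by (rule DERIV_chain2[OF DERIV_pos_part_squared]) (auto intro!: derivative_eq_intros)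
    from DERIV_add[OF DERIV_ident DERIV_cdivide[OF this, of "r\<^sup>2"]]
    show ?thesis unfolding m_def[abs_def] m'_def by simp
  qed
  define \<rho> where "\<rho> x = m (x \<bullet> x) powr (- a / 2)" for x :: 'a
  define g where "g x = (- a * m (x \<bullet> x) powr (- a / 2 - 1) * m' (x \<bullet> x)) *\<^sub>R x" for x :: 'a
  have D: "(\<rho> has_derivative (\<lambda>h. g x \<bullet> h)) (at x)" for x
  proof -
    have 1: "((\<lambda>x. x \<bullet> x) has_derivative (\<lambda>h. 2 * (x \<bullet> h))) (at x)"
      by (auto intro!: derivative_eq_intros simp: inner_commute)
    have 2: "((\<lambda>s. m s powr (- a / 2)) has_real_derivative (- a / 2) * m (x \<bullet> x) powr (- a / 2 - 1) * m' (x \<bullet> x)) (at (x \<bullet> x))"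
      using DERIV_fun_powr[OF Dm[of "x \<bullet> x"] m_pos[of "x \<bullet> x"], of "- a / 2"] by simp
    from has_derivative_compose[OF 1 2[THEN has_field_derivative_imp_has_derivative]]
    show ?thesis unfolding \<rho>_def g_def by (rule has_derivative_eq_rhs) (auto simp: fun_eq_iff)
  qed
  have cm: "continuous_on UNIV m" "continuous_on UNIV m'"
    unfolding m_def[abs_def] m'_def[abs_def] using r2 by (auto intro!: continuous_intros)
  have cg: "continuous_on UNIV g"
    unfolding g_def
    by (intro continuous_intros continuous_on_compose2[OF cm(1)] continuous_on_compose2[OF cm(2)])
      (use m_pos in \<open>auto simp: less_imp_neq[THEN not_sym]\<close>)
  have out: "m (x \<bullet> x) = (norm x)\<^sup>2" "m' (x \<bullet> x) = 1" if "norm x \<ge> r" for x :: 'a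
  proof -
    have "r\<^sup>2 \<le> x \<bullet> x" using that r by (simp add: power2_norm_eq_inner[symmetric] power_mono)
    then show "m (x \<bullet> x) = (norm x)\<^sup>2" "m' (x \<bullet> x) = 1"
      by (simp_all add: m_def m'_def power2_norm_eq_inner max_def)
  qed
  have pw: "((norm x)\<^sup>2) powr s = norm x powr (2 * s)" if "norm x \<ge> r" for x :: 'a and s
    using that r by (simp add: powr_powr[symmetric] powr_numeral)
  show thesis
  proof (rule that[of \<rho>])
    show "Ck 1 \<rho>" by (rule Ck_1I(1)[OF D cg])
    show "\<rho> x = norm x powr (- a)" if "norm x \<ge> r" for x
      using pw[OF that, of "- a / 2"] by (simp add: \<rho>_def out[OF that])
    show "grad \<rho> x = (- (a * norm x powr (- a - 2))) *\<^sub>R x" if "norm x \<ge> r" for x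
      using pw[OF that, of "- a / 2 - 1"] unfolding Ck_1I(2)[OF D cg] by (simp add: g_def out[OF that])
  qed
qed

section \<open>Traces on spheres\<close>

lemma measurable_restrict_cong_AE:
  fixes f g :: "'a::euclidean_space \<Rightarrow> 'b::euclidean_space"
  assumes f: "f \<in> borel_measurable (lebesgue_on S)" and S: "S \<in> sets lebesgue"
    and eq: "AE x in lebesgue. x \<in> S \<longrightarrow> g x = f x"
  shows "g \<in> borel_measurable (lebesgue_on S)"
proof -
  have "(\<lambda>x. indicator S x *\<^sub>R f x) \<in> borel_measurable lebesgue"
    using f S by (simp add: borel_measurable_restrict_space_iff)
  moreover have "AE x in lebesgue. indicator S x *\<^sub>R f x = indicator S x *\<^sub>R g x"
    using eq by eventually_elim (auto simp: indicator_def)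
  ultimately have "(\<lambda>x. indicator S x *\<^sub>R g x) \<in> borel_measurable lebesgue"
    by (rule borel_measurable_AE)
  then show ?thesis using S by (simp add: borel_measurable_restrict_space_iff)
qed

lemma nn_integral_diff_squared_le:
  fixes f f' g :: "'a \<Rightarrow> 'b::euclidean_space"
  assumes [measurable]: "f \<in> borel_measurable M" "f' \<in> borel_measurable M" "g \<in> borel_measurable M"
  shows "nn_sq_norm M (\<lambda>x. f x - f' x)
    \<le> 2 * nn_sq_norm M (\<lambda>x. f x - g x) + 2 * nn_sq_norm M (\<lambda>x. f' x - g x)"
  using nn_integral_norm_add_squared_le[of "\<lambda>x. f x - g x" M "\<lambda>x. g x - f' x"]
  by (simp add: norm_minus_commute)

lemma trace_energy:
  fixes T :: "'a::euclidean_space set"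
  assumes r: "0 < r" "r < R" and T: "ball 0 R - cball 0 r \<subseteq> T" "T \<in> sets lebesgue"
  obtains C where "C > 0" "\<And>w. Ck 1 w \<Longrightarrow> nn_sq_norm (sphere_measure r) w \<le>
    ennreal C * (nn_sq_norm (lebesgue_on T) w +
      nn_sq_norm (lebesgue_on T) (grad w))"
proof -
  obtain C where C: "C > 0" "\<And>w::'a \<Rightarrow> real. Ck 1 w \<Longrightarrow>
    (\<integral>\<^sup>+x. ennreal ((w x)\<^sup>2) \<partial>sphere_measure r) \<le>
    ennreal C * (\<integral>\<^sup>+x. ennreal ((w x)\<^sup>2 + (norm (grad w x))\<^sup>2) * indicator (ball 0 R - cball 0 r) x \<partial>lborel)"
    by (rule trace_inequality[OF r], rule that)
  have "nn_sq_norm (sphere_measure r) w \<le>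
    ennreal C * (nn_sq_norm (lebesgue_on T) w +
      nn_sq_norm (lebesgue_on T) (grad w))" if w: "Ck 1 w" for w
  proof -
    note m = continuous_imp_borel_lebesgue[OF Ck_1D(3)[OF w]] continuous_imp_borel_lebesgue[OF Ck_1D(2)[OF w]]
    have m1: "(\<lambda>x. ennreal ((norm (w x))\<^sup>2)) \<in> borel_measurable (lebesgue_on T)"
      "(\<lambda>x. ennreal ((norm (grad w x))\<^sup>2)) \<in> borel_measurable (lebesgue_on T)"
      using m by (auto intro!: measurable_restrict_space1)
    let ?E = "\<lambda>x. ennreal ((w x)\<^sup>2 + (norm (grad w x))\<^sup>2) * indicator (ball 0 R - cball 0 r) x"
    have "(\<integral>\<^sup>+x. ?E x \<partial>lborel) = (\<integral>\<^sup>+x. ?E x \<partial>lebesgue)"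
      by (rule nn_integral_completion[symmetric])
    also have "\<dots> \<le> (\<integral>\<^sup>+x. (ennreal ((norm (w x))\<^sup>2) + ennreal ((norm (grad w x))\<^sup>2)) * indicator T x \<partial>lebesgue)"
      using T(1) by (intro nn_integral_mono) (auto simp: indicator_def subset_iff)
    also have "\<dots> = (\<integral>\<^sup>+x. ennreal ((norm (w x))\<^sup>2) + ennreal ((norm (grad w x))\<^sup>2) \<partial>lebesgue_on T)"
      by (rule nn_integral_restrict_lebesgue[symmetric, OF T(2)])
    also have "\<dots> = nn_sq_norm (lebesgue_on T) w +
      nn_sq_norm (lebesgue_on T) (grad w)"
      by (rule nn_integral_add[OF m1])
    finally have "ennreal C * (\<integral>\<^sup>+x. ?E x \<partial>lborel) \<le> ennreal C * (nn_sq_norm (lebesgue_on T) w +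
      nn_sq_norm (lebesgue_on T) (grad w))"
      by (rule mult_left_mono) simp
    then show ?thesis using order_trans[OF C(2)[OF w]] by simp
  qed
  with C(1) show thesis by (rule that)
qed

text \<open>The trace inequality yields both that the traces of an approximating sequence converge and
  that the limit does not depend on the sequence.\<close>

lemma sphere_trace_limit:
  fixes \<psi> :: "nat \<Rightarrow> 'a::euclidean_space \<Rightarrow> real"
  assumes \<Omega>: "open \<Omega>" and r: "0 < r" "r < R" "cball 0 R \<subseteq> \<Omega>"
    and \<psi>: "\<And>k. Ck 1 (\<psi> k)"
    and L: "L2_tendsto (lebesgue_on (\<Omega> - cball 0 r)) \<psi> u"
      "L2_tendsto (lebesgue_on (\<Omega> - cball 0 r)) (\<lambda>k. grad (\<psi> k)) G"
  shows "L2_tendsto (sphere_measure r) \<psi> (sphere_trace \<Omega> r u)"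
proof -
  define T where "T = \<Omega> - cball 0 r"
  define M where "M = lebesgue_on T"
  have T: "open T" "T \<in> sets lebesgue" "ball 0 R - cball 0 r \<subseteq> T"
    using \<Omega> r by (auto simp: T_def open_Diff)
  note L = L[folded T_def, folded M_def]
  obtain C where C: "C > 0" "\<And>w. Ck 1 w \<Longrightarrow> nn_sq_norm (sphere_measure r) w \<le>
    ennreal C * (nn_sq_norm M w + nn_sq_norm M (grad w))"
    by (rule trace_energy[OF r(1,2) T(3,2), folded M_def], rule that)
  have m_sphere: "w \<in> borel_measurable (sphere_measure r)" if "Ck 1 w" for w :: "'a \<Rightarrow> real"
    using continuous_imp_borel_lebesgue(1)[OF Ck_1D(3)[OF that]] by measurable
  have weak: "is_weak_gradient T u G"
    using L unfolding M_def by (rule weak_gradient_L2_limit[OF T(1) \<psi>])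
  define E where "E f = nn_sq_norm M (\<lambda>x. f x - u x) + nn_sq_norm M (\<lambda>x. grad f x - G x)" for f
  have diff_le: "nn_sq_norm (sphere_measure r) (\<lambda>x. f x - f' x) \<le> ennreal C * (2 * E f + 2 * E f')"
    if f: "Ck 1 f" "Ck 1 f'" for f f' :: "'a \<Rightarrow> real"
  proof -
    have m: "f \<in> borel_measurable M" "f' \<in> borel_measurable M" "grad f \<in> borel_measurable M" "grad f' \<in> borel_measurable M"
      unfolding M_def using Ck_1D[OF f(1)] Ck_1D[OF f(2)]
      by (auto intro!: measurable_restrict_space1 continuous_imp_borel_lebesgue)
    have mu: "u \<in> borel_measurable M" "G \<in> borel_measurable M" using L by (auto simp: L2_tendsto_def)
    have "nn_sq_norm (sphere_measure r) (\<lambda>x. f x - f' x) \<le>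
      ennreal C * (nn_sq_norm M (\<lambda>x. f x - f' x) + nn_sq_norm M (\<lambda>x. grad f x - grad f' x))"
      using C(2)[OF Ck_diff[OF f]] by (simp add: grad_diff[OF f])
    also have "\<dots> \<le> ennreal C * ((2 * nn_sq_norm M (\<lambda>x. f x - u x) + 2 * nn_sq_norm M (\<lambda>x. f' x - u x)) +
       (2 * nn_sq_norm M (\<lambda>x. grad f x - G x) + 2 * nn_sq_norm M (\<lambda>x. grad f' x - G x)))"
      by (intro mult_left_mono add_mono nn_integral_diff_squared_le m mu) simp
    finally show ?thesis by (simp add: E_def distrib_left ac_simps)
  qed
  have E_lim: "(\<lambda>k. E (h k)) \<longlonglongrightarrow> 0"
    if "L2_tendsto M h u" "(\<lambda>k. nn_sq_norm M (\<lambda>x. grad (h k) x - G x)) \<longlonglongrightarrow> 0" for h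
    using tendsto_add[OF _ that(2), of "\<lambda>k. nn_sq_norm M (\<lambda>x. h k x - u x)" 0] that(1)
    by (simp add: E_def L2_tendsto_def)
  have lim: "(\<lambda>k. E (\<psi> k)) \<longlonglongrightarrow> 0" using L by (intro E_lim) (auto simp: L2_tendsto_def)
  obtain g where g: "L2_tendsto (sphere_measure r) \<psi> g"
  proof (rule L2_complete[of \<psi> "sphere_measure r"])
    show "\<psi> k \<in> borel_measurable (sphere_measure r)" for k by (rule m_sphere[OF \<psi>])
    fix e :: real assume e: "e > 0"
    define d where "d = e / (8 * C)"
    have d: "d > 0" using e C(1) by (simp add: d_def)
    have "\<forall>\<^sub>F k in sequentially. E (\<psi> k) < ennreal d"
      by (rule order_tendstoD(2)[OF lim]) (use d in auto)
    then obtain N where N: "\<And>k. k \<ge> N \<Longrightarrow> E (\<psi> k) < ennreal d"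
      by (auto simp: eventually_sequentially)
    show "\<exists>N. \<forall>j\<ge>N. \<forall>k\<ge>N. nn_sq_norm (sphere_measure r) (\<lambda>x. \<psi> j x - \<psi> k x) < ennreal e"
    proof (intro exI[of _ N] allI impI)
      fix j k assume jk: "N \<le> j" "N \<le> k"
      note diff_le[OF \<psi>[of j] \<psi>[of k]]
      also have "ennreal C * (2 * E (\<psi> j) + 2 * E (\<psi> k)) \<le> ennreal C * (2 * ennreal d + 2 * ennreal d)"
        using N[OF jk(1)] N[OF jk(2)] by (intro mult_left_mono add_mono) auto
      also have "\<dots> = ennreal (C * (2 * d + 2 * d))"
      proof -
        have t: "2 * ennreal d = ennreal (2 * d)" using d by (simp add: ennreal_mult)
        show ?thesis unfolding t
          using C(1) d by (simp add: ennreal_mult[symmetric] ennreal_plus[symmetric] del: ennreal_plus)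
      qed
      also have "C * (2 * d + 2 * d) = e / 2"
        using C(1) by (simp add: d_def)
      also have "ennreal (e / 2) < ennreal e" using e by (simp add: ennreal_less_iff)
      finally show "nn_sq_norm (sphere_measure r) (\<lambda>x. \<psi> j x - \<psi> k x) < ennreal e" .
    qed
  qed blast
  have "is_trace \<Omega> r u g"
    unfolding is_trace_def T_def[symmetric] M_def[symmetric] using \<psi> weak L g by blast
  then have "is_trace \<Omega> r u (sphere_trace \<Omega> r u)"
    unfolding sphere_trace_def by (rule someI[where P = "is_trace \<Omega> r u"])
  then obtain \<psi>' G' where 2: "\<And>k. Ck 1 (\<psi>' k)" "is_weak_gradient T u G'"
    "L2_tendsto M \<psi>' u" "L2_tendsto M (\<lambda>k. grad (\<psi>' k)) G'"
    "L2_tendsto (sphere_measure r) \<psi>' (sphere_trace \<Omega> r u)"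
    unfolding is_trace_def T_def[symmetric] M_def[symmetric] by blast
  have "AE x in lebesgue. x \<in> T \<longrightarrow> G' x = G x"
    by (rule weak_gradient_unique[OF T(1) 2(2) weak])
  then have GG': "AE x in M. G' x = G x"
    unfolding M_def using T(2) by (subst AE_restrict_space_iff) auto
  have "nn_sq_norm M (\<lambda>x. grad (\<psi>' k) x - G x) = nn_sq_norm M (\<lambda>x. grad (\<psi>' k) x - G' x)" for k
    by (rule nn_integral_cong_AE) (use GG' in \<open>auto elim: eventually_mono\<close>)
  then have lim': "(\<lambda>k. E (\<psi>' k)) \<longlonglongrightarrow> 0"
    using 2(3,4) by (intro E_lim) (auto simp: L2_tendsto_def)
  have "(\<lambda>k. ennreal C * (2 * E (\<psi> k) + 2 * E (\<psi>' k))) \<longlonglongrightarrow> ennreal C * (2 * 0 + 2 * 0)"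
    by (intro ennreal_tendsto_cmult tendsto_add lim lim') auto
  then have z: "(\<lambda>k. ennreal C * (2 * E (\<psi> k) + 2 * E (\<psi>' k))) \<longlonglongrightarrow> 0" by simp
  have "(\<lambda>k. nn_sq_norm (sphere_measure r) (\<lambda>x. \<psi> k x - \<psi>' k x)) \<longlonglongrightarrow> 0"
    by (rule tendsto_sandwich[OF _ _ tendsto_const z]) (use diff_le[OF \<psi> 2(1)] in auto)
  then have eq: "AE x in sphere_measure r. g x = sphere_trace \<Omega> r u x"
    by (rule L2_tendsto_unique_AE[OF g 2(5)])
  show ?thesis
  proof (rule L2_tendsto_dominated[OF g, where C = 1])
    show "\<psi> k \<in> borel_measurable (sphere_measure r)" for k by (rule m_sphere[OF \<psi>])
    show "sphere_trace \<Omega> r u \<in> borel_measurable (sphere_measure r)"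
      using 2(5) by (simp add: L2_tendsto_def)
    show "AE x in sphere_measure r. norm (\<psi> k x - sphere_trace \<Omega> r u x) \<le> 1 * norm (\<psi> k x - g x)" for k
      using eq by eventually_elim simp
  qed simp
qed

section \<open>The identity outside a ball\<close>

lemma integral_exterior:
  fixes f :: "'a::euclidean_space \<Rightarrow> real"
  assumes \<Omega>: "open \<Omega>" and i: "integrable lborel (\<lambda>x. indicator (- ball 0 r) x * f x)"
    and z: "\<And>x. x \<notin> \<Omega> \<Longrightarrow> f x = 0"
  shows "integrable (lebesgue_on (\<Omega> - ball 0 r)) f"
    "(\<integral>x. f x \<partial>lebesgue_on (\<Omega> - ball 0 r)) = (\<integral>x. indicator (- ball 0 r) x * f x \<partial>lborel)"
proof -
  have eq: "indicator (\<Omega> - ball 0 r) x * f x = indicator (- ball 0 r) x * f x" for x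
    using z[of x] by (auto simp: indicator_def)
  have m: "(\<lambda>x. indicator (- ball 0 r) x * f x) \<in> borel_measurable lborel"
    by (rule borel_measurable_integrable[OF i])
  have s: "\<Omega> - ball 0 r \<in> sets lebesgue" using \<Omega> by (auto intro!: sets.Diff)
  show "integrable (lebesgue_on (\<Omega> - ball 0 r)) f"
    using i m s by (subst integrable_restrict_space) (simp_all add: eq integrable_completion)
  show "(\<integral>x. f x \<partial>lebesgue_on (\<Omega> - ball 0 r)) = (\<integral>x. indicator (- ball 0 r) x * f x \<partial>lborel)"
    using m s by (subst integral_restrict_space) (simp_all add: eq integral_completion)
qed

text \<open>For \<open>u = \<bar>x\<bar>\<^sup>-\<^sup>a v\<close> with \<open>2 a + 2 = N\<close> the pointwise Hardy density of \<open>u\<close> is the weighted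
  energy density of \<open>v\<close> minus \<open>a \<bar>x\<bar>\<^sup>-\<^sup>N (x \<cdot> \<nabla>(v\<^sup>2))\<close>, whose integral is the flux that
  the surface term cancels.\<close>

lemma exterior_identity:
  fixes \<phi> \<psi> :: "'a::euclidean_space \<Rightarrow> real" and r a :: real and \<Omega> :: "'a set"
  defines "M \<equiv> lebesgue_on (\<Omega> - ball 0 r)"
  assumes a: "a = (real DIM('a) - 2) / 2" "a \<ge> 0" and \<Omega>: "open \<Omega>" and r: "r > 0"
    and test: "\<phi> \<in> test_functions \<Omega>" and \<psi>: "Ck 1 \<psi>" "bounded {x. \<psi> x \<noteq> 0}"
    and out: "\<forall>x. x \<notin> \<Omega> \<longrightarrow> \<psi> x = 0 \<and> grad \<psi> x = 0"
    and eqs: "\<forall>x. r \<le> norm x \<longrightarrow> \<psi> x = norm x powr (- a) * \<phi> x"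
      "\<forall>x. r \<le> norm x \<longrightarrow>
        grad \<psi> x = norm x powr (- a) *\<^sub>R grad \<phi> x - (a * norm x powr (- a - 2) * \<phi> x) *\<^sub>R x"
  shows "integrable M (\<lambda>x. (norm (grad \<psi> x))\<^sup>2)" "integrable M (\<lambda>x. (\<psi> x)\<^sup>2 / (norm x)\<^sup>2)"
    "integrable (sphere_measure r) (\<lambda>x. (\<psi> x)\<^sup>2)"
    "integrable M (\<lambda>x. hardy_weight x * (norm (grad \<phi> x))\<^sup>2)"
    "(\<integral>x. (norm (grad \<psi> x))\<^sup>2 \<partial>M) - a\<^sup>2 * (\<integral>x. (\<psi> x)\<^sup>2 / (norm x)\<^sup>2 \<partial>M)
      - a * inverse r * (\<integral>x. (\<psi> x)\<^sup>2 \<partial>sphere_measure r)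
      = (\<integral>x. hardy_weight x * (norm (grad \<phi> x))\<^sup>2 \<partial>M)"
proof -
  let ?N = "DIM('a)" and ?I = "\<lambda>x. indicator (- ball 0 r) x :: real"
  note \<phi> = test_functionD(1)[OF test, of 1] test_functionD(2)[OF test]
  note eq = eqs[rule_format]
  have aa: "- a + - a = 2 - real ?N" using a(1) by simp
  obtain L1 R1 where 1: "L1 > 0" "R1 > 0" "\<And>x. norm x \<ge> R1 \<Longrightarrow> \<phi> x = 0" "\<And>x. norm x \<ge> R1 \<Longrightarrow> grad \<phi> x = 0"
      "\<And>x. \<bar>\<phi> x\<bar> \<le> L1" "\<And>x. norm (grad \<phi> x) \<le> L1"
    by (rule C1_compact_bounds[OF \<phi>], rule that)
  obtain L2 R2 where 2: "L2 > 0" "R2 > 0" "\<And>x. norm x \<ge> R2 \<Longrightarrow> \<psi> x = 0" "\<And>x. norm x \<ge> R2 \<Longrightarrow> grad \<psi> x = 0"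
      "\<And>x. \<bar>\<psi> x\<bar> \<le> L2" "\<And>x. norm (grad \<psi> x) \<le> L2"
    by (rule C1_compact_bounds[OF \<psi>], rule that)
  have [measurable]: "\<phi> \<in> borel_measurable borel" "grad \<phi> \<in> borel_measurable borel"
     "\<psi> \<in> borel_measurable borel" "grad \<psi> \<in> borel_measurable borel"
    using Ck_1D[OF \<phi>(1)] Ck_1D[OF \<psi>(1)] by (auto intro: borel_measurable_continuous_onI)
  have mI: "(\<lambda>x. ?I x * f x) \<in> borel_measurable borel" if "f \<in> borel_measurable borel" for f :: "'a \<Rightarrow> real"
    using that by (intro borel_measurable_times borel_measurable_indicator) auto
  have i1: "integrable lborel (\<lambda>x. ?I x * (norm (grad \<psi> x))\<^sup>2)"
  proof (rule integrable_bounded_on_cball)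
    show "(\<lambda>x. ?I x * (norm (grad \<psi> x))\<^sup>2) \<in> borel_measurable borel" by (rule mI) measurable
    show "\<bar>?I x * (norm (grad \<psi> x))\<^sup>2\<bar> \<le> indicator (cball 0 R2) x * L2\<^sup>2" for x
      using 2(4)[of x] power_mono[OF 2(6)[of x] norm_ge_zero, of 2]
      by (cases "norm x \<le> R2") (auto simp: indicator_def)
  qed
  have i2: "integrable lborel (\<lambda>x. ?I x * ((\<psi> x)\<^sup>2 / (norm x)\<^sup>2))"
  proof (rule integrable_bounded_on_cball)
    show "(\<lambda>x. ?I x * ((\<psi> x)\<^sup>2 / (norm x)\<^sup>2)) \<in> borel_measurable borel" by (rule mI) measurable
    show "\<bar>?I x * ((\<psi> x)\<^sup>2 / (norm x)\<^sup>2)\<bar> \<le> indicator (cball 0 R2) x * (L2\<^sup>2 / r\<^sup>2)" for x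
    proof (cases "norm x \<le> R2 \<and> norm x \<ge> r")
      case True
      have "(\<psi> x)\<^sup>2 \<le> L2\<^sup>2" using power_mono[OF 2(5)[of x] abs_ge_zero, of 2] by simp
      then have "(\<psi> x)\<^sup>2 / (norm x)\<^sup>2 \<le> L2\<^sup>2 / r\<^sup>2"
        using power_mono[of r "norm x" 2] True r by (intro frac_le) auto
      then show ?thesis using True by simp
    qed (use 2(3)[of x] in \<open>auto simp: indicator_def\<close>)
  qed
  have i4: "integrable lborel (\<lambda>x. ?I x * (hardy_weight x * (norm (grad \<phi> x))\<^sup>2))"
  proof (rule integrable_bounded_on_cball)
    show "(\<lambda>x. ?I x * (hardy_weight x * (norm (grad \<phi> x))\<^sup>2)) \<in> borel_measurable borel" by (rule mI) measurable
    show "\<bar>?I x * (hardy_weight x * (norm (grad \<phi> x))\<^sup>2)\<bar> \<le> indicator (cball 0 R1) x * (r powr (- (real ?N - 2)) * L1\<^sup>2)" for x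
    proof (cases "norm x \<le> R1 \<and> norm x \<ge> r")
      case True
      have "hardy_weight x \<le> r powr (- (real ?N - 2))"
        using True r a by (intro powr_mono2') auto
      moreover have "(norm (grad \<phi> x))\<^sup>2 \<le> L1\<^sup>2" using power_mono[OF 1(6)[of x] norm_ge_zero, of 2] .
      ultimately show ?thesis using True by (auto intro!: mult_mono)
    qed (use 1(4)[of x] in \<open>auto simp: indicator_def\<close>)
  qed
  have "(norm (grad \<psi> x))\<^sup>2 = 0" "(\<psi> x)\<^sup>2 / (norm x)\<^sup>2 = 0" "hardy_weight x * (norm (grad \<phi> x))\<^sup>2 = 0"
    if "x \<notin> \<Omega>" for x
    using out that test_function_outside[OF test that] by auto
  note e1 = integral_exterior[OF \<Omega> i1 this(1), folded M_def] and e2 = integral_exterior[OF \<Omega> i2 this(2), folded M_def]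
    and e4 = integral_exterior[OF \<Omega> i4 this(3), folded M_def]
  show "integrable M (\<lambda>x. (norm (grad \<psi> x))\<^sup>2)" "integrable M (\<lambda>x. (\<psi> x)\<^sup>2 / (norm x)\<^sup>2)"
    "integrable M (\<lambda>x. hardy_weight x * (norm (grad \<phi> x))\<^sup>2)"
    by (rule e1(1) e2(1) e4(1); assumption)+
  define f where "f x = \<phi> x * \<phi> x" for x
  have f: "Ck 1 f" "bounded {x. f x \<noteq> 0}" "f x \<ge> 0" "grad f x = (2 * \<phi> x) *\<^sub>R grad \<phi> x" for x
  proof -
    have fe: "f = (\<lambda>x. \<phi> x * \<phi> x)" by (simp add: f_def fun_eq_iff)
    show "Ck 1 f" unfolding fe by (rule Ck_mult[OF \<phi>(1) \<phi>(1)])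
    show "grad f x = (2 * \<phi> x) *\<^sub>R grad \<phi> x"
      unfolding fe grad_mult[OF \<phi>(1) \<phi>(1)] by (simp add: scaleR_left_distrib[symmetric])
    show "bounded {x. f x \<noteq> 0}" "f x \<ge> 0" using \<phi>(2) by (simp_all add: f_def)
  qed
  let ?q = "\<lambda>x. ?I x * ((grad f x \<bullet> x) / norm x ^ ?N)"
  have iq: "integrable lborel ?q" by (rule radial_flux(1)[OF f(1,2) r])
  have ptw: "?I x * (norm (grad \<psi> x))\<^sup>2 - a\<^sup>2 * (?I x * ((\<psi> x)\<^sup>2 / (norm x)\<^sup>2))
      = ?I x * (hardy_weight x * (norm (grad \<phi> x))\<^sup>2) - a * ?q x" for x
  proof (cases "norm x \<ge> r")
    case True
    define t where "t = norm x"
    have t: "t > 0" using True r unfolding t_def by linarith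
    define p where "p = t powr (- a)"
    have pt: "t powr (- a - 2) = p / t\<^sup>2"
      using t by (simp add: p_def powr_diff powr_numeral)
    have "p * p = t powr (2 - real ?N)" unfolding p_def powr_add[symmetric] aa ..
    also have "\<dots> = t\<^sup>2 / t ^ ?N" using t by (simp add: powr_diff powr_numeral powr_realpow)
    finally have pp: "p * p = t\<^sup>2 / t ^ ?N" .
    have hw: "hardy_weight x = p * p"
      unfolding p_def powr_add[symmetric] aa t_def by simp
    define c where "c = a * (p / t\<^sup>2) * \<phi> x"
    have "(norm (grad \<psi> x))\<^sup>2 = (p *\<^sub>R grad \<phi> x - c *\<^sub>R x) \<bullet> (p *\<^sub>R grad \<phi> x - c *\<^sub>R x)"
      unfolding power2_norm_eq_inner eq(2)[OF True] t_def[symmetric] pt c_def p_def by simp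
    also have "\<dots> = p * p * (grad \<phi> x \<bullet> grad \<phi> x) - 2 * p * c * (grad \<phi> x \<bullet> x) + c * c * (x \<bullet> x)"
      by (simp add: inner_diff_left inner_diff_right inner_commute[of x "grad \<phi> x"] algebra_simps)
    also have "x \<bullet> x = t\<^sup>2" by (simp add: t_def power2_norm_eq_inner)
    also have "c * c * t\<^sup>2 = a\<^sup>2 * ((\<psi> x)\<^sup>2 / t\<^sup>2)"
    proof -
      have "\<psi> x = p * \<phi> x" by (simp add: eq(1)[OF True] p_def t_def)
      then show ?thesis using t by (simp add: c_def power2_eq_square divide_simps)
    qed
    also have "2 * p * c * (grad \<phi> x \<bullet> x) = a * ((grad f x \<bullet> x) / t ^ ?N)"
    proof -
      have "p * p / t\<^sup>2 = 1 / t ^ ?N" using t by (simp add: pp)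
      moreover have "2 * p * c * (grad \<phi> x \<bullet> x) = a * (2 * \<phi> x * (grad \<phi> x \<bullet> x)) * (p * p / t\<^sup>2)"
        by (simp add: c_def)
      ultimately show ?thesis by (simp add: f(4))
    qed
    finally have "(norm (grad \<psi> x))\<^sup>2 - a\<^sup>2 * ((\<psi> x)\<^sup>2 / t\<^sup>2) = (p * p) * (norm (grad \<phi> x))\<^sup>2 - a * ((grad f x \<bullet> x) / t ^ ?N)"
      by (simp add: power2_norm_eq_inner)
    then show ?thesis using True hw by (simp add: t_def)
  next
    case False
    then show ?thesis by (simp add: indicator_def)
  qed
  define Q where "Q = (\<integral>x. ?q x \<partial>lborel)"
  have AB: "(\<integral>x. ?I x * (norm (grad \<psi> x))\<^sup>2 \<partial>lborel) - a\<^sup>2 * (\<integral>x. ?I x * ((\<psi> x)\<^sup>2 / (norm x)\<^sup>2) \<partial>lborel)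
      = (\<integral>x. ?I x * (hardy_weight x * (norm (grad \<phi> x))\<^sup>2) \<partial>lborel) - a * Q"
    unfolding Q_def integral_mult_right_zero[symmetric]
      Bochner_Integration.integral_diff[symmetric, OF i1 integrable_mult_right[OF i2]]
      Bochner_Integration.integral_diff[symmetric, OF i4 integrable_mult_right[OF iq]] ptw ..
  have sf: "(\<integral>\<^sup>+x. ennreal (f x) \<partial>sphere_measure r) = ennreal (- (r ^ ?N / r) * Q)"
    unfolding Q_def by (rule sphere_flux[OF f(1,2,3) r])
  have mf: "f \<in> borel_measurable (sphere_measure r)" unfolding f_def by measurable
  have isf: "integrable (sphere_measure r) f"
    by (rule integrableI_nonneg[OF mf]) (use f(3) sf in auto)
  have Q: "- (r ^ ?N / r) * Q \<ge> 0"
  proof -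
    obtain J where "Q = - (real ?N / r ^ ?N) * J" "J \<ge> 0"
      unfolding Q_def radial_flux(2)[OF f(1,2) r]
      using f(3) by (blast intro: Bochner_Integration.integral_nonneg mult_nonneg_nonneg indicator_pos_le)
    then show ?thesis using r by simp
  qed
  have intf: "(\<integral>x. f x \<partial>sphere_measure r) = - (r ^ ?N / r) * Q"
    using sf Q f(3) by (subst integral_eq_nn_integral[OF mf]) auto
  have psi_sphere: "AE x in sphere_measure r. (r powr (- a))\<^sup>2 * f x = (\<psi> x)\<^sup>2"
    using AE_sphere_measure[OF r]
    by eventually_elim (simp add: eq(1) f_def power_mult_distrib power2_eq_square)
  have mpsi: "(\<lambda>x. (\<psi> x)\<^sup>2) \<in> borel_measurable (sphere_measure r)" by measurable
  have mf': "(\<lambda>x. (r powr (- a))\<^sup>2 * f x) \<in> borel_measurable (sphere_measure r)" using mf by measurable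
  show "integrable (sphere_measure r) (\<lambda>x. (\<psi> x)\<^sup>2)"
    by (rule integrable_cong_AE_imp[OF integrable_mult_right[OF isf] mpsi]) (use psi_sphere in \<open>auto elim: eventually_mono\<close>)
  have "(\<integral>x. (\<psi> x)\<^sup>2 \<partial>sphere_measure r) = (\<integral>x. (r powr (- a))\<^sup>2 * f x \<partial>sphere_measure r)"
    by (rule integral_cong_AE[OF mpsi mf']) (use psi_sphere in \<open>auto elim: eventually_mono\<close>)
  also have "\<dots> = (r powr (- a))\<^sup>2 * (- (r ^ ?N / r) * Q)" by (simp add: intf)
  finally have "a * inverse r * (\<integral>x. (\<psi> x)\<^sup>2 \<partial>sphere_measure r) = - a * ((r powr (- a))\<^sup>2 * r ^ ?N / r\<^sup>2) * Q"
    by (simp add: field_simps power2_eq_square)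
  also have "(r powr (- a))\<^sup>2 * r ^ ?N / r\<^sup>2 = 1"
  proof -
    have "(r powr (- a))\<^sup>2 = r powr (2 - real ?N)"
      unfolding power2_eq_square powr_add[symmetric] aa ..
    also have "\<dots> = r\<^sup>2 / r ^ ?N" using r by (simp add: powr_diff powr_numeral powr_realpow)
    finally show ?thesis using r by simp
  qed
  finally show "(\<integral>x. (norm (grad \<psi> x))\<^sup>2 \<partial>M) - a\<^sup>2 * (\<integral>x. (\<psi> x)\<^sup>2 / (norm x)\<^sup>2 \<partial>M)
      - a * inverse r * (\<integral>x. (\<psi> x)\<^sup>2 \<partial>sphere_measure r)
      = (\<integral>x. hardy_weight x * (norm (grad \<phi> x))\<^sup>2 \<partial>M)"
    using AB by (simp add: e1(2) e2(2) e4(2) del: minus_diff_eq)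
qed

section \<open>The limit formula\<close>

text \<open>The data obtained from an element of \<open>H_space\<close>: the function \<open>v\<close>, its approximating test functions
  and the limit \<open>G\<close> of their gradients.\<close>

locale hardy_approximation =
  fixes \<Omega> :: "'a::euclidean_space set" and u v :: "'a \<Rightarrow> real"
    and \<phi> :: "nat \<Rightarrow> 'a \<Rightarrow> real" and G :: "'a \<Rightarrow> 'a" and a :: real
  assumes a_eq: "a = (real DIM('a) - 2) / 2"
    and dim: "DIM('a) \<ge> 3" and open_\<Omega>: "open \<Omega>" and bounded_\<Omega>: "bounded \<Omega>"
    and \<phi>_test: "\<And>k. \<phi> k \<in> test_functions \<Omega>"
    and \<phi>_lim: "L2_tendsto (weighted_measure \<Omega>) \<phi> v"
    and grad_lim: "L2_tendsto (weighted_measure \<Omega>) (\<lambda>k. grad (\<phi> k)) G"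
    and u_eq: "AE x in lebesgue. x \<in> \<Omega> \<longrightarrow> u x = norm x powr (- a) * v x"
begin

text \<open>The product rule for \<open>\<bar>x\<bar>\<^sup>-\<^sup>a v\<close> with \<open>G\<close> in the place of the gradient of \<open>v\<close>.\<close>

definition Gu :: "'a \<Rightarrow> 'a" where
  "Gu x = norm x powr (- a) *\<^sub>R G x - (a * norm x powr (- a - 2) * v x) *\<^sub>R x"

lemma a_pos: "a > 0" using dim by (simp add: a_eq)

lemma \<phi>_C1: "Ck 1 (\<phi> k)"
  by (rule test_functionD(1)[OF \<phi>_test])

lemma unweighted:
  assumes "S \<subseteq> \<Omega>" "S \<in> sets lebesgue"
  shows "L2_tendsto (lebesgue_on S) \<phi> v"
    "L2_tendsto (lebesgue_on S) (\<lambda>k. grad (\<phi> k)) G"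
  using L2_tendsto_unweighted[OF \<phi>_lim open_\<Omega> bounded_\<Omega>] L2_tendsto_unweighted[OF grad_lim open_\<Omega> bounded_\<Omega>]
    dim assms open_\<Omega> by (auto intro: L2_tendsto_restrict_subset)

lemma exterior_sets: "\<Omega> - ball 0 r \<in> sets lebesgue" "\<Omega> - cball 0 r \<in> sets lebesgue"
  using open_\<Omega> by (auto intro!: sets.Diff)

lemma borel_restrict_lebesgue:
  "f \<in> borel_measurable borel \<Longrightarrow> f \<in> borel_measurable (lebesgue_on S)"
  by (intro measurable_restrict_space1) (simp add: measurable_completion)

lemma scaled_gradients:
  assumes r: "r > 0"
  shows "L2_tendsto (lebesgue_on (\<Omega> - ball 0 r))
    (\<lambda>k x. norm x powr (- a) *\<^sub>R grad (\<phi> k) x) (\<lambda>x. norm x powr (- a) *\<^sub>R G x)"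
proof -
  let ?M = "lebesgue_on (\<Omega> - ball 0 r)"
  have L: "L2_tendsto ?M (\<lambda>k. grad (\<phi> k)) G" by (rule unweighted) (auto simp: exterior_sets)
  have m: "grad (\<phi> k) \<in> borel_measurable ?M" "G \<in> borel_measurable ?M" for k
    using L by (auto simp: L2_tendsto_def)
  have mp: "(\<lambda>x::'a. norm x powr (- a)) \<in> borel_measurable ?M" by (rule borel_restrict_lebesgue) measurable
  show ?thesis
  proof (rule L2_tendsto_dominated[OF L, where C = "r powr (- a)"])
    show "(\<lambda>x. norm x powr (- a) *\<^sub>R grad (\<phi> k) x) \<in> borel_measurable ?M"
      "(\<lambda>x. norm x powr (- a) *\<^sub>R G x) \<in> borel_measurable ?M" for k
      using m mp by (auto intro: borel_measurable_scaleR)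
    show "AE x in ?M. norm (norm x powr (- a) *\<^sub>R grad (\<phi> k) x - norm x powr (- a) *\<^sub>R G x)
        \<le> r powr (- a) * norm (grad (\<phi> k) x - G x)" for k
    proof (rule AE_I2)
      fix x assume "x \<in> space ?M"
      then have x: "norm x \<ge> r" by (auto simp: space_restrict_space)
      have "norm x powr (- a) \<le> r powr (- a)" using x r a_pos by (intro powr_mono2') auto
      then show "norm (norm x powr (- a) *\<^sub>R grad (\<phi> k) x - norm x powr (- a) *\<^sub>R G x)
        \<le> r powr (- a) * norm (grad (\<phi> k) x - G x)"
        by (simp add: scaleR_diff_right[symmetric] mult_right_mono)
    qed
  qed simp
qed

text \<open>Traces are defined through functions that are \<open>C\<^sup>1\<close> on the whole space, while \<open>\<bar>x\<bar>\<^sup>-\<^sup>a\<close> is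
  singular at the origin. The test functions are therefore multiplied by a \<open>C\<^sup>1\<close> function that agrees
  with \<open>\<bar>x\<bar>\<^sup>-\<^sup>a\<close> outside the ball.\<close>

lemma approximants:
  assumes r: "r > 0"
  obtains \<psi> where "\<And>k. Ck 1 (\<psi> k)" "\<And>k. bounded {x. \<psi> k x \<noteq> 0}"
    "\<And>k. \<forall>x. x \<notin> \<Omega> \<longrightarrow> \<psi> k x = 0 \<and> grad (\<psi> k) x = 0"
    "\<And>k. \<forall>x. r \<le> norm x \<longrightarrow> \<psi> k x = norm x powr (- a) * \<phi> k x"
    "\<And>k. \<forall>x. r \<le> norm x \<longrightarrow>
      grad (\<psi> k) x = norm x powr (- a) *\<^sub>R grad (\<phi> k) x - (a * norm x powr (- a - 2) * \<phi> k x) *\<^sub>R x"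
    "L2_tendsto (lebesgue_on (\<Omega> - ball 0 r)) \<psi> u"
    "L2_tendsto (lebesgue_on (\<Omega> - ball 0 r)) (\<lambda>k. grad (\<psi> k)) Gu"
proof -
  let ?S = "\<Omega> - ball 0 r"
  let ?M = "lebesgue_on ?S"
  obtain \<rho> :: "'a \<Rightarrow> real" where \<rho>: "Ck 1 \<rho>" "\<And>x. norm x \<ge> r \<Longrightarrow> \<rho> x = norm x powr (- a)"
    "\<And>x. norm x \<ge> r \<Longrightarrow> grad \<rho> x = (- (a * norm x powr (- a - 2))) *\<^sub>R x"
    by (rule powr_norm_C1_extension[OF r], rule that)
  define \<psi> where "\<psi> k x = \<rho> x * \<phi> k x" for k x
  have \<psi>e: "\<psi> k = (\<lambda>x. \<rho> x * \<phi> k x)" for k by (simp add: \<psi>_def fun_eq_iff)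
  have 1: "Ck 1 (\<psi> k)" for k unfolding \<psi>e by (rule Ck_mult[OF \<rho>(1) \<phi>_C1])
  have g: "grad (\<psi> k) x = \<rho> x *\<^sub>R grad (\<phi> k) x + \<phi> k x *\<^sub>R grad \<rho> x" for k x
    unfolding \<psi>e by (rule grad_mult[OF \<rho>(1) \<phi>_C1])
  have 2: "bounded {x. \<psi> k x \<noteq> 0}" for k
    by (rule bounded_subset[OF test_functionD(2)[OF \<phi>_test[of k]]]) (auto simp: \<psi>_def)
  have 3: "\<psi> k x = 0 \<and> grad (\<psi> k) x = 0" if "x \<notin> \<Omega>" for k x
    using test_function_outside[OF \<phi>_test that, of k] by (simp add: \<psi>_def g)
  have 4: "\<psi> k x = norm x powr (- a) * \<phi> k x" if "norm x \<ge> r" for k x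
    by (simp add: \<psi>_def \<rho>(2)[OF that])
  have 5: "grad (\<psi> k) x = norm x powr (- a) *\<^sub>R grad (\<phi> k) x - (a * norm x powr (- a - 2) * \<phi> k x) *\<^sub>R x"
    if "norm x \<ge> r" for k x
    unfolding g \<rho>(2)[OF that] \<rho>(3)[OF that] by (simp add: mult.commute)
  have L: "L2_tendsto ?M \<phi> v" by (rule unweighted) (auto simp: exterior_sets)
  have S: "?S \<in> sets lebesgue" by (rule exterior_sets)
  have spM: "norm x \<ge> r" if "x \<in> space ?M" for x using that by (auto simp: space_restrict_space)
  have mv: "v \<in> borel_measurable ?M" "\<phi> k \<in> borel_measurable ?M" for k using L by (auto simp: L2_tendsto_def)
  have mp: "(\<lambda>x::'a. norm x powr c) \<in> borel_measurable ?M" for c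
    by (rule borel_restrict_lebesgue) measurable
  have mid: "(\<lambda>x::'a. x) \<in> borel_measurable ?M" by (rule borel_restrict_lebesgue) measurable
  have u_eq': "AE x in ?M. u x = norm x powr (- a) * v x"
    using u_eq S by (subst AE_restrict_space_iff) (auto elim: eventually_mono)
  have 6: "L2_tendsto ?M \<psi> u"
  proof (rule L2_tendsto_dominated[OF L, where C = "r powr (- a)"])
    show "\<psi> k \<in> borel_measurable ?M" for k
      by (rule borel_restrict_lebesgue) (rule continuous_imp_borel_lebesgue(1)[OF Ck_1D(3)[OF 1]])
    show "u \<in> borel_measurable ?M"
    proof (rule measurable_restrict_cong_AE[OF _ S])
      show "(\<lambda>x. norm x powr (- a) * v x) \<in> borel_measurable ?M"
        by (intro borel_measurable_times mp mv)
      show "AE x in lebesgue. x \<in> ?S \<longrightarrow> u x = norm x powr (- a) * v x"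
        using u_eq by eventually_elim simp
    qed
    show "AE x in ?M. norm (\<psi> k x - u x) \<le> r powr (- a) * norm (\<phi> k x - v x)" for k
      using u_eq' AE_space
    proof eventually_elim
      case (elim x)
      then have x: "norm x \<ge> r" by (intro spM)
      have "norm x powr (- a) \<le> r powr (- a)" using x r a_pos by (intro powr_mono2') auto
      moreover have "\<psi> k x - u x = norm x powr (- a) * (\<phi> k x - v x)"
        using elim(1) 4[OF x] by (simp add: right_diff_distrib)
      ultimately show ?case by (simp add: abs_mult mult_right_mono)
    qed
  qed simp
  let ?w = "\<lambda>f x. (- (a * norm x powr (- a - 2) * f x)) *\<^sub>R (x::'a)"
  have mw: "?w f \<in> borel_measurable ?M" if "f \<in> borel_measurable ?M" for f
    by (intro borel_measurable_scaleR borel_measurable_uminus borel_measurable_times mp mid that borel_measurable_const)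
  have "L2_tendsto ?M (\<lambda>k. ?w (\<phi> k)) (?w v)"
  proof (rule L2_tendsto_dominated[OF L, where C = "a * r powr (- a - 1)"])
    show "?w (\<phi> k) \<in> borel_measurable ?M" "?w v \<in> borel_measurable ?M" for k
      by (rule mw mv)+
    show "AE x in ?M. norm (?w (\<phi> k) x - ?w v x) \<le> a * r powr (- a - 1) * norm (\<phi> k x - v x)" for k
    proof (rule AE_I2)
      fix x assume "x \<in> space ?M"
      then have x: "norm x \<ge> r" by (rule spM)
      have "?w (\<phi> k) x - ?w v x = (- (a * norm x powr (- a - 2) * (\<phi> k x - v x))) *\<^sub>R x"
        by (simp only: scaleR_diff_left[symmetric] right_diff_distrib minus_diff_minus)
      then have "norm (?w (\<phi> k) x - ?w v x) = a * (norm x powr (- a - 2) * norm x) * norm (\<phi> k x - v x)"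
        using a_pos by (simp add: abs_mult)
      also have "norm x powr (- a - 2) * norm x = norm x powr (- a - 1)"
      proof -
        have "norm x powr (- a - 2) * norm x = norm x powr (- a - 2) * norm x powr 1" using x r by simp
        also have "\<dots> = norm x powr ((- a - 2) + 1)" by (rule powr_add[symmetric])
        also have "(- a - 2) + 1 = - a - 1" by simp
        finally show ?thesis .
      qed
      also have "norm x powr (- a - 1) \<le> r powr (- a - 1)" using x r a_pos by (intro powr_mono2') auto
      finally show "norm (?w (\<phi> k) x - ?w v x) \<le> a * r powr (- a - 1) * norm (\<phi> k x - v x)"
        using a_pos by (simp add: mult_right_mono)
    qed
    show "0 \<le> a * r powr (- a - 1)" using a_pos by simp
  qed
  note sum = L2_tendsto_add[OF scaled_gradients[OF r] this]
  have 7: "L2_tendsto ?M (\<lambda>k. grad (\<psi> k)) Gu"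
  proof (rule L2_tendsto_dominated[OF sum, where C = 1])
    show "grad (\<psi> k) \<in> borel_measurable ?M" for k
      by (rule borel_restrict_lebesgue) (rule continuous_imp_borel_lebesgue(1)[OF Ck_1D(2)[OF 1]])
    have "Gu = (\<lambda>x. norm x powr (- a) *\<^sub>R G x + ?w v x)" by (simp add: Gu_def fun_eq_iff)
    then show "Gu \<in> borel_measurable ?M" using sum by (simp add: L2_tendsto_def)
    show "AE x in ?M. norm (grad (\<psi> k) x - Gu x) \<le>
        1 * norm (norm x powr (- a) *\<^sub>R grad (\<phi> k) x + ?w (\<phi> k) x - (norm x powr (- a) *\<^sub>R G x + ?w v x))" for k
      by (rule AE_I2) (simp add: 5[OF spM] Gu_def)
  qed simp
  show thesis by (rule that[of \<psi>]) (use 1 2 3 4 5 6 7 in blast)+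
qed

text \<open>A compact set that avoids the origin avoids a ball around it, and outside that ball \<open>u\<close> is a limit
  of \<open>C\<^sup>1\<close> functions.\<close>

lemma weak_gradient_u: "is_weak_gradient (\<Omega> - {0}) u Gu"
proof (rule weak_gradient_local)
  fix K assume K: "compact K" "K \<subseteq> \<Omega> - {0}"
  then have "open (- K)" "0 \<in> - K" by (auto simp: compact_imp_closed)
  then obtain e where e: "e > 0" "cball 0 e \<subseteq> - K" by (auto simp: open_contains_cball)
  obtain \<psi> where \<psi>: "\<And>k. Ck 1 (\<psi> k)"
    "L2_tendsto (lebesgue_on (\<Omega> - ball 0 e)) \<psi> u"
    "L2_tendsto (lebesgue_on (\<Omega> - ball 0 e)) (\<lambda>k. grad (\<psi> k)) Gu"
    by (rule approximants[OF e(1)], rule that)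
  have s: "\<Omega> - cball 0 e \<subseteq> \<Omega> - ball 0 e" by auto
  have "is_weak_gradient (\<Omega> - cball 0 e) u Gu"
    by (rule weak_gradient_L2_limit[OF open_Diff[OF open_\<Omega> closed_cball] \<psi>(1)
        L2_tendsto_restrict_subset[OF \<psi>(2) s exterior_sets] L2_tendsto_restrict_subset[OF \<psi>(3) s exterior_sets]])
  moreover have "K \<subseteq> \<Omega> - cball 0 e" "\<Omega> - cball 0 e \<subseteq> \<Omega> - {0}" using K e by auto
  ultimately show "\<exists>V. K \<subseteq> V \<and> V \<subseteq> \<Omega> - {0} \<and> is_weak_gradient V u Gu" by blast
qed

lemma weak_gradient_v: "is_weak_gradient \<Omega> v G"
  by (rule weak_gradient_L2_limit[OF open_\<Omega> \<phi>_C1]) (use unweighted[of \<Omega>] open_\<Omega> in auto)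

text \<open>All four integrals in the identity for the approximants are squared \<open>L\<^sup>2\<close> norms, so the identity
  passes to the limit.\<close>

lemma exact_formula:
  assumes r: "0 < r" "r < R" "cball 0 R \<subseteq> \<Omega>"
  shows "hardy_exterior \<Omega> r u - hardy_surface \<Omega> r u
    = (\<integral>x. indicator (\<Omega> - ball 0 r) x * (hardy_weight x * (norm (G x))\<^sup>2) \<partial>lebesgue)"
proof -
  let ?S = "\<Omega> - ball 0 r"
  let ?M = "lebesgue_on ?S"
  have S: "?S \<in> sets lebesgue" "?S \<inter> space lebesgue \<in> sets lebesgue" using exterior_sets by auto
  obtain \<psi> where \<psi>: "\<And>k. Ck 1 (\<psi> k)" "\<And>k. bounded {x. \<psi> k x \<noteq> 0}"
    "\<And>k. \<forall>x. x \<notin> \<Omega> \<longrightarrow> \<psi> k x = 0 \<and> grad (\<psi> k) x = 0"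
    "\<And>k. \<forall>x. r \<le> norm x \<longrightarrow> \<psi> k x = norm x powr (- a) * \<phi> k x"
    "\<And>k. \<forall>x. r \<le> norm x \<longrightarrow>
      grad (\<psi> k) x = norm x powr (- a) *\<^sub>R grad (\<phi> k) x - (a * norm x powr (- a - 2) * \<phi> k x) *\<^sub>R x"
    "L2_tendsto ?M \<psi> u" "L2_tendsto ?M (\<lambda>k. grad (\<psi> k)) Gu"
    by (rule approximants[OF r(1)], rule that)
  have spM: "norm x \<ge> r" if "x \<in> space ?M" for x using that by (auto simp: space_restrict_space)
  have a0: "a \<ge> 0" using a_pos by simp
  note ident = exterior_identity[OF a_eq a0 open_\<Omega> r(1) \<phi>_test \<psi>(1-5)]
  have l1: "(\<lambda>k. \<integral>x. (norm (grad (\<psi> k) x))\<^sup>2 \<partial>?M) \<longlonglongrightarrow> (\<integral>x. (norm (Gu x))\<^sup>2 \<partial>?M)"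
    by (rule L2_tendsto_norm(2)[OF \<psi>(7) ident(1)])
  have "L2_tendsto ?M (\<lambda>k x. \<psi> k x / norm x) (\<lambda>x. u x / norm x)"
  proof (rule L2_tendsto_dominated[OF \<psi>(6), where C = "1 / r"])
    have m: "u \<in> borel_measurable ?M" "\<psi> k \<in> borel_measurable ?M" for k using \<psi>(6) by (auto simp: L2_tendsto_def)
    have mn: "(\<lambda>x::'a. norm x) \<in> borel_measurable ?M" by (rule borel_restrict_lebesgue) measurable
    show "(\<lambda>x. \<psi> k x / norm x) \<in> borel_measurable ?M" "(\<lambda>x. u x / norm x) \<in> borel_measurable ?M" for k
      using m mn by (auto intro: borel_measurable_divide)
    show "AE x in ?M. norm (\<psi> k x / norm x - u x / norm x) \<le> 1 / r * norm (\<psi> k x - u x)" for k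
    proof (rule AE_I2)
      fix x assume "x \<in> space ?M"
      then have "norm x \<ge> r" by (rule spM)
      moreover from this have "0 < norm x" using r by linarith
      ultimately have "\<bar>\<psi> k x - u x\<bar> / norm x \<le> \<bar>\<psi> k x - u x\<bar> / r"
        using r by (intro divide_left_mono mult_pos_pos) auto
      then show "norm (\<psi> k x / norm x - u x / norm x) \<le> 1 / r * norm (\<psi> k x - u x)"
        by (simp add: diff_divide_distrib[symmetric])
    qed
  qed (use r in simp)
  from L2_tendsto_norm(2)[OF this] have l2: "(\<lambda>k. \<integral>x. (\<psi> k x)\<^sup>2 / (norm x)\<^sup>2 \<partial>?M) \<longlonglongrightarrow> (\<integral>x. (u x)\<^sup>2 / (norm x)\<^sup>2 \<partial>?M)"
    using ident(2) by (simp add: power_divide)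
  have s: "\<Omega> - cball 0 r \<subseteq> ?S" by auto
  have tr: "L2_tendsto (sphere_measure r) \<psi> (sphere_trace \<Omega> r u)"
    by (rule sphere_trace_limit[OF open_\<Omega> r \<psi>(1)
        L2_tendsto_restrict_subset[OF \<psi>(6) s exterior_sets] L2_tendsto_restrict_subset[OF \<psi>(7) s exterior_sets]])
  from L2_tendsto_norm(2)[OF tr] have l3: "(\<lambda>k. \<integral>x. (\<psi> k x)\<^sup>2 \<partial>sphere_measure r) \<longlonglongrightarrow> (\<integral>x. (sphere_trace \<Omega> r u x)\<^sup>2 \<partial>sphere_measure r)"
    using ident(3) by simp
  have aa: "- a + - a = - (real DIM('a) - 2)" by (simp add: a_eq)
  have sq: "(norm (norm x powr (- a) *\<^sub>R y))\<^sup>2 = hardy_weight x * (norm y)\<^sup>2" for x y :: 'a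
  proof -
    have "(norm x powr (- a))\<^sup>2 = hardy_weight x"
      unfolding power2_eq_square powr_add[symmetric] aa ..
    then show ?thesis by (simp only: norm_scaleR power_mult_distrib power2_abs)
  qed
  from L2_tendsto_norm(2)[OF scaled_gradients[OF r(1)], unfolded sq, OF ident(4)]
  have l4: "(\<lambda>k. \<integral>x. hardy_weight x * (norm (grad (\<phi> k) x))\<^sup>2 \<partial>?M) \<longlonglongrightarrow> (\<integral>x. hardy_weight x * (norm (G x))\<^sup>2 \<partial>?M)" .
  have "(\<lambda>k. (\<integral>x. (norm (grad (\<psi> k) x))\<^sup>2 \<partial>?M) - a\<^sup>2 * (\<integral>x. (\<psi> k x)\<^sup>2 / (norm x)\<^sup>2 \<partial>?M)
      - a * inverse r * (\<integral>x. (\<psi> k x)\<^sup>2 \<partial>sphere_measure r)) \<longlonglongrightarrow>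
      (\<integral>x. (norm (Gu x))\<^sup>2 \<partial>?M) - a\<^sup>2 * (\<integral>x. (u x)\<^sup>2 / (norm x)\<^sup>2 \<partial>?M)
      - a * inverse r * (\<integral>x. (sphere_trace \<Omega> r u x)\<^sup>2 \<partial>sphere_measure r)"
    by (intro tendsto_diff tendsto_mult tendsto_const l1 l2 l3)
  from LIMSEQ_unique[OF this[unfolded ident(5)] l4]
  have main: "(\<integral>x. (norm (Gu x))\<^sup>2 \<partial>?M) - a\<^sup>2 * (\<integral>x. (u x)\<^sup>2 / (norm x)\<^sup>2 \<partial>?M)
      - a * inverse r * (\<integral>x. (sphere_trace \<Omega> r u x)\<^sup>2 \<partial>sphere_measure r) = (\<integral>x. hardy_weight x * (norm (G x))\<^sup>2 \<partial>?M)" .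
  have "(LINT x:?S|lebesgue. (norm (weak_grad (\<Omega> - {0}) u x))\<^sup>2) = (LINT x:?S|lebesgue. (norm (Gu x))\<^sup>2)"
  proof -
    have "AE x in lebesgue. x \<in> \<Omega> - {0} \<longrightarrow> weak_grad (\<Omega> - {0}) u x = Gu x"
      by (rule weak_grad_unique(1)[OF open_Diff[OF open_\<Omega>] weak_gradient_u]) simp
    then show ?thesis
      unfolding set_lebesgue_integral_def
      by (intro integral_lebesgue_cong_AE, elim eventually_mono) (use r in \<open>auto simp: indicator_def\<close>)
  qed
  also have "\<dots> = (\<integral>x. (norm (Gu x))\<^sup>2 \<partial>?M)"
    unfolding set_lebesgue_integral_def by (rule integral_restrict_space[OF S(2), symmetric])
  finally have h1: "(LINT x:?S|lebesgue. (norm (weak_grad (\<Omega> - {0}) u x))\<^sup>2) = (\<integral>x. (norm (Gu x))\<^sup>2 \<partial>?M)" .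
  have h2: "(LINT x:?S|lebesgue. (u x)\<^sup>2 / (norm x)\<^sup>2) = (\<integral>x. (u x)\<^sup>2 / (norm x)\<^sup>2 \<partial>?M)"
    unfolding set_lebesgue_integral_def by (rule integral_restrict_space[OF S(2), symmetric])
  have h3: "(\<integral>x. hardy_weight x * (norm (G x))\<^sup>2 \<partial>?M)
      = (\<integral>x. indicator ?S x * (hardy_weight x * (norm (G x))\<^sup>2) \<partial>lebesgue)"
    by (subst integral_restrict_space[OF S(2)]) simp
  show ?thesis
    unfolding hardy_exterior_def hardy_surface_def h1 h2 a_eq[symmetric] using main h3 by simp
qed

lemma weighted_energy_integrable:
  "integrable lebesgue (\<lambda>x. indicator \<Omega> x * (hardy_weight x * (norm (G x))\<^sup>2))"
proof -
  have dim2: "DIM('a) \<ge> 2" using dim by simp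
  have m: "grad (\<phi> k) \<in> borel_measurable (weighted_measure \<Omega>)" "G \<in> borel_measurable (weighted_measure \<Omega>)" for k
    using grad_lim by (auto simp: L2_tendsto_def)
  have fin: "nn_sq_norm (weighted_measure \<Omega>) (grad (\<phi> k)) < \<infinity>" for k
    unfolding Htilde_norm_test[OF \<phi>_test open_\<Omega> dim2] by simp
  have ik: "integrable (weighted_measure \<Omega>) (\<lambda>x. (norm (grad (\<phi> k) x))\<^sup>2)" for k
  proof (rule integrableI_bounded)
    show "(\<lambda>x. (norm (grad (\<phi> k) x))\<^sup>2) \<in> borel_measurable (weighted_measure \<Omega>)" using m(1) by measurable
  qed (use fin in simp)
  have iG: "integrable (weighted_measure \<Omega>) (\<lambda>x. (norm (G x))\<^sup>2)"
    by (rule L2_tendsto_norm(1)[OF grad_lim ik])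
  have mG: "(\<lambda>x. (norm (G x))\<^sup>2) \<in> borel_measurable (lebesgue_on \<Omega>)"
    using m(2) unfolding measurable_weighted_measure by measurable
  have mw: "(\<lambda>x::'a. hardy_weight x) \<in> borel_measurable (lebesgue_on \<Omega>)"
    by (rule borel_restrict_lebesgue) measurable
  have "integrable (lebesgue_on \<Omega>) (\<lambda>x. hardy_weight x *\<^sub>R (norm (G x))\<^sup>2)"
    using iG mw mG unfolding weighted_measure_def by (subst (asm) integrable_density) auto
  then show ?thesis
    using open_\<Omega> by (subst (asm) integrable_restrict_space) auto
qed

text \<open>Multiplying \<open>u\<close> by \<open>\<bar>x\<bar>\<^sup>a\<close> gives back \<open>v\<close> away from the origin.\<close>

lemma H_norm_u: "(H_norm \<Omega> u)\<^sup>2 = (\<integral>x. indicator \<Omega> x * (hardy_weight x * (norm (G x))\<^sup>2) \<partial>lebesgue)"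
proof -
  have "AE x in lebesgue. x \<noteq> (0::'a)"
    by (intro AE_completion AE_lborel_singleton)
  then have "AE x in lebesgue. x \<in> \<Omega> \<longrightarrow> norm x powr a * u x = v x"
    using u_eq by eventually_elim (simp add: powr_minus)
  then have wg: "weak_grad \<Omega> (\<lambda>x. norm x powr a * u x) = weak_grad \<Omega> v"
    by (rule weak_grad_cong_AE)
  have "AE x in lebesgue. x \<in> \<Omega> \<longrightarrow> weak_grad \<Omega> v x = G x"
    by (rule weak_grad_unique(1)[OF open_\<Omega> weak_gradient_v])
  then have "(LINT x:\<Omega>|lebesgue. hardy_weight x * (norm (weak_grad \<Omega> v x))\<^sup>2)
      = (\<integral>x. indicator \<Omega> x * (hardy_weight x * (norm (G x))\<^sup>2) \<partial>lebesgue)"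
    unfolding set_lebesgue_integral_def
    by (intro integral_lebesgue_cong_AE, elim eventually_mono) (auto simp: indicator_def)
  moreover have "0 \<le> (\<integral>x. indicator \<Omega> x * (hardy_weight x * (norm (G x))\<^sup>2) \<partial>lebesgue)"
    by (intro Bochner_Integration.integral_nonneg) auto
  ultimately show ?thesis
    unfolding H_norm_def Htilde_norm_def a_eq[symmetric] wg by simp
qed

lemma hardy_limit:
  assumes "0 \<in> \<Omega>"
  shows "((\<lambda>\<epsilon>. hardy_exterior \<Omega> \<epsilon> u - hardy_surface \<Omega> \<epsilon> u) \<longlongrightarrow> (H_norm \<Omega> u)\<^sup>2) (at_right 0)"
proof -
  obtain R where R: "R > 0" "cball 0 R \<subseteq> \<Omega>"
    using open_\<Omega> assms by (auto simp: open_contains_cball)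
  let ?h = "\<lambda>x. hardy_weight x * (norm (G x))\<^sup>2"
  let ?J = "\<lambda>\<epsilon>. \<integral>x. indicator (\<Omega> - ball 0 \<epsilon>) x * ?h x \<partial>lebesgue"
  note i = weighted_energy_integrable
  have "(?J \<longlongrightarrow> (\<integral>x. indicator \<Omega> x * ?h x \<partial>lebesgue)) (at_right 0)"
    unfolding tendsto_at_iff_sequentially comp_def
  proof (intro allI impI)
    fix X :: "nat \<Rightarrow> real" assume X: "\<forall>n. X n \<in> {0<..} - {0}" "X \<longlonglongrightarrow> 0"
    show "(\<lambda>n. ?J (X n)) \<longlonglongrightarrow> (\<integral>x. indicator \<Omega> x * ?h x \<partial>lebesgue)"
    proof (rule integral_dominated_convergence[where w = "\<lambda>x. indicator \<Omega> x * ?h x"])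
      show "(\<lambda>x. indicator \<Omega> x * ?h x) \<in> borel_measurable lebesgue"
        by (rule borel_measurable_integrable[OF i])
      show "(\<lambda>x. indicator (\<Omega> - ball 0 (X n)) x * ?h x) \<in> borel_measurable lebesgue" for n
      proof -
        have "(\<lambda>x. indicator (\<Omega> - ball 0 (X n)) x * ?h x)
            = (\<lambda>x. indicator (\<Omega> - ball 0 (X n)) x *\<^sub>R (indicator \<Omega> x * ?h x))"
          by (auto simp: fun_eq_iff indicator_def)
        then show ?thesis
          using integrable_mult_indicator[OF exterior_sets(1)[of "X n"] i] by (simp add: borel_measurable_integrable)
      qed
      show "integrable lebesgue (\<lambda>x. indicator \<Omega> x * ?h x)" by (rule i)
      show "AE x in lebesgue. norm (indicator (\<Omega> - ball 0 (X n)) x * ?h x) \<le> indicator \<Omega> x * ?h x" for n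
        by (intro AE_I2) (auto simp: indicator_def)
      have "AE x in lebesgue. x \<noteq> (0::'a)"
        by (intro AE_completion AE_lborel_singleton)
      then show "AE x in lebesgue. (\<lambda>n. indicator (\<Omega> - ball 0 (X n)) x * ?h x) \<longlonglongrightarrow> indicator \<Omega> x * ?h x"
      proof eventually_elim
        case (elim x)
        have "\<forall>\<^sub>F n in sequentially. X n < norm x"
          using X(2) elim by (intro order_tendstoD) auto
        then have "\<forall>\<^sub>F n in sequentially. indicator (\<Omega> - ball 0 (X n)) x * ?h x = indicator \<Omega> x * ?h x"
          by eventually_elim (auto simp: indicator_def)
        then show ?case by (rule tendsto_eventually)
      qed
    qed
  qed
  moreover have "\<forall>\<^sub>F \<epsilon> in at_right 0. ?J \<epsilon> = hardy_exterior \<Omega> \<epsilon> u - hardy_surface \<Omega> \<epsilon> u"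
    using R exact_formula by (intro eventually_at_rightI[of 0 R]) auto
  ultimately show ?thesis
    unfolding H_norm_u by (rule Lim_transform_eventually)
qed

end

theorem mainTheorem2:
  fixes \<Omega> :: "'a::euclidean_space set" and u :: "'a \<Rightarrow> real"
  assumes "DIM('a) \<ge> 3"
    and "open \<Omega>" and "connected \<Omega>" and "bounded \<Omega>" and "0 \<in> \<Omega>"
    and "u \<in> H_space \<Omega>"
  shows "((\<lambda>\<epsilon>. hardy_exterior \<Omega> \<epsilon> u - hardy_surface \<Omega> \<epsilon> u) \<longlongrightarrow> (H_norm \<Omega> u)\<^sup>2) (at_right 0)"
proof -
  obtain v where v: "v \<in> Htilde \<Omega>" and
    u: "AE x in lebesgue. x \<in> \<Omega> \<longrightarrow> u x = norm x powr (- ((real DIM('a) - 2) / 2)) * v x"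
    using assms(6) unfolding H_space_def by blast
  have "DIM('a) \<ge> 2" using assms(1) by simp
  obtain \<phi> G where "\<And>k. \<phi> k \<in> test_functions \<Omega>" "L2_tendsto (weighted_measure \<Omega>) \<phi> v"
    "L2_tendsto (weighted_measure \<Omega>) (\<lambda>k. grad (\<phi> k)) G"
    by (rule Htilde_sequence[OF v assms(2) \<open>DIM('a) \<ge> 2\<close>], rule that)
  then interpret hardy_approximation \<Omega> u v \<phi> G "(real DIM('a) - 2) / 2"
    using assms u by unfold_locales auto
  show ?thesis by (rule hardy_limit[OF assms(5)])
qed

end
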